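(* Let $q\in\mathbb{C}\setminus\{0,1\}$. Let $\boldsymbol\Theta=(\Theta_0,\Theta_1,\Theta_t,\Theta_\infty)\in(\mathbb{C}^* )^4$ be such that $\Theta_0^2\ne1$, $\Theta_1^2\neq1$, $\Theta_t^2\ne1$, $\Theta_\infty^2\neq q$, and put $\overline\Theta_i=1/\Theta_i$. Let $t\in\mathbb{C}^*\setminus S_q$, where $$S_q=\{\Theta_1^{\varepsilon_1}\Theta_t^{\varepsilon_t},\ \Theta_0^{\varepsilon_0}\Theta_\infty^{\varepsilon_\infty}\mid\varepsilon_0,\varepsilon_1,\varepsilon_t,\varepsilon_\infty\in\{-1,1\}\}\cdot q^{\mathbb{Z}}.$$ Consider the birational map $\varphi:\mathfrak{P}_t\dashrightarrow\widetilde{\mathfrak{P}}_t$ given, with respect to the standard coordinates, by $$(y,z)\mapsto(u,v)=\left(y,\ \frac{(y-t\Theta_t)(y-t\overline\Theta_t)-q(y-1)(y-t)z}{q(q-1)z}\right).$$ This map is biregular and induces bijections $$\mathcal{V}_t^{\pm*}\simeq\mathcal{E}_t^\pm,\quad\mathcal{F}_t^\pm\simeq\mathcal{D}_t^{\pm*}\quad\text{and}\quad\mathcal{F}_i^\pm\simeq\mathcal{E}_i^\pm\quad\text{for all } i\in\{0,1,\infty\}.$$ Moreover, it induces a bijection $\boldsymbol{J}^t\stackrel{\sim}{\to}\boldsymbol{I}^t$ and therefore provides an isomorphism $q\mathrm{Oka}_t=\mathfrak{P}_t\setminus\boldsymbol{J}^t\ \stackrel{\sim}{\longrightarrow}\ 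q\widetilde{\mathrm{Oka}}_t=\widetilde{\mathfrak{P}}_t\setminus\boldsymbol{I}^t$.
   Context: The surface $\mathfrak{P}_t$. On $\mathbb{F}_0=\mathbb{P}^1\times\mathbb{P}^1$ with standard coordinates $(y,z)$ consider the eight points $\gamma_0^-=(0,t\Theta_0/q)$, $\gamma_0^+=(0,t\overline\Theta_0/q)$, $\gamma_1^-=(\overline\Theta_1,\infty)$, $\gamma_1^+=(\Theta_1,\infty)$, $\gamma_t^-=(t\Theta_t,0)$, $\gamma_t^+=(t\overline\Theta_t,0)$, $\gamma_\infty^-=(\infty,\overline\Theta_\infty)$, $\gamma_\infty^+=(\infty,\Theta_\infty/q)$. $\mathfrak{P}_t$ is the blow-up of $\mathbb{P}^1\times\mathbb{P}^1$ at these eight points; $\mathcal{F}_i^\pm$ is the exceptional line over $\gamma_i^\pm$. $\mathcal{V}_t^{+*},\mathcal{V}_t^{-*}$ are the strict transforms of $\{y=t\overline\Theta_t\}$, $\{y=t\Theta_t\}$ respectively, and $\boldsymbol{J}^t\subset\mathfrak{P}_t$ is the union of the strict transforms of the lines $\{z=0\},\{z=\infty\},\{y=0\},\{y=\infty\}$. The surface $\widetilde{\mathfrak{P}}_t$. $\mathbb{F}_2$ is the second Hirzebruch surface with four charts $\mathbb{C}^2$ with coordinates $(u,v)$ (standard coordinates), $(u_1,v_1)=(u,\frac1v)$, $(u_2,v_2)=(\frac1u,\frac v{u^2})$, $(u_3,v_3)=(\frac1u,\frac{u^2}{v})$. Consider the eight points $\beta_0^-:(u,v)=(0,\frac{t(\overline\Theta_0-1)}{q-1})$,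 $\beta_0^+:(u,v)=(0,\frac{t(\Theta_0-1)}{q-1})$, $\beta_1^-:(u,v)=(\overline\Theta_1,\frac{(\overline\Theta_1-1)(t-\overline\Theta_1)}{q-1})$, $\beta_1^+:(u,v)=(\Theta_1,\frac{(\Theta_1-1)(t-\Theta_1)}{q-1})$, $\beta_t^-:(u,v)=(t\Theta_t,-\frac{t(\Theta_t-1)(t\Theta_t-1)}{q-1})$, $\beta_t^+:(u,v)=(t\overline\Theta_t,-\frac{t(\overline\Theta_t-1)(t\overline\Theta_t-1)}{q-1})$, $\beta_\infty^-:(u_2,v_2)=(0,\frac{\overline\Theta_\infty-1}{q-1})$, $\beta_\infty^+:(u_2,v_2)=(0,\frac{\Theta_\infty-q}{q(q-1)})$. $\widetilde{\mathfrak{P}}_t$ is the blow-up of $\mathbb{F}_2$ at these eight points; $\mathcal{E}_i^\pm$ is the exceptional line over $\beta_i^\pm$. $\mathcal{D}_t^{+*},\mathcal{D}_t^{-*}$ are the strict transforms of $\{u=t\overline\Theta_t\}\cup\{u_1=t\overline\Theta_t\}$ and $\{u=t\Theta_t\}\cup\{u_1=t\Theta_t\}$ respectively. $\boldsymbol{I}^t\subset\widetilde{\mathfrak{P}}_t$ is the union of the strict transforms of $\mathcal{H}=\{v_1=0\}\cup\{v_3=0\}$, $\mathcal{D}_0=\{u=0\}\cup\{u_1=0\}$, $\mathcal{D}_\infty=\{u_2=0\}\cup\{u_3=0\}$ and of the curve $\mathcal{C}=\{(u-1)(u-t)=(1-q)v\}\cup\{(u_1-1)(u_1-t)v_1=1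-q\}\cup\{(1-u_3)(1-tu_3)v_3=1-q\}$.
   Formalization: For i = ∞ the bijections are F_∞^± ≃ E_∞^∓, with signs exchanged: on y = ∞ the map is v_2 = (1−qz)/(q(q−1)z), which sends γ_∞^− to β_∞^+ and γ_∞^+ to β_∞^−, so the claim with equal signs fails for all admissible parameters. *)

theory Defs
  imports Complex_Main "HOL-Computational_Algebra.Polynomial"
begin

section \<open>Complex algebraic surfaces given by charts\<close>

text \<open>
  A smooth surface that is locally a Zariski-open part of the affine plane is represented by a
  set of local parametrizations. A chart \<open>(D, \<psi>)\<close> consists of a Zariski-open set \<open>D\<close> of
  coordinate values and the injective map \<open>\<psi>\<close> sending coordinates in \<open>D\<close> to a point of the surface
  (the inverse of a coordinate map). Values of \<open>\<psi>\<close> outside \<open>D\<close> are irrelevant.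
\<close>

type_synonym 'p chart = "(complex \<times> complex) set \<times> (complex \<times> complex \<Rightarrow> 'p)"
type_synonym 'p surface = "'p chart set"

text \<open>
  Polynomials in two variables are elements of \<open>\<complex>[X][Y]\<close>; this is the value at \<open>X = x\<close>, \<open>Y = y\<close>.
\<close>

definition peval :: "complex poly poly \<Rightarrow> complex \<times> complex \<Rightarrow> complex" where
  "peval P = (\<lambda>(x, y). poly (poly P [:y:]) x)"

definition pts :: "'p surface \<Rightarrow> 'p set" where
  "pts X = (\<Union>(D, \<psi>)\<in>X. \<psi> ` D)"

text \<open>
  Regularity: in the coordinates of any chart around a point and of any chart around its
  image, the map is given by rational functions with a common denominator that does not vanish at
  the point.
\<close>

definition regular_map :: "'p surface \<Rightarrow> 'r surface \<Rightarrow> ('p \<Rightarrow> 'r) \<Rightarrow> bool" where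
  "regular_map X Y f \<longleftrightarrow>
     f ` pts X \<subseteq> pts Y \<and>
     (\<forall>(D, \<psi>)\<in>X. \<forall>(E, \<chi>)\<in>Y. \<forall>a\<in>D. f (\<psi> a) \<in> \<chi> ` E \<longrightarrow>
        (\<exists>P1 P2 Q. peval Q a \<noteq> 0 \<and>
           (\<forall>a'\<in>D. peval Q a' \<noteq> 0 \<longrightarrow>
              (peval P1 a' / peval Q a', peval P2 a' / peval Q a') \<in> E \<and>
              f (\<psi> a') = \<chi> (peval P1 a' / peval Q a', peval P2 a' / peval Q a'))))"

definition plane_open :: "(complex \<times> complex) set \<Rightarrow> bool" where
  "plane_open D \<longleftrightarrow> (\<forall>a\<in>D. \<exists>Q. peval Q a \<noteq> 0 \<and> (\<forall>a'. peval Q a' \<noteq> 0 \<longrightarrow> a' \<in> D))"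

text \<open>Regularity of the identity says that all coordinate changes are regular.\<close>

definition alg_surface :: "'p surface \<Rightarrow> bool" where
  "alg_surface X \<longleftrightarrow>
     finite X \<and> (\<forall>(D, \<psi>)\<in>X. plane_open D \<and> inj_on \<psi> D) \<and> regular_map X X (\<lambda>p. p)"

definition biregular :: "'p surface \<Rightarrow> 'r surface \<Rightarrow> ('p \<Rightarrow> 'r) \<Rightarrow> bool" where
  "biregular X Y f \<longleftrightarrow>
     alg_surface X \<and> alg_surface Y \<and> bij_betw f (pts X) (pts Y) \<and>
     regular_map X Y f \<and> regular_map Y X (inv_into (pts X) f)"

definition restrict_surface :: "'p surface \<Rightarrow> 'p set \<Rightarrow> 'p surface" where
  "restrict_surface X U = (\<lambda>(D, \<psi>). ({a \<in> D. \<psi> a \<in> U}, \<psi>)) ` X"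

definition zariski_open :: "'p surface \<Rightarrow> 'p set \<Rightarrow> bool" where
  "zariski_open X U \<longleftrightarrow> U \<subseteq> pts X \<and> (\<forall>(D, \<psi>)\<in>X. plane_open {a \<in> D. \<psi> a \<in> U})"

definition zariski_closure :: "'p surface \<Rightarrow> 'p set \<Rightarrow> 'p set" where
  "zariski_closure X A = {p \<in> pts X. \<forall>U. zariski_open X U \<and> p \<in> U \<longrightarrow> U \<inter> A \<noteq> {}}"

definition dense_open :: "'p surface \<Rightarrow> 'p set \<Rightarrow> bool" where
  "dense_open X U \<longleftrightarrow> zariski_open X U \<and> zariski_closure X U = pts X"

text \<open>
  A rational map is given by a map \<open>f\<close> that is regular on a dense open set \<open>U\<close>; it is birational if
  it restricts to an isomorphism between dense open sets.
\<close>

definition birational_map :: "'p surface \<Rightarrow> 'r surface \<Rightarrow> 'p set \<Rightarrow> ('p \<Rightarrow> 'r) \<Rightarrow> bool" where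
  "birational_map X Y U f \<longleftrightarrow>
     alg_surface X \<and> alg_surface Y \<and> dense_open X U \<and> regular_map (restrict_surface X U) Y f \<and>
     (\<exists>V W. V \<subseteq> U \<and> dense_open X V \<and> dense_open Y W \<and>
        biregular (restrict_surface X V) (restrict_surface Y W) f)"

section \<open>The projective line and the Hirzebruch surfaces of degree 0 and 2\<close>

datatype p1 = Fin complex | Infty

fun p1_inv :: "p1 \<Rightarrow> p1" where
  "p1_inv (Fin x) = (if x = 0 then Infty else Fin (1 / x))"
| "p1_inv Infty = Fin 0"

text \<open>
  The four charts of \<open>\<bbbP>\<^sup>1 \<times> \<bbbP>\<^sup>1\<close> have coordinates \<open>(y, z)\<close>, \<open>(y, 1/z)\<close>, \<open>(1/y, z)\<close>, \<open>(1/y, 1/z)\<close>.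
\<close>

definition F0_0 :: "complex \<times> complex \<Rightarrow> p1 \<times> p1" where
  "F0_0 = (\<lambda>(y, z). (Fin y, Fin z))"
definition F0_1 :: "complex \<times> complex \<Rightarrow> p1 \<times> p1" where
  "F0_1 = (\<lambda>(y, z1). (Fin y, p1_inv (Fin z1)))"
definition F0_2 :: "complex \<times> complex \<Rightarrow> p1 \<times> p1" where
  "F0_2 = (\<lambda>(y1, z). (p1_inv (Fin y1), Fin z))"
definition F0_3 :: "complex \<times> complex \<Rightarrow> p1 \<times> p1" where
  "F0_3 = (\<lambda>(y1, z1). (p1_inv (Fin y1), p1_inv (Fin z1)))"

definition F0 :: "(p1 \<times> p1) surface" where
  "F0 = {(UNIV, F0_0), (UNIV, F0_1), (UNIV, F0_2), (UNIV, F0_3)}"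

text \<open>
  The points of \<open>\<bbbF>\<^sub>2\<close> are also labelled by pairs \<open>(u, w)\<close> of points of the projective line, as
  \<open>\<bbbF>\<^sub>2\<close> is a bundle of projective lines over the projective line: \<open>w\<close> is the
  coordinate \<open>v\<close> on the fibre if \<open>u\<close> is finite, and the coordinate \<open>v\<^sub>2\<close> on the fibre over infinity.
  The surface structure is that of the charts, in which
  \<open>(u\<^sub>1, v\<^sub>1) = (u, 1/v)\<close>, \<open>(u\<^sub>2, v\<^sub>2) = (1/u, v/u\<^sup>2)\<close>, \<open>(u\<^sub>3, v\<^sub>3) = (1/u, u\<^sup>2/v)\<close>.
\<close>

definition F2_0 :: "complex \<times> complex \<Rightarrow> p1 \<times> p1" where
  "F2_0 = (\<lambda>(u, v). (Fin u, Fin v))"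
definition F2_1 :: "complex \<times> complex \<Rightarrow> p1 \<times> p1" where
  "F2_1 = (\<lambda>(u1, v1). (Fin u1, p1_inv (Fin v1)))"
definition F2_2 :: "complex \<times> complex \<Rightarrow> p1 \<times> p1" where
  "F2_2 = (\<lambda>(u2, v2). if u2 = 0 then (Infty, Fin v2) else (Fin (1 / u2), Fin (v2 / u2\<^sup>2)))"
definition F2_3 :: "complex \<times> complex \<Rightarrow> p1 \<times> p1" where
  "F2_3 = (\<lambda>(u3, v3). if u3 = 0 then (Infty, p1_inv (Fin v3))
                       else (Fin (1 / u3), p1_inv (Fin (u3\<^sup>2 * v3))))"

definition F2 :: "(p1 \<times> p1) surface" where
  "F2 = {(UNIV, F2_0), (UNIV, F2_1), (UNIV, F2_2), (UNIV, F2_3)}"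

section \<open>Blow-ups\<close>

text \<open>
  A centre is a point given by its coordinates \<open>a\<close> in a chart. In these coordinates the
  tangent directions at the point are the points \<open>[\<xi> : \<eta>]\<close> of a projective line, labelled by the slope
  \<open>\<eta>/\<xi>\<close>. The points of the blow-up are the points \<open>Away p\<close>, for \<open>p\<close> not a centre, and \<open>Exc p m\<close>
  for a centre \<open>p\<close> and a slope \<open>m\<close>. Distinct elements of a set of centres have to be distinct
  points of the surface.
\<close>

type_synonym 'p centre = "'p chart \<times> complex \<times> complex"

datatype 'p blown = Away 'p | Exc 'p p1

definition centre_pt :: "'p centre \<Rightarrow> 'p" where
  "centre_pt = (\<lambda>((D, \<psi>), a). \<psi> a)"

text \<open>
  The two standard charts of the blow-up over a neighbourhood of the centre \<open>a = (a1, a2)\<close>: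
  \<open>(s, m) \<mapsto> (a1 + s, a2 + m s)\<close> and \<open>(m, s) \<mapsto> (a1 + m s, a2 + s)\<close>, where \<open>s = 0\<close> is the exceptional
  line. The points above the other centres in \<open>S\<close> are removed.
\<close>

definition blowup_chart1 :: "'p set \<Rightarrow> 'p centre \<Rightarrow> 'p blown chart" where
  "blowup_chart1 S = (\<lambda>((D, \<psi>), (a1, a2)).
     ({(s, m). s = 0 \<or> (a1 + s, a2 + m * s) \<in> D \<and> \<psi> (a1 + s, a2 + m * s) \<notin> S},
      \<lambda>(s, m). if s = 0 then Exc (\<psi> (a1, a2)) (Fin m) else Away (\<psi> (a1 + s, a2 + m * s))))"

definition blowup_chart2 :: "'p set \<Rightarrow> 'p centre \<Rightarrow> 'p blown chart" where
  "blowup_chart2 S = (\<lambda>((D, \<psi>), (a1, a2)).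
     ({(m, s). s = 0 \<or> (a1 + m * s, a2 + s) \<in> D \<and> \<psi> (a1 + m * s, a2 + s) \<notin> S},
      \<lambda>(m, s). if s = 0 then Exc (\<psi> (a1, a2)) (p1_inv (Fin m))
                else Away (\<psi> (a1 + m * s, a2 + s))))"

definition blowup :: "'p surface \<Rightarrow> 'p centre set \<Rightarrow> 'p blown surface" where
  "blowup X K =
     (\<lambda>(D, \<psi>). ({a \<in> D. \<psi> a \<notin> centre_pt ` K}, Away \<circ> \<psi>)) ` X \<union>
     blowup_chart1 (centre_pt ` K) ` K \<union>
     blowup_chart2 (centre_pt ` K) ` K"

definition exc_line :: "'p centre \<Rightarrow> 'p blown set" where
  "exc_line k = range (Exc (centre_pt k))"

definition strict_transform :: "'p surface \<Rightarrow> 'p centre set \<Rightarrow> 'p set \<Rightarrow> 'p blown set" where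
  "strict_transform X K C = zariski_closure (blowup X K) (Away ` (C - centre_pt ` K))"

section \<open>The two surfaces and the map\<close>

datatype idx = I0 | I1 | It | Iinf
datatype pm = Pls | Mns

fun opp :: "pm \<Rightarrow> pm" where
  "opp Pls = Mns"
| "opp Mns = Pls"

definition Sq :: "complex \<Rightarrow> (idx \<Rightarrow> complex) \<Rightarrow> complex set" where
  "Sq q \<Theta> =
     {\<Theta> I1 powi e1 * \<Theta> It powi et * q powi n | e1 et n. e1 \<in> {-1, 1} \<and> et \<in> {-1, 1}} \<union>
     {\<Theta> I0 powi e0 * \<Theta> Iinf powi ei * q powi n | e0 ei n. e0 \<in> {-1, 1} \<and> ei \<in> {-1, 1}}"

fun gamma :: "complex \<Rightarrow> complex \<Rightarrow> (idx \<Rightarrow> complex) \<Rightarrow> idx \<Rightarrow> pm \<Rightarrow> (p1 \<times> p1) centre" where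
  "gamma q t \<Theta> I0 Mns = ((UNIV, F0_0), (0, t * \<Theta> I0 / q))"
| "gamma q t \<Theta> I0 Pls = ((UNIV, F0_0), (0, t * (1 / \<Theta> I0) / q))"
| "gamma q t \<Theta> I1 Mns = ((UNIV, F0_1), (1 / \<Theta> I1, 0))"
| "gamma q t \<Theta> I1 Pls = ((UNIV, F0_1), (\<Theta> I1, 0))"
| "gamma q t \<Theta> It Mns = ((UNIV, F0_0), (t * \<Theta> It, 0))"
| "gamma q t \<Theta> It Pls = ((UNIV, F0_0), (t * (1 / \<Theta> It), 0))"
| "gamma q t \<Theta> Iinf Mns = ((UNIV, F0_2), (0, 1 / \<Theta> Iinf))"
| "gamma q t \<Theta> Iinf Pls = ((UNIV, F0_2), (0, \<Theta> Iinf / q))"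

text \<open>
  With the labels below, the map \<open>(y, z) \<mapsto> (u, v)\<close> carries \<open>\<gamma>\<^sub>i\<^sup>\<plusminus>\<close> to \<open>\<beta>\<^sub>i\<^sup>\<plusminus>\<close> for \<open>i = 0, 1\<close>, but exchanges
  the signs at infinity: on \<open>y = \<infinity>\<close> it is \<open>v\<^sub>2 = (1 - q z) / (q (q - 1) z)\<close>, which sends
  \<open>z = 1/\<Theta>\<^sub>\<infinity>\<close> to \<open>(\<Theta>\<^sub>\<infinity> - q) / (q (q - 1))\<close>. This is the reason for \<open>opp\<close>.
\<close>

fun beta :: "complex \<Rightarrow> complex \<Rightarrow> (idx \<Rightarrow> complex) \<Rightarrow> idx \<Rightarrow> pm \<Rightarrow> (p1 \<times> p1) centre" where
  "beta q t \<Theta> I0 Mns = ((UNIV, F2_0), (0, t * (1 / \<Theta> I0 - 1) / (q - 1)))"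
| "beta q t \<Theta> I0 Pls = ((UNIV, F2_0), (0, t * (\<Theta> I0 - 1) / (q - 1)))"
| "beta q t \<Theta> I1 Mns =
     ((UNIV, F2_0), (1 / \<Theta> I1, (1 / \<Theta> I1 - 1) * (t - 1 / \<Theta> I1) / (q - 1)))"
| "beta q t \<Theta> I1 Pls = ((UNIV, F2_0), (\<Theta> I1, (\<Theta> I1 - 1) * (t - \<Theta> I1) / (q - 1)))"
| "beta q t \<Theta> It Mns =
     ((UNIV, F2_0), (t * \<Theta> It, - (t * (\<Theta> It - 1) * (t * \<Theta> It - 1) / (q - 1))))"
| "beta q t \<Theta> It Pls =
     ((UNIV, F2_0),
      (t * (1 / \<Theta> It), - (t * (1 / \<Theta> It - 1) * (t * (1 / \<Theta> It) - 1) / (q - 1))))"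
| "beta q t \<Theta> Iinf Mns = ((UNIV, F2_2), (0, (1 / \<Theta> Iinf - 1) / (q - 1)))"
| "beta q t \<Theta> Iinf Pls = ((UNIV, F2_2), (0, (\<Theta> Iinf - q) / (q * (q - 1))))"

definition gammas :: "complex \<Rightarrow> complex \<Rightarrow> (idx \<Rightarrow> complex) \<Rightarrow> (p1 \<times> p1) centre set" where
  "gammas q t \<Theta> = {gamma q t \<Theta> i s | i s. True}"

definition betas :: "complex \<Rightarrow> complex \<Rightarrow> (idx \<Rightarrow> complex) \<Rightarrow> (p1 \<times> p1) centre set" where
  "betas q t \<Theta> = {beta q t \<Theta> i s | i s. True}"

definition Psurf :: "complex \<Rightarrow> complex \<Rightarrow> (idx \<Rightarrow> complex) \<Rightarrow> (p1 \<times> p1) blown surface" where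
  "Psurf q t \<Theta> = blowup F0 (gammas q t \<Theta>)"

definition Psurf' :: "complex \<Rightarrow> complex \<Rightarrow> (idx \<Rightarrow> complex) \<Rightarrow> (p1 \<times> p1) blown surface" where
  "Psurf' q t \<Theta> = blowup F2 (betas q t \<Theta>)"

text \<open>The exceptional lines \<open>\<F>\<^sub>i\<^sup>\<plusminus>\<close> and \<open>\<E>\<^sub>i\<^sup>\<plusminus>\<close>.\<close>

definition Fexc :: "complex \<Rightarrow> complex \<Rightarrow> (idx \<Rightarrow> complex) \<Rightarrow> idx \<Rightarrow> pm \<Rightarrow> (p1 \<times> p1) blown set" where
  "Fexc q t \<Theta> i s = exc_line (gamma q t \<Theta> i s)"

definition Eexc :: "complex \<Rightarrow> complex \<Rightarrow> (idx \<Rightarrow> complex) \<Rightarrow> idx \<Rightarrow> pm \<Rightarrow> (p1 \<times> p1) blown set" where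
  "Eexc q t \<Theta> i s = exc_line (beta q t \<Theta> i s)"

fun tTheta :: "complex \<Rightarrow> (idx \<Rightarrow> complex) \<Rightarrow> pm \<Rightarrow> complex" where
  "tTheta t \<Theta> Pls = t * (1 / \<Theta> It)"
| "tTheta t \<Theta> Mns = t * \<Theta> It"

definition Vt :: "complex \<Rightarrow> complex \<Rightarrow> (idx \<Rightarrow> complex) \<Rightarrow> pm \<Rightarrow> (p1 \<times> p1) blown set" where
  "Vt q t \<Theta> s = strict_transform F0 (gammas q t \<Theta>) {(y, z). y = Fin (tTheta t \<Theta> s)}"

definition Dt :: "complex \<Rightarrow> complex \<Rightarrow> (idx \<Rightarrow> complex) \<Rightarrow> pm \<Rightarrow> (p1 \<times> p1) blown set" where
  "Dt q t \<Theta> s = strict_transform F2 (betas q t \<Theta>)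
     (F2_0 ` {(u, v). u = tTheta t \<Theta> s} \<union> F2_1 ` {(u1, v1). u1 = tTheta t \<Theta> s})"

definition Jt :: "complex \<Rightarrow> complex \<Rightarrow> (idx \<Rightarrow> complex) \<Rightarrow> (p1 \<times> p1) blown set" where
  "Jt q t \<Theta> =
     strict_transform F0 (gammas q t \<Theta>) {(y, z). z = Fin 0} \<union>
     strict_transform F0 (gammas q t \<Theta>) {(y, z). z = Infty} \<union>
     strict_transform F0 (gammas q t \<Theta>) {(y, z). y = Fin 0} \<union>
     strict_transform F0 (gammas q t \<Theta>) {(y, z). y = Infty}"

definition H_curve :: "(p1 \<times> p1) set" where
  "H_curve = F2_1 ` {(u1, v1). v1 = 0} \<union> F2_3 ` {(u3, v3). v3 = 0}"

definition D0_curve :: "(p1 \<times> p1) set" where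
  "D0_curve = F2_0 ` {(u, v). u = 0} \<union> F2_1 ` {(u1, v1). u1 = 0}"

definition Dinf_curve :: "(p1 \<times> p1) set" where
  "Dinf_curve = F2_2 ` {(u2, v2). u2 = 0} \<union> F2_3 ` {(u3, v3). u3 = 0}"

definition C_curve :: "complex \<Rightarrow> complex \<Rightarrow> (p1 \<times> p1) set" where
  "C_curve q t =
     F2_0 ` {(u, v). (u - 1) * (u - t) = (1 - q) * v} \<union>
     F2_1 ` {(u1, v1). (u1 - 1) * (u1 - t) * v1 = 1 - q} \<union>
     F2_3 ` {(u3, v3). (1 - u3) * (1 - t * u3) * v3 = 1 - q}"

definition It_curve :: "complex \<Rightarrow> complex \<Rightarrow> (idx \<Rightarrow> complex) \<Rightarrow> (p1 \<times> p1) blown set" where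
  "It_curve q t \<Theta> =
     strict_transform F2 (betas q t \<Theta>) H_curve \<union>
     strict_transform F2 (betas q t \<Theta>) D0_curve \<union>
     strict_transform F2 (betas q t \<Theta>) Dinf_curve \<union>
     strict_transform F2 (betas q t \<Theta>) (C_curve q t)"

definition qOka :: "complex \<Rightarrow> complex \<Rightarrow> (idx \<Rightarrow> complex) \<Rightarrow> (p1 \<times> p1) blown surface" where
  "qOka q t \<Theta> = restrict_surface (Psurf q t \<Theta>) (pts (Psurf q t \<Theta>) - Jt q t \<Theta>)"

definition qOka' :: "complex \<Rightarrow> complex \<Rightarrow> (idx \<Rightarrow> complex) \<Rightarrow> (p1 \<times> p1) blown surface" where
  "qOka' q t \<Theta> = restrict_surface (Psurf' q t \<Theta>) (pts (Psurf' q t \<Theta>) - It_curve q t \<Theta>)"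

definition phi_coord ::
  "complex \<Rightarrow> complex \<Rightarrow> (idx \<Rightarrow> complex) \<Rightarrow> complex \<times> complex \<Rightarrow> complex \<times> complex" where
  "phi_coord q t \<Theta> = (\<lambda>(y, z).
     (y, ((y - t * \<Theta> It) * (y - t * (1 / \<Theta> It)) - q * (y - 1) * (y - t) * z)
           / (q * (q - 1) * z)))"

text \<open>
  The birational map is represented on the set of all points in the standard chart at which the
  formula makes sense: the points with \<open>z \<noteq> 0\<close> that are not blown up and whose image under the
  formula is not blown up either.
\<close>

fun phi :: "complex \<Rightarrow> complex \<Rightarrow> (idx \<Rightarrow> complex) \<Rightarrow> (p1 \<times> p1) blown \<Rightarrow> (p1 \<times> p1) blown" where
  "phi q t \<Theta> (Away (Fin y, Fin z)) = Away (F2_0 (phi_coord q t \<Theta> (y, z)))"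
| "phi q t \<Theta> _ = undefined"

definition phi_points :: "complex \<Rightarrow> complex \<Rightarrow> (idx \<Rightarrow> complex) \<Rightarrow> (p1 \<times> p1) blown set" where
  "phi_points q t \<Theta> =
     {Away (F0_0 (y, z)) | y z. z \<noteq> 0 \<and> F0_0 (y, z) \<notin> centre_pt ` gammas q t \<Theta> \<and>
        F2_0 (phi_coord q t \<Theta> (y, z)) \<notin> centre_pt ` betas q t \<Theta>}"

end

theory Submission
  imports Defs
begin

text \<open>
  The map is an elementary transformation of ruled surfaces. On the fibre over \<open>y\<close> it is the
  fractional linear map \<open>z \<mapsto> (N(y) - R(y) z) / (c z)\<close> with \<open>c = q (q - 1)\<close>, so it is a fibrewise
  isomorphism except over the two roots of \<open>N(y) = (y - t \<Theta>\<^sub>t)(y - t / \<Theta>\<^sub>t)\<close>, where the fibre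
  is contracted to \<open>\<beta>\<^sub>t\<^sup>\<plusminus>\<close> and \<open>\<gamma>\<^sub>t\<^sup>\<plusminus>\<close> is blown up to the new fibre. The map is extended
  to all points by an explicit bijection; as regularity is a local property on surfaces, it suffices
  to exhibit, at each point, one pair of charts in which the map is rational with a rational
  inverse. A biregular map commutes with Zariski closures, so the images of the curves follow from
  those of dense subsets.
\<close>

section \<open>Zariski neighbourhoods and regular functions in the plane\<close>

text \<open>Let y0 be a root of \<open>N\<close> and write N = N1 (y - y0) and R = R(y0) + R1 (y -
  y0). Then v = -R(y0)/c + (y - y0) (N1 - R1 z)/(c z), so a point z of the fibre over y0 determines
  the slope (N1 - R1 z)/(c z) at \<beta>_t. Conversely, z = m (y - y0) gives v = (N1 - R m)/(c m),
  so a slope m at \<gamma>_t determines a point of the new fibre. Both maps are again fractional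
  linear, now with the constant N1, which is nonzero at y0 because \<Theta>_t^2 \<noteq> 1 makes the
  roots of \<open>N\<close> simple. Hence the same lemmas on fractional linear fibre maps serve
  generic fibres with N and R, the old fibre with N1 and R1, and the slopes at \<gamma>_t with N1
  and R. The one direction left over, the vertical one at \<gamma>_t, goes to the vertical direction
  at \<beta>_t and needs a separate local computation. The condition on t keeps the centres
  \<gamma>_1 off the fibres over the roots, so every centre other than \<gamma>_t is blown up at a
  point where the fibrewise map is a local isomorphism.\<close>

text \<open>Neighbourhoods of a point are packaged as a filter, so that shrinking a neighbourhood is
  done by the calculus of \<^const>\<open>eventually\<close>.\<close>

definition zar :: "complex \<times> complex \<Rightarrow> (complex \<times> complex) filter" where
  "zar a = (INF Q\<in>{Q. peval Q a \<noteq> 0}. principal {x. peval Q x \<noteq> 0})"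

lemma peval_mult [simp]: "peval (P * Q) x = peval P x * peval Q x"
  by (simp add: peval_def split_beta)

lemma peval_add [simp]: "peval (P + Q) x = peval P x + peval Q x"
  by (simp add: peval_def split_beta)

lemma peval_const [simp]: "peval [:[:c:]:] x = c"
  by (simp add: peval_def split_beta)

lemma peval_1 [simp]: "peval 1 x = 1"
  by (simp add: peval_def split_beta)

lemma peval_0 [simp]: "peval 0 x = 0"
  by (simp add: peval_def split_beta)

lemma peval_pCons: "peval (pCons c P) x = poly c (fst x) + snd x * peval P x"
  by (simp add: peval_def split_beta)

text \<open>A product of two polynomials is nonzero exactly where both factors are, so the sets cut
  out by one polynomial form a filter base and a single polynomial suffices as a witness.\<close>

lemma eventually_zar:
  "eventually P (zar a) \<longleftrightarrow> (\<exists>Q. peval Q a \<noteq> 0 \<and> (\<forall>x. peval Q x \<noteq> 0 \<longrightarrow> P x))"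
proof -
  have "(\<exists>Q\<in>{Q. peval Q a \<noteq> 0}. {x. peval Q x \<noteq> 0} \<subseteq> {x. peval Q1 x \<noteq> 0} \<inter> {x. peval Q2 x \<noteq> 0})"
    if "peval Q1 a \<noteq> 0" "peval Q2 a \<noteq> 0" for Q1 Q2
    using that by (intro bexI[of _ "Q1 * Q2"]) auto
  moreover have "{Q. peval Q a \<noteq> 0} \<noteq> {}"
    using peval_1[of a] by (metis (mono_tags) empty_iff mem_Collect_eq zero_neq_one)
  ultimately show ?thesis
    unfolding zar_def by (subst eventually_INF_base) (auto simp: eventually_principal)
qed

lemma eventually_zar_self: "eventually P (zar a) \<Longrightarrow> P a"
  unfolding eventually_zar by blast

section \<open>Functions regular at a point\<close>

definition reg :: "(complex \<times> complex \<Rightarrow> complex) \<Rightarrow> complex \<times> complex \<Rightarrow> bool" where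
  "reg f a \<longleftrightarrow> (\<exists>P Q. peval Q a \<noteq> 0 \<and> (\<forall>x. peval Q x \<noteq> 0 \<longrightarrow> f x = peval P x / peval Q x))"

named_theorems reg_intros

lemma regE:
  assumes "reg f a"
  obtains P Q where "peval Q a \<noteq> 0" "\<forall>\<^sub>F x in zar a. peval Q x \<noteq> 0 \<and> f x = peval P x / peval Q x"
  using assms unfolding reg_def eventually_zar by metis

text \<open>\<open>reg\<close> demands the formula wherever its denominator is nonzero. A smaller
  neighbourhood, given by some \<open>R\<close>, is absorbed by multiplying numerator and
  denominator by \<open>R\<close>.\<close>

lemma regI:
  assumes "peval Q a \<noteq> 0" "\<forall>\<^sub>F x in zar a. f x = peval P x / peval Q x"
  shows "reg f a"
proof -
  obtain R where R: "peval R a \<noteq> 0" "\<And>x. peval R x \<noteq> 0 \<Longrightarrow> f x = peval P x / peval Q x"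
    using assms(2) by (auto simp: eventually_zar)
  show ?thesis
    unfolding reg_def using R assms(1) by (intro exI[of _ "P * R"] exI[of _ "Q * R"]) auto
qed

lemma reg_cong:
  assumes "reg g a" "\<forall>\<^sub>F x in zar a. f x = g x"
  shows "reg f a"
proof -
  obtain P Q where Q: "peval Q a \<noteq> 0" "\<forall>\<^sub>F x in zar a. peval Q x \<noteq> 0 \<and> g x = peval P x / peval Q x"
    using assms(1) by (rule regE)
  show ?thesis
    by (rule regI[OF Q(1), of _ P]) (use Q(2) assms(2) in \<open>eventually_elim, simp\<close>)
qed

lemma reg_const [reg_intros]: "reg (\<lambda>x. c) a"
  by (rule regI[of 1 _ _ "[:[:c:]:]"]) auto

lemma reg_fst [reg_intros]: "reg fst a"
  by (rule regI[of 1 _ _ "[:[:0,1:]:]"]) (auto simp: peval_pCons)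

lemma reg_snd [reg_intros]: "reg snd a"
  by (rule regI[of 1 _ _ "[:0,1:]"]) (auto simp: peval_pCons)

lemma reg_add [reg_intros]:
  assumes "reg f a" "reg g a"
  shows "reg (\<lambda>x. f x + g x) a"
proof -
  obtain P Q where Q: "peval Q a \<noteq> 0" "\<forall>\<^sub>F x in zar a. peval Q x \<noteq> 0 \<and> f x = peval P x / peval Q x"
    using assms(1) by (rule regE)
  obtain P' Q' where Q': "peval Q' a \<noteq> 0" "\<forall>\<^sub>F x in zar a. peval Q' x \<noteq> 0 \<and> g x = peval P' x / peval Q' x"
    using assms(2) by (rule regE)
  show ?thesis
    by (rule regI[of "Q * Q'" _ _ "P * Q' + P' * Q"], use Q Q' in simp)
       (use Q(2) Q'(2) in \<open>eventually_elim, simp add: add_frac_eq\<close>)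
qed

lemma reg_mult [reg_intros]:
  assumes "reg f a" "reg g a"
  shows "reg (\<lambda>x. f x * g x) a"
proof -
  obtain P Q where Q: "peval Q a \<noteq> 0" "\<forall>\<^sub>F x in zar a. peval Q x \<noteq> 0 \<and> f x = peval P x / peval Q x"
    using assms(1) by (rule regE)
  obtain P' Q' where Q': "peval Q' a \<noteq> 0" "\<forall>\<^sub>F x in zar a. peval Q' x \<noteq> 0 \<and> g x = peval P' x / peval Q' x"
    using assms(2) by (rule regE)
  show ?thesis
    by (rule regI[of "Q * Q'" _ _ "P * P'"], use Q Q' in simp)
       (use Q(2) Q'(2) in \<open>eventually_elim, simp\<close>)
qed

text \<open>The numerator is nonzero at \<open>a\<close> and therefore cuts out the required
  neighbourhood.\<close>

lemma reg_nonzero: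
  assumes "reg f a" "f a \<noteq> 0"
  shows "\<forall>\<^sub>F x in zar a. f x \<noteq> 0"
proof -
  obtain P Q where Q: "peval Q a \<noteq> 0" "\<forall>\<^sub>F x in zar a. peval Q x \<noteq> 0 \<and> f x = peval P x / peval Q x"
    using assms(1) by (rule regE)
  have "peval P a \<noteq> 0" using eventually_zar_self[OF Q(2)] assms(2) by auto
  hence "\<forall>\<^sub>F x in zar a. peval P x \<noteq> 0" by (auto simp: eventually_zar)
  with Q(2) show ?thesis by eventually_elim simp
qed

lemma reg_inverse:
  assumes "reg f a" "f a \<noteq> 0"
  shows "reg (\<lambda>x. inverse (f x)) a"
proof -
  obtain P Q where Q: "peval Q a \<noteq> 0" "\<forall>\<^sub>F x in zar a. peval Q x \<noteq> 0 \<and> f x = peval P x / peval Q x"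
    using assms(1) by (rule regE)
  have "peval P a \<noteq> 0" using eventually_zar_self[OF Q(2)] assms(2) by auto
  thus ?thesis
    by (rule regI[of _ _ _ Q]) (use Q(2) in \<open>eventually_elim, simp\<close>)
qed

lemma reg_divide [reg_intros]:
  "reg f a \<Longrightarrow> reg g a \<Longrightarrow> g a \<noteq> 0 \<Longrightarrow> reg (\<lambda>x. f x / g x) a"
  unfolding divide_inverse by (intro reg_mult reg_inverse)

lemma reg_minus [reg_intros]: "reg f a \<Longrightarrow> reg (\<lambda>x. - f x) a"
  using reg_mult[OF reg_const[of "-1"]] by simp

lemma reg_diff [reg_intros]: "reg f a \<Longrightarrow> reg g a \<Longrightarrow> reg (\<lambda>x. f x - g x) a"
  using reg_add[OF _ reg_minus] by simp

lemma reg_power [reg_intros]: "reg f a \<Longrightarrow> reg (\<lambda>x. f x ^ n) a"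
  by (induction n) (auto intro!: reg_intros)

lemma reg_poly: "reg f a \<Longrightarrow> reg (\<lambda>x. poly p (f x)) a"
  by (induction p) (auto intro!: reg_intros)

section \<open>Regular maps of the plane and their composition\<close>

definition reg2 :: "(complex \<times> complex \<Rightarrow> complex \<times> complex) \<Rightarrow> complex \<times> complex \<Rightarrow> bool" where
  "reg2 h a \<longleftrightarrow> reg (\<lambda>x. fst (h x)) a \<and> reg (\<lambda>x. snd (h x)) a"

lemma reg2_Pair [reg_intros]: "reg f a \<Longrightarrow> reg g a \<Longrightarrow> reg2 (\<lambda>x. (f x, g x)) a"
  by (simp add: reg2_def)

lemma reg2_id: "reg2 (\<lambda>x. x) a"
  by (simp add: reg2_def reg_intros)

lemma reg_peval:
  assumes "reg2 h a"
  shows "reg (\<lambda>x. peval P (h x)) a"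
proof (induction P)
  case 0
  show ?case by (auto simp: peval_def split_beta intro: reg_intros)
next
  case (pCons c P)
  show ?case
    unfolding peval_pCons using assms pCons by (auto simp: reg2_def intro!: reg_intros reg_poly)
qed

text \<open>The polynomial that cuts out the neighbourhood of \<open>h a\<close> pulls back to a
  regular function that is nonzero at \<open>a\<close>; this is the continuity of
  \<open>h\<close>.\<close>

lemma eventually_zar_compose:
  assumes "reg2 h a" "eventually P (zar (h a))"
  shows "\<forall>\<^sub>F x in zar a. P (h x)"
proof -
  obtain Q where Q: "peval Q (h a) \<noteq> 0" "\<And>x. peval Q x \<noteq> 0 \<Longrightarrow> P x"
    using assms(2) by (auto simp: eventually_zar)
  show ?thesis
    using reg_nonzero[OF reg_peval[OF assms(1)] Q(1)] by eventually_elim (rule Q(2))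
qed

lemma reg_compose:
  assumes "reg f (h a)" "reg2 h a"
  shows "reg (\<lambda>x. f (h x)) a"
proof -
  obtain P Q where Q: "peval Q (h a) \<noteq> 0"
    "\<forall>\<^sub>F x in zar (h a). peval Q x \<noteq> 0 \<and> f x = peval P x / peval Q x"
    using assms(1) by (rule regE)
  show ?thesis
    by (rule reg_cong[of "\<lambda>x. peval P (h x) / peval Q (h x)"])
       (use Q eventually_zar_compose[OF assms(2) Q(2)] assms(2) in
         \<open>auto intro!: reg_intros reg_peval elim: eventually_mono\<close>)
qed

lemma reg2_compose: "reg2 g (h a) \<Longrightarrow> reg2 h a \<Longrightarrow> reg2 (\<lambda>x. g (h x)) a"
  unfolding reg2_def[of g] reg2_def[of "\<lambda>x. g (h x)"] by (auto intro: reg_compose)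

lemma plane_open_iff: "plane_open D \<longleftrightarrow> (\<forall>a\<in>D. \<forall>\<^sub>F x in zar a. x \<in> D)"
  by (simp add: plane_open_def eventually_zar)

lemma plane_open_UNIV [simp]: "plane_open UNIV"
  by (simp add: plane_open_iff)

lemma eventually_zar_neq:
  assumes "a \<noteq> b"
  shows "\<forall>\<^sub>F x in zar a. x \<noteq> b"
proof (cases "fst a = fst b")
  case True
  have "\<forall>\<^sub>F x in zar a. snd x - snd b \<noteq> 0"
    using True assms by (intro reg_nonzero) (auto intro!: reg_intros simp: prod_eq_iff)
  thus ?thesis by (rule eventually_mono) auto
next
  case False
  have "\<forall>\<^sub>F x in zar a. fst x - fst b \<noteq> 0"
    using False by (intro reg_nonzero) (auto intro!: reg_intros)
  thus ?thesis by (rule eventually_mono) auto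
qed

lemma eventually_zar_finite:
  assumes "finite F" "a \<notin> F"
  shows "\<forall>\<^sub>F x in zar a. x \<notin> F"
proof -
  have "\<forall>\<^sub>F x in zar a. \<forall>b\<in>F. x \<noteq> b"
    using assms by (intro eventually_ball_finite) (auto intro: eventually_zar_neq)
  thus ?thesis by (rule eventually_mono) auto
qed

section \<open>Irreducibility of the plane\<close>

lemma peval_nonzero_ex:
  assumes "P \<noteq> 0"
  shows "\<exists>x. peval P x \<noteq> 0"
proof -
  \<comment> \<open>As a polynomial in Y over \<complex>[X], \<open>P\<close> has finitely many
    roots, whereas there are infinitely many constants to substitute for Y.\<close>
  have inf: "infinite (range (\<lambda>c::complex. [:c:]))"
    by (auto dest!: finite_imageD simp: inj_on_def infinite_UNIV_char_0)
  have "\<exists>y. poly P [:y:] \<noteq> 0"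
  proof (rule ccontr)
    assume "\<not> ?thesis"
    hence "range (\<lambda>c. [:c:]) \<subseteq> {x. poly P x = 0}" by auto
    thus False using poly_roots_finite[OF assms] inf finite_subset by blast
  qed
  then obtain y where y: "poly P [:y:] \<noteq> 0" by blast
  then obtain x where "poly (poly P [:y:]) x \<noteq> 0"
    using poly_all_0_iff_0 by blast
  thus ?thesis by (intro exI[of _ "(x, y)"]) (simp add: peval_def)
qed

text \<open>The product of two nonzero polynomials is nonzero and so has a nonvanishing value. The
  density arguments below rest on this.\<close>

lemma zar_meet:
  assumes "eventually P (zar a)" "eventually Q (zar b)"
  shows "\<exists>x. P x \<and> Q x"
proof -
  obtain A where A: "peval A a \<noteq> 0" "\<And>x. peval A x \<noteq> 0 \<Longrightarrow> P x"
    using assms(1) by (auto simp: eventually_zar)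
  obtain B where B: "peval B b \<noteq> 0" "\<And>x. peval B x \<noteq> 0 \<Longrightarrow> Q x"
    using assms(2) by (auto simp: eventually_zar)
  have "A \<noteq> 0" "B \<noteq> 0" using A B by (auto simp: peval_def split_beta)
  then obtain x where "peval (A * B) x \<noteq> 0"
    using peval_nonzero_ex[of "A * B"] by (metis no_zero_divisors)
  hence "P x \<and> Q x" using A B by simp
  thus ?thesis ..
qed

text \<open>Used with \<open>h x = (fst x, 0)\<close>, a line with parameter \<open>fst x\<close>:
  each neighbourhood of one of its points contains points of the line off any finite set of
  parameters. The second parameter is a dummy, so that \<open>zar_meet\<close> applies in the source
  plane.\<close>

lemma zar_curve:
  assumes "eventually P (zar (h a))" "reg2 h a" "finite F"
  shows "\<exists>x. fst x \<notin> F \<and> P (h x)"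
proof -
  obtain c where c: "c \<notin> F"
    using assms(3) infinite_UNIV_char_0 ex_new_if_finite by blast
  \<comment> \<open>The lines over \<open>F\<close> are the zero set of one product, which does not
    vanish at \<open>(c, 0)\<close>.\<close>
  have "\<forall>\<^sub>F x in zar (c, 0). (\<Prod>b\<in>F. fst x - b) \<noteq> 0"
  proof (rule reg_nonzero)
    have "reg (\<lambda>x. \<Prod>b\<in>F. fst x - b) (c, 0)" using assms(3)
      by induction (auto intro!: reg_intros)
    thus "reg (\<lambda>x. \<Prod>b\<in>F. fst x - b) (c, 0)" .
  qed (use c assms(3) in auto)
  from zar_meet[OF this eventually_zar_compose[OF assms(2,1)]] assms(3) show ?thesis by auto
qed

section \<open>Regular maps are local\<close>

text \<open>The condition of \<open>regular_map\<close> at one point in one pair of charts, with an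
  arbitrary regular \<open>h\<close> in place of fractions over a common denominator. In this form
  local expressions can be composed directly.\<close>

definition loc :: "('p \<Rightarrow> 'r) \<Rightarrow> 'p chart \<Rightarrow> 'r chart \<Rightarrow> complex \<times> complex \<Rightarrow> bool" where
  "loc f = (\<lambda>(D, \<psi>) (E, \<chi>) a.
     \<exists>h. reg2 h a \<and> (\<forall>\<^sub>F x in zar a. x \<in> D \<longrightarrow> h x \<in> E \<and> f (\<psi> x) = \<chi> (h x)))"

lemma locI:
  "reg2 h a \<Longrightarrow> \<forall>\<^sub>F x in zar a. x \<in> D \<longrightarrow> h x \<in> E \<and> f (\<psi> x) = \<chi> (h x) \<Longrightarrow> loc f (D, \<psi>) (E, \<chi>) a"
  by (auto simp: loc_def)

lemma locE:
  assumes "loc f (D, \<psi>) (E, \<chi>) a"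
  obtains h where "reg2 h a" "\<forall>\<^sub>F x in zar a. x \<in> D \<longrightarrow> h x \<in> E \<and> f (\<psi> x) = \<chi> (h x)"
  using assms by (auto simp: loc_def)

lemma loc_image: "loc f (D, \<psi>) (E, \<chi>) a \<Longrightarrow> a \<in> D \<Longrightarrow> f (\<psi> a) \<in> \<chi> ` E"
  by (auto simp: loc_def dest!: eventually_zar_self)

lemma loc_cong:
  assumes "loc g (D, \<psi>) C a" "\<And>x. x \<in> D \<Longrightarrow> f (\<psi> x) = g (\<psi> x)"
  shows "loc f (D, \<psi>) C a"
  using assms by (cases C) (auto simp: loc_def cong: imp_cong conj_cong)

lemma loc_iff:
  "loc f (D, \<psi>) (E, \<chi>) a \<longleftrightarrow>
     (\<exists>P1 P2 Q. peval Q a \<noteq> 0 \<and> (\<forall>a'\<in>D. peval Q a' \<noteq> 0 \<longrightarrow>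
        (peval P1 a' / peval Q a', peval P2 a' / peval Q a') \<in> E \<and>
        f (\<psi> a') = \<chi> (peval P1 a' / peval Q a', peval P2 a' / peval Q a')))"
  (is "_ \<longleftrightarrow> ?R")
proof
  assume "loc f (D, \<psi>) (E, \<chi>) a"
  then obtain h where h: "reg2 h a" "\<forall>\<^sub>F x in zar a. x \<in> D \<longrightarrow> h x \<in> E \<and> f (\<psi> x) = \<chi> (h x)"
    by (rule locE)
  obtain R where R: "peval R a \<noteq> 0" 
    "\<And>x. peval R x \<noteq> 0 \<Longrightarrow> x \<in> D \<Longrightarrow> h x \<in> E \<and> f (\<psi> x) = \<chi> (h x)"
    using h(2) unfolding eventually_zar by blast
  obtain P1 Q1 where 1: "peval Q1 a \<noteq> 0" "\<And>x. peval Q1 x \<noteq> 0 \<Longrightarrow> fst (h x) = peval P1 x / peval Q1 x"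
    using h(1) unfolding reg2_def reg_def by blast
  obtain P2 Q2 where 2: "peval Q2 a \<noteq> 0" "\<And>x. peval Q2 x \<noteq> 0 \<Longrightarrow> snd (h x) = peval P2 x / peval Q2 x"
    using h(1) unfolding reg2_def reg_def by blast
  \<comment> \<open>The common denominator has one factor from each coordinate of \<open>h\<close>
    and the factor \<open>R\<close>, which confines it to the set where \<open>h\<close> describes
    \<open>f\<close>.\<close>
  have eq: "(peval (P1 * Q2 * R) x / peval (Q1 * Q2 * R) x,
             peval (P2 * Q1 * R) x / peval (Q1 * Q2 * R) x) = h x"
    if "peval (Q1 * Q2 * R) x \<noteq> 0" for x
    using that 1(2)[of x] 2(2)[of x] by (simp add: prod_eq_iff)
  show ?R
  proof (rule exI[of _ "P1 * Q2 * R"], rule exI[of _ "P2 * Q1 * R"], rule exI[of _ "Q1 * Q2 * R"],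
      intro conjI ballI impI)
    show "peval (Q1 * Q2 * R) a \<noteq> 0" using R(1) 1(1) 2(1) by simp
  next
    fix x assume x: "x \<in> D" "peval (Q1 * Q2 * R) x \<noteq> 0"
    hence "peval R x \<noteq> 0" by simp
    from R(2)[OF this x(1)] show
      "(peval (P1 * Q2 * R) x / peval (Q1 * Q2 * R) x, peval (P2 * Q1 * R) x / peval (Q1 * Q2 * R) x) \<in> E"
      "f (\<psi> x) = \<chi> (peval (P1 * Q2 * R) x / peval (Q1 * Q2 * R) x,
         peval (P2 * Q1 * R) x / peval (Q1 * Q2 * R) x)"
      unfolding eq[OF x(2)] by auto
  qed
next
  assume ?R
  then obtain P1 P2 Q where Q: "peval Q a \<noteq> 0" "\<forall>a'\<in>D. peval Q a' \<noteq> 0 \<longrightarrow>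
        (peval P1 a' / peval Q a', peval P2 a' / peval Q a') \<in> E \<and>
        f (\<psi> a') = \<chi> (peval P1 a' / peval Q a', peval P2 a' / peval Q a')"
    by blast
  show "loc f (D, \<psi>) (E, \<chi>) a"
  proof (rule locI)
    show "reg2 (\<lambda>x. (peval P1 x / peval Q x, peval P2 x / peval Q x)) a"
      by (intro reg2_Pair reg_divide reg_peval[OF reg2_id] Q(1))
    have "\<forall>\<^sub>F x in zar a. peval Q x \<noteq> 0" using Q(1) unfolding eventually_zar by blast
    thus "\<forall>\<^sub>F x in zar a. x \<in> D \<longrightarrow> (peval P1 x / peval Q x, peval P2 x / peval Q x) \<in> E \<and>
        f (\<psi> x) = \<chi> (peval P1 x / peval Q x, peval P2 x / peval Q x)"
      by eventually_elim (use Q(2) in blast)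
  qed
qed

lemma regular_map_iff:
  "regular_map X Y f \<longleftrightarrow> f ` pts X \<subseteq> pts Y \<and>
     (\<forall>(D, \<psi>)\<in>X. \<forall>(E, \<chi>)\<in>Y. \<forall>a\<in>D. f (\<psi> a) \<in> \<chi> ` E \<longrightarrow> loc f (D, \<psi>) (E, \<chi>) a)"
  unfolding regular_map_def loc_iff ..

lemma regular_mapD:
  assumes "regular_map X Y f" "(D, \<psi>) \<in> X" "(E, \<chi>) \<in> Y" "a \<in> D" "b \<in> E" "f (\<psi> a) = \<chi> b"
  shows "loc f (D, \<psi>) (E, \<chi>) a"
proof -
  note 1 = conjunct2[OF assms(1)[unfolded regular_map_iff]]
  note 2 = bspec[OF bspec[OF 1 assms(2), unfolded prod.case] assms(3), unfolded prod.case]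
  show ?thesis using bspec[OF 2 assms(4)] assms(5,6) by simp
qed

lemma regular_map_pts: "regular_map X Y f \<Longrightarrow> p \<in> pts X \<Longrightarrow> f p \<in> pts Y"
  unfolding regular_map_def by (meson image_subset_iff)

lemma regular_mapI:
  assumes "\<And>p. p \<in> pts X \<Longrightarrow> f p \<in> pts Y"
    and "\<And>D \<psi> E \<chi> a b. (D, \<psi>) \<in> X \<Longrightarrow> (E, \<chi>) \<in> Y \<Longrightarrow> a \<in> D \<Longrightarrow> b \<in> E \<Longrightarrow> f (\<psi> a) = \<chi> b \<Longrightarrow>
           loc f (D, \<psi>) (E, \<chi>) a"
  shows "regular_map X Y f"
  unfolding regular_map_iff split_beta
proof (intro conjI ballI)
  fix C C' a assume *: "C \<in> X" "C' \<in> Y" and a: "a \<in> fst C"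
  obtain D \<psi> E \<chi> where eq: "C = (D, \<psi>)" "C' = (E, \<chi>)" by (metis surj_pair)
  have "loc f (D, \<psi>) (E, \<chi>) a" if "a \<in> D" "f (\<psi> a) \<in> \<chi> ` E" for a
    using assms(2) * that unfolding eq by (meson imageE)
  thus "f (snd C a) \<in> snd C' ` fst C' \<longrightarrow> loc f (fst C, snd C) (fst C', snd C') a" 
    using a by (simp add: eq)
qed (use assms(1) in blast)

lemma pts_iff: "p \<in> pts X \<longleftrightarrow> (\<exists>D \<psi> a. (D, \<psi>) \<in> X \<and> a \<in> D \<and> \<psi> a = p)"
  unfolding pts_def by force

lemma ptsE:
  assumes "p \<in> pts X"
  obtains D \<psi> a where "(D, \<psi>) \<in> X" "a \<in> D" "p = \<psi> a"
  using assms unfolding pts_iff by blast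

lemma ptsI: "(D, \<psi>) \<in> X \<Longrightarrow> a \<in> D \<Longrightarrow> \<psi> a \<in> pts X"
  unfolding pts_iff by blast

text \<open>Injectivity of the middle chart forces \<open>h a = b\<close>, so the expression of
  \<open>g\<close> at \<open>b\<close> can be substituted into that of \<open>f\<close> at
  \<open>a\<close>.\<close>

lemma loc_comp:
  assumes f: "loc f (D, \<psi>) (E, \<chi>) a" and a: "a \<in> D" and b: "b \<in> E" "f (\<psi> a) = \<chi> b"
    and inj: "inj_on \<chi> E" and g: "loc g (E, \<chi>) (G, \<omega>) b"
  shows "loc (\<lambda>p. g (f p)) (D, \<psi>) (G, \<omega>) a"
proof -
  obtain h where h: "reg2 h a" "\<forall>\<^sub>F x in zar a. x \<in> D \<longrightarrow> h x \<in> E \<and> f (\<psi> x) = \<chi> (h x)"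
    using f by (rule locE)
  have ha: "h a = b"
    using eventually_zar_self[OF h(2)] a b inj by (auto dest: inj_onD)
  obtain k where k: "reg2 k b" "\<forall>\<^sub>F x in zar b. x \<in> E \<longrightarrow> k x \<in> G \<and> g (\<chi> x) = \<omega> (k x)"
    using g by (rule locE)
  show ?thesis
  proof (rule locI)
    show "reg2 (\<lambda>x. k (h x)) a" using reg2_compose[of k h a] h(1) k(1) ha by simp
    show "\<forall>\<^sub>F x in zar a. x \<in> D \<longrightarrow> k (h x) \<in> G \<and> g (f (\<psi> x)) = \<omega> (k (h x))"
      using h(2) eventually_zar_compose[OF h(1), unfolded ha, OF k(2)]
      by eventually_elim auto
  qed
qed

lemma regular_map_cong:
  assumes "regular_map X Y g" "\<And>p. p \<in> pts X \<Longrightarrow> f p = g p"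
  shows "regular_map X Y f"
proof (rule regular_mapI)
  fix p assume "p \<in> pts X"
  thus "f p \<in> pts Y" using assms regular_map_pts by metis
next
  fix D \<psi> E \<chi> a b
  assume *: "(D, \<psi>) \<in> X" "(E, \<chi>) \<in> Y" "a \<in> D" "b \<in> E" "f (\<psi> a) = \<chi> b"
  have eq: "f (\<psi> x) = g (\<psi> x)" if "x \<in> D" for x
    using assms(2) ptsI[OF *(1) that] by blast
  show "loc f (D, \<psi>) (E, \<chi>) a"
    by (rule loc_cong[OF regular_mapD[OF assms(1) *(1-4)] eq]) (use *(3,5) eq in simp_all)
qed

lemma alg_surface_chart:
  assumes "alg_surface X" "(D, \<psi>) \<in> X"
  shows "plane_open D" "inj_on \<psi> D"
  using assms by (auto simp: alg_surface_def)

lemma alg_surface_id: "alg_surface X \<Longrightarrow> regular_map X X (\<lambda>p. p)"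
  by (simp add: alg_surface_def)

lemma alg_surface_open:
  "alg_surface X \<Longrightarrow> (D, \<psi>) \<in> X \<Longrightarrow> a \<in> D \<Longrightarrow> \<forall>\<^sub>F x in zar a. x \<in> D"
  using alg_surface_chart(1) plane_open_iff by blast

lemma alg_surfaceI:
  assumes "finite X" "\<And>D \<psi>. (D, \<psi>) \<in> X \<Longrightarrow> plane_open D" "\<And>D \<psi>. (D, \<psi>) \<in> X \<Longrightarrow> inj_on \<psi> D"
    and "\<And>D \<psi> E \<chi> a b. (D, \<psi>) \<in> X \<Longrightarrow> (E, \<chi>) \<in> X \<Longrightarrow> a \<in> D \<Longrightarrow> b \<in> E \<Longrightarrow> \<psi> a = \<chi> b \<Longrightarrow>
           loc (\<lambda>p. p) (D, \<psi>) (E, \<chi>) a"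
  shows "alg_surface X"
  unfolding alg_surface_def using assms by (auto intro!: regular_mapI)

text \<open>Between arbitrary charts the map factors into a coordinate change of \<open>X\<close>,
  the given local expression and a coordinate change of \<open>Y\<close>. The outer two are regular
  because \<open>X\<close> and \<open>Y\<close> are algebraic surfaces.\<close>

lemma regular_map_localI:
  assumes X: "alg_surface X" and Y: "alg_surface Y"
    and l: "\<And>p. p \<in> pts X \<Longrightarrow> \<exists>D \<psi> E \<chi> a. (D, \<psi>) \<in> X \<and> a \<in> D \<and> \<psi> a = p \<and> (E, \<chi>) \<in> Y \<and>
               loc f (D, \<psi>) (E, \<chi>) a"
  shows "regular_map X Y f"
proof (rule regular_mapI)
  fix p assume "p \<in> pts X"
  then obtain D \<psi> E \<chi> a where *: "(D, \<psi>) \<in> X" "a \<in> D" "\<psi> a = p" "(E, \<chi>) \<in> Y" "loc f (D, \<psi>) (E, \<chi>) a"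
    using l by metis
  then obtain b where "b \<in> E" "f p = \<chi> b" using loc_image[OF *(5,2)] by auto
  thus "f p \<in> pts Y" using ptsI[OF *(4), of b] by simp
next
  fix D \<psi> E \<chi> a b
  assume *: "(D, \<psi>) \<in> X" "(E, \<chi>) \<in> Y" "a \<in> D" "b \<in> E" "f (\<psi> a) = \<chi> b"
  obtain D' \<psi>' E' \<chi>' a' where D': "(D', \<psi>') \<in> X" "a' \<in> D'" "\<psi>' a' = \<psi> a" "(E', \<chi>') \<in> Y"
     "loc f (D', \<psi>') (E', \<chi>') a'"
    using l[OF ptsI[OF *(1,3)]] by metis
  obtain b' where b': "b' \<in> E'" "f (\<psi>' a') = \<chi>' b'" using loc_image[OF D'(5,2)] by auto
  have 1: "loc (\<lambda>p. p) (D, \<psi>) (D', \<psi>') a"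
    by (rule regular_mapD[OF alg_surface_id[OF X] *(1) D'(1) *(3) D'(2) D'(3)[symmetric]])
  have 2: "loc f (D, \<psi>) (E', \<chi>') a"
    by (rule loc_comp[OF 1 *(3) D'(2) D'(3)[symmetric] alg_surface_chart(2)[OF X D'(1)] D'(5)])
  have fa: "f (\<psi> a) = \<chi>' b'" using D'(3) b'(2) by simp
  have 3: "loc (\<lambda>p. p) (E', \<chi>') (E, \<chi>) b'"
    by (rule regular_mapD[OF alg_surface_id[OF Y] D'(4) *(2) b'(1) *(4)]) (use fa *(5) in simp)
  show "loc f (D, \<psi>) (E, \<chi>) a"
    by (rule loc_comp[OF 2 *(3) b'(1) fa alg_surface_chart(2)[OF Y D'(4)] 3])
qed

section \<open>The Zariski topology of a surface\<close>

lemma zariski_open_iff: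
  "zariski_open X U \<longleftrightarrow> U \<subseteq> pts X \<and>
     (\<forall>D \<psi> a. (D, \<psi>)\<in>X \<longrightarrow> a\<in>D \<longrightarrow> \<psi> a \<in> U \<longrightarrow> (\<forall>\<^sub>F x in zar a. x \<in> D \<and> \<psi> x \<in> U))"
  unfolding zariski_open_def plane_open_iff by fastforce

lemma zariski_openD:
  "zariski_open X U \<Longrightarrow> (D, \<psi>) \<in> X \<Longrightarrow> a \<in> D \<Longrightarrow> \<psi> a \<in> U \<Longrightarrow> \<forall>\<^sub>F x in zar a. x \<in> D \<and> \<psi> x \<in> U"
  unfolding zariski_open_iff by blast

lemma zariski_open_subset: "zariski_open X U \<Longrightarrow> U \<subseteq> pts X"
  unfolding zariski_open_iff by blast

lemma loc_eventually:
  assumes f: "loc f (D, \<psi>) (E, \<chi>) a" and ab: "a \<in> D" "b \<in> E" "f (\<psi> a) = \<chi> b" and inj: "inj_on \<chi> E"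
    and P: "\<forall>\<^sub>F y in zar b. P (\<chi> y)"
  shows "\<forall>\<^sub>F x in zar a. x \<in> D \<longrightarrow> P (f (\<psi> x))"
proof -
  obtain h where h: "reg2 h a" "\<forall>\<^sub>F x in zar a. x \<in> D \<longrightarrow> h x \<in> E \<and> f (\<psi> x) = \<chi> (h x)"
    using f by (rule locE)
  have ha: "h a = b"
    using eventually_zar_self[OF h(2)] ab inj by (auto dest: inj_onD)
  show ?thesis
    using h(2) eventually_zar_compose[OF h(1), unfolded ha, OF P] by eventually_elim auto
qed

lemma zariski_open_vimage:
  assumes X: "alg_surface X" and Y: "alg_surface Y" and f: "regular_map X Y f"
    and U: "zariski_open Y U"
  shows "zariski_open X {p \<in> pts X. f p \<in> U}"
  unfolding zariski_open_iff
proof (intro conjI allI impI)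
  fix D \<psi> a
  assume *: "(D, \<psi>) \<in> X" "a \<in> D" "\<psi> a \<in> {p \<in> pts X. f p \<in> U}" 
  have "f (\<psi> a) \<in> pts Y" using * f by (simp add: regular_map_pts)
  then obtain E \<chi> b where E: "(E, \<chi>) \<in> Y" "b \<in> E" "f (\<psi> a) = \<chi> b" by (rule ptsE)
  have "\<forall>\<^sub>F x in zar a. x \<in> D \<longrightarrow> f (\<psi> x) \<in> U"
    by (rule loc_eventually[OF regular_mapD[OF f *(1) E(1) *(2) E(2,3)] *(2) E(2,3)
          alg_surface_chart(2)[OF Y E(1)]])
       (use zariski_openD[OF U E(1,2)] *(3) E(3) in \<open>auto elim: eventually_mono\<close>)
  with alg_surface_open[OF X *(1,2)] show "\<forall>\<^sub>F x in zar a. x \<in> D \<and> \<psi> x \<in> {p \<in> pts X. f p \<in> U}"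
    by eventually_elim (use ptsI[OF *(1)] in auto)
qed auto

text \<open>By \<open>loc_eventually\<close>, applied to the identity, a neighbourhood found in one
  chart yields one in every chart around the same point.\<close>

lemma zariski_open_localI:
  assumes X: "alg_surface X" 
    and l: "\<And>p. p \<in> U \<Longrightarrow> \<exists>D \<psi> a. (D, \<psi>) \<in> X \<and> a \<in> D \<and> \<psi> a = p \<and> (\<forall>\<^sub>F x in zar a. \<psi> x \<in> U)"
  shows "zariski_open X U"
  unfolding zariski_open_iff
proof (intro conjI allI impI)
  show "U \<subseteq> pts X" using l pts_iff by fast
  fix D \<psi> a
  assume *: "(D, \<psi>) \<in> X" "a \<in> D" "\<psi> a \<in> U"
  obtain E \<chi> b where E: "(E, \<chi>) \<in> X" "b \<in> E" "\<chi> b = \<psi> a" "\<forall>\<^sub>F x in zar b. \<chi> x \<in> U"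
    using l[OF *(3)] by blast
  have "\<forall>\<^sub>F x in zar a. x \<in> D \<longrightarrow> \<psi> x \<in> U"
    by (rule loc_eventually[OF regular_mapD[OF alg_surface_id[OF X] *(1) E(1) *(2) E(2)] *(2) E(2) _
          alg_surface_chart(2)[OF X E(1)] E(4)]) (use E in auto)
  with alg_surface_open[OF X *(1,2)] show "\<forall>\<^sub>F x in zar a. x \<in> D \<and> \<psi> x \<in> U"
    by eventually_elim auto
qed

lemma zariski_open_UN:
  assumes "\<And>U. U \<in> \<U> \<Longrightarrow> zariski_open X U"
  shows "zariski_open X (\<Union>\<U>)"
  using assms unfolding zariski_open_iff by (fastforce elim: eventually_mono)

lemma zariski_open_Int:
  assumes "zariski_open X U" "zariski_open X V"
  shows "zariski_open X (U \<inter> V)"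
  using assms unfolding zariski_open_iff by (auto simp: eventually_conj_iff)

lemma zariski_closureI:
  assumes "p \<in> pts X" "\<And>U. zariski_open X U \<Longrightarrow> p \<in> U \<Longrightarrow> U \<inter> A \<noteq> {}"
  shows "p \<in> zariski_closure X A"
  using assms unfolding zariski_closure_def by blast

lemma zariski_closure_subset_pts: "zariski_closure X A \<subseteq> pts X"
  unfolding zariski_closure_def by blast

lemma zariski_open_closure: "zariski_open X (pts X - zariski_closure X A)"
proof -
  have "pts X - zariski_closure X A = \<Union>{U. zariski_open X U \<and> U \<inter> A = {}}"
    using zariski_open_subset unfolding zariski_closure_def by fastforce
  thus ?thesis by (metis (mono_tags, lifting) mem_Collect_eq zariski_open_UN)
qed

lemma subset_zariski_closure: "A \<subseteq> pts X \<Longrightarrow> A \<subseteq> zariski_closure X A"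
  unfolding zariski_closure_def by blast

lemma zariski_closure_minimal:
  assumes "A \<subseteq> C" "zariski_open X (pts X - C)"
  shows "zariski_closure X A \<subseteq> C"
  using assms unfolding zariski_closure_def by blast

lemma zariski_closure_eqI:
  assumes "B \<subseteq> A" "\<And>p U. p \<in> A \<Longrightarrow> zariski_open X U \<Longrightarrow> p \<in> U \<Longrightarrow> U \<inter> B \<noteq> {}"
  shows "zariski_closure X A = zariski_closure X B"
  using assms unfolding zariski_closure_def by blast

section \<open>Isomorphisms\<close>

lemma restrict_surface_iff:
  "(D, \<psi>) \<in> restrict_surface X U \<longleftrightarrow> (\<exists>D'. (D', \<psi>) \<in> X \<and> D = {a \<in> D'. \<psi> a \<in> U})"
  unfolding restrict_surface_def by (force simp: image_iff)

lemma pts_restrict: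
  assumes "U \<subseteq> pts X"
  shows "pts (restrict_surface X U) = U"
proof (intro equalityI subsetI)
  fix p assume "p \<in> pts (restrict_surface X U)"
  thus "p \<in> U" by (rule ptsE) (auto simp: restrict_surface_iff)
next
  fix p assume p: "p \<in> U"
  with assms have "p \<in> pts X" by blast
  then obtain D \<psi> a where "(D, \<psi>) \<in> X" "a \<in> D" "p = \<psi> a" by (rule ptsE)
  thus "p \<in> pts (restrict_surface X U)"
    using p ptsI[of "{a \<in> D. \<psi> a \<in> U}" \<psi> "restrict_surface X U" a] by (auto simp: restrict_surface_iff)
qed

lemma regular_map_restrict:
  assumes f: "regular_map X Y f" and "U \<subseteq> pts X" "V \<subseteq> pts Y" "f ` U \<subseteq> V"
  shows "regular_map (restrict_surface X U) (restrict_surface Y V) f"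
proof (rule regular_mapI)
  fix p assume "p \<in> pts (restrict_surface X U)"
  thus "f p \<in> pts (restrict_surface Y V)" using assms by (auto simp: pts_restrict)
next
  fix D \<psi> E \<chi> a b
  assume *: "(D, \<psi>) \<in> restrict_surface X U" "(E, \<chi>) \<in> restrict_surface Y V" "a \<in> D" "b \<in> E"
    "f (\<psi> a) = \<chi> b"
  obtain D' E' where D': "(D', \<psi>) \<in> X" "D = {a \<in> D'. \<psi> a \<in> U}" "(E', \<chi>) \<in> Y" "E = {b \<in> E'. \<chi> b \<in> V}"
    using *(1,2) unfolding restrict_surface_iff by blast
  have "loc f (D', \<psi>) (E', \<chi>) a" by (rule regular_mapD[OF f D'(1,3)]) (use * D' in auto)
  then obtain h where h: "reg2 h a" "\<forall>\<^sub>F x in zar a. x \<in> D' \<longrightarrow> h x \<in> E' \<and> f (\<psi> x) = \<chi> (h x)"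
    by (rule locE)
  show "loc f (D, \<psi>) (E, \<chi>) a"
  proof (rule locI[OF h(1)])
    show "\<forall>\<^sub>F x in zar a. x \<in> D \<longrightarrow> h x \<in> E \<and> f (\<psi> x) = \<chi> (h x)"
      using h(2)
    proof eventually_elim
      case (elim x)
      show ?case
      proof
        assume x: "x \<in> D"
        hence "f (\<psi> x) \<in> V" using assms(4) D' by auto
        thus "h x \<in> E \<and> f (\<psi> x) = \<chi> (h x)" using x elim D' by auto
      qed
    qed
  qed
qed

lemma restrict_surface_pts [simp]: "restrict_surface X (pts X) = X"
proof -
  have "{a \<in> D. \<psi> a \<in> pts X} = D" if "(D, \<psi>) \<in> X" for D \<psi>
    using ptsI[OF that] by blast
  hence "(\<lambda>(D, \<psi>). ({a \<in> D. \<psi> a \<in> pts X}, \<psi>)) C = C" if "C \<in> X" for C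
    using that by (cases C) simp
  thus ?thesis unfolding restrict_surface_def by simp
qed

lemma alg_surface_restrict:
  assumes "alg_surface X" "zariski_open X U"
  shows "alg_surface (restrict_surface X U)"
proof -
  have "regular_map (restrict_surface X U) (restrict_surface X U) (\<lambda>p. p)"
    using assms by (intro regular_map_restrict alg_surface_id) (auto dest: zariski_open_subset)
  moreover have "finite (restrict_surface X U)"
    using assms by (auto simp: restrict_surface_def alg_surface_def)
  moreover have "plane_open D \<and> inj_on \<psi> D" if mem: "(D, \<psi>) \<in> restrict_surface X U" for D \<psi>
  proof -
    obtain D' where D': "(D', \<psi>) \<in> X" "D = {a \<in> D'. \<psi> a \<in> U}"
      using mem unfolding restrict_surface_iff by blast
    have "plane_open D" unfolding D'(2) using assms(2) D'(1) by (auto simp: zariski_open_def)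
    moreover have "inj_on \<psi> D"
      using alg_surface_chart(2)[OF assms(1) D'(1)] by (rule inj_on_subset) (auto simp: D'(2))
    ultimately show ?thesis ..
  qed
  ultimately show ?thesis unfolding alg_surface_def by blast
qed

lemma biregular_restrict:
  assumes f: "biregular X Y f" and U: "zariski_open X U" and V: "zariski_open Y V" and fU: "f ` U = V"
  shows "biregular (restrict_surface X U) (restrict_surface Y V) f"
proof -
  have sub: "U \<subseteq> pts X" "V \<subseteq> pts Y" using U V by (auto dest: zariski_open_subset)
  have bij: "bij_betw f (pts X) (pts Y)" using f by (simp add: biregular_def)
  have bijU: "bij_betw f U V" using bij_betw_subset[OF bij sub(1) fU] .
  \<comment> \<open>The chosen inverse depends on the set on which it is taken; injectivity makes
    both choices agree on \<open>V\<close>.\<close>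
  have eq: "inv_into U f p = inv_into (pts X) f p" if "p \<in> V" for p
    using that bij fU sub(1) by (metis bij_betw_def f_inv_into_f inj_on_contraD inv_into_f_f
        inv_into_into subsetD)
  have im: "inv_into (pts X) f ` V \<subseteq> U"
    using eq fU by (metis image_subsetI inv_into_into)
  have "regular_map (restrict_surface Y V) (restrict_surface X U) (inv_into U f)"
    by (rule regular_map_cong[OF regular_map_restrict[OF _ sub(2,1) im]])
       (use f eq sub in \<open>auto simp: biregular_def pts_restrict\<close>)
  moreover have "regular_map (restrict_surface X U) (restrict_surface Y V) f"
    using f sub fU by (intro regular_map_restrict) (auto simp: biregular_def)
  ultimately show ?thesis
    using f U V bijU sub by (simp add: biregular_def pts_restrict alg_surface_restrict)
qed

lemma biregular_open_image:
  assumes f: "biregular X Y f" and U: "zariski_open X U"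
  shows "zariski_open Y (f ` U)"
proof -
  have bij: "bij_betw f (pts X) (pts Y)" using f by (simp add: biregular_def)
  have "f ` U = {p \<in> pts Y. inv_into (pts X) f p \<in> U}"
    using bij zariski_open_subset[OF U] 
    by (auto simp: bij_betw_def inv_into_f_f subset_iff image_iff) (metis f_inv_into_f)
  thus ?thesis
    using f zariski_open_vimage[OF _ _ _ U, of Y "inv_into (pts X) f"] by (simp add: biregular_def)
qed

lemma biregular_closure_image:
  assumes f: "biregular X Y f" and A: "A \<subseteq> pts X"
  shows "f ` zariski_closure X A = zariski_closure Y (f ` A)"
proof -
  have bij: "bij_betw f (pts X) (pts Y)" using f by (simp add: biregular_def)
  have reg: "alg_surface X" "alg_surface Y" "regular_map X Y f" using f by (auto simp: biregular_def)
  have "f p \<in> zariski_closure Y (f ` A) \<longleftrightarrow> p \<in> zariski_closure X A" if p: "p \<in> pts X" for p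
  proof
    assume *: "p \<in> zariski_closure X A"
    show "f p \<in> zariski_closure Y (f ` A)"
    proof (rule zariski_closureI)
      fix V assume V: "zariski_open Y V" "f p \<in> V"
      have "{p \<in> pts X. f p \<in> V} \<inter> A \<noteq> {}"
        using * zariski_open_vimage[OF reg V(1)] p V(2) unfolding zariski_closure_def by blast
      thus "V \<inter> f ` A \<noteq> {}" by blast
    qed (rule regular_map_pts[OF reg(3) p])
  next
    assume *: "f p \<in> zariski_closure Y (f ` A)"
    show "p \<in> zariski_closure X A"
    proof (rule zariski_closureI[OF p])
      fix U assume U: "zariski_open X U" "p \<in> U"
      have "f ` U \<inter> f ` A \<noteq> {}"
        using * biregular_open_image[OF f U(1)] U(2) unfolding zariski_closure_def by blast
      thus "U \<inter> A \<noteq> {}" using bij A zariski_open_subset[OF U(1)]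
        by (metis bij_betw_def image_empty inj_on_image_Int)
    qed
  qed
  note 1 = this
  show ?thesis
  proof (intro equalityI subsetI)
    fix p' assume p': "p' \<in> zariski_closure Y (f ` A)"
    then obtain p where "p \<in> pts X" "p' = f p"
      using bij zariski_closure_subset_pts[of Y "f ` A"] unfolding bij_betw_def by blast
    thus "p' \<in> f ` zariski_closure X A" using 1 p' by blast
  next
    fix p' assume "p' \<in> f ` zariski_closure X A"
    then obtain p where "p \<in> zariski_closure X A" "p' = f p" by blast
    thus "p' \<in> zariski_closure Y (f ` A)" using 1 zariski_closure_subset_pts[of X A] by blast
  qed
qed

lemma biregular_dense_image:
  assumes f: "biregular X Y f" and U: "dense_open X U"
  shows "dense_open Y (f ` U)"
proof -
  have "f ` pts X = pts Y" using f by (auto simp: biregular_def bij_betw_def)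
  thus ?thesis using U biregular_closure_image[OF f, of U] biregular_open_image[OF f, of U] 
    unfolding dense_open_def zariski_open_def by auto
qed

text \<open>The open set \<open>V\<close> in the definition of a birational map is taken to be
  \<open>U\<close> itself, and \<open>W\<close> to be its image.\<close>

lemma birational_map_of_biregular:
  assumes f: "biregular X Y f" and U: "dense_open X U" and g: "\<And>p. p \<in> U \<Longrightarrow> g p = f p"
  shows "birational_map X Y U g"
proof -
  have op: "zariski_open X U" and sub: "U \<subseteq> pts X"
    using U by (auto simp: dense_open_def zariski_open_def)
  have fg: "f ` U = g ` U" using g by auto
  have op': "zariski_open Y (f ` U)" using biregular_open_image[OF f op] .
  have b: "biregular (restrict_surface X U) (restrict_surface Y (f ` U)) f"
    using biregular_restrict[OF f op op'] by simp
  have "regular_map (restrict_surface X U) (restrict_surface Y (pts Y)) f"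
    by (rule regular_map_restrict)
       (use f sub in \<open>auto simp: biregular_def bij_betw_def\<close>)
  hence r: "regular_map (restrict_surface X U) Y g"
    using g by (auto intro: regular_map_cong simp: pts_restrict[OF sub])
  have sub': "f ` U \<subseteq> pts Y" using op' by (simp add: zariski_open_def)
  \<comment> \<open>Both sides choose from the same predicate, because \<open>g\<close> and
    \<open>f\<close> agree on \<open>U\<close>.\<close>
  have eq: "inv_into U g p = inv_into U f p" for p
    unfolding inv_into_def using g by metis
  hence "biregular (restrict_surface X U) (restrict_surface Y (f ` U)) g"
    using b g unfolding biregular_def pts_restrict[OF sub] pts_restrict[OF sub']
    by (auto intro: regular_map_cong simp: pts_restrict[OF sub] pts_restrict[OF sub'] cong: bij_betw_cong)
  thus ?thesis
    using f U r biregular_dense_image[OF f U] unfolding birational_map_def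
    by (auto simp: biregular_def)
qed

text \<open>A local isomorphism together with its inverse in coordinates. The inverse is only asked to be
  a right inverse: this suffices to express the inverse of a bijection.\<close>

definition liso :: "('p \<Rightarrow> 'r) \<Rightarrow> 'p chart \<Rightarrow> 'r chart \<Rightarrow> complex \<times> complex \<Rightarrow> bool" where
  "liso f = (\<lambda>(D, \<psi>) (E, \<chi>) a. \<exists>h k. reg2 h a \<and> reg2 k (h a) \<and> k (h a) = a \<and> h a \<in> E \<and>
     (\<forall>\<^sub>F x in zar a. f (\<psi> x) = \<chi> (h x)) \<and> (\<forall>\<^sub>F y in zar (h a). h (k y) = y))"

lemma lisoI:
  assumes "reg2 h a" "reg2 k (h a)" "k (h a) = a" "h a \<in> E"
    "\<forall>\<^sub>F x in zar a. f (\<psi> x) = \<chi> (h x)" "\<forall>\<^sub>F y in zar (h a). h (k y) = y"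
  shows "liso f (D, \<psi>) (E, \<chi>) a"
  using assms unfolding liso_def prod.case by blast

lemma biregularI:
  assumes X: "alg_surface X" and Y: "alg_surface Y" and bij: "bij_betw f (pts X) (pts Y)"
    and l: "\<And>p. p \<in> pts X \<Longrightarrow> \<exists>D \<psi> E \<chi> a. (D, \<psi>) \<in> X \<and> a \<in> D \<and> \<psi> a = p \<and> (E, \<chi>) \<in> Y \<and>
               liso f (D, \<psi>) (E, \<chi>) a"
  shows "biregular X Y f"
proof -
  have 1: "\<exists>D \<psi> E \<chi> a b. (D, \<psi>) \<in> X \<and> a \<in> D \<and> \<psi> a = p \<and> (E, \<chi>) \<in> Y \<and> b \<in> E \<and> f p = \<chi> b \<and>
      loc f (D, \<psi>) (E, \<chi>) a \<and> loc (inv_into (pts X) f) (E, \<chi>) (D, \<psi>) b" if p: "p \<in> pts X" for p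
  proof -
    obtain D \<psi> E \<chi> a where *: "(D, \<psi>) \<in> X" "a \<in> D" "\<psi> a = p" "(E, \<chi>) \<in> Y" "liso f (D, \<psi>) (E, \<chi>) a"
      using l[OF p] by blast
    obtain h k where hk: "reg2 h a" "reg2 k (h a)" "k (h a) = a" "h a \<in> E"
      "\<forall>\<^sub>F x in zar a. f (\<psi> x) = \<chi> (h x)" "\<forall>\<^sub>F y in zar (h a). h (k y) = y"
      using *(5) unfolding liso_def prod.case by blast
    have "\<forall>\<^sub>F x in zar a. h x \<in> E"
      by (rule eventually_zar_compose[OF hk(1) alg_surface_open[OF Y *(4) hk(4)]])
    with hk(5) have "\<forall>\<^sub>F x in zar a. x \<in> D \<longrightarrow> h x \<in> E \<and> f (\<psi> x) = \<chi> (h x)"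
      by eventually_elim simp
    hence "loc f (D, \<psi>) (E, \<chi>) a" by (rule locI[OF hk(1)])
    moreover have "\<forall>\<^sub>F y in zar (h a). k y \<in> D \<and> f (\<psi> (k y)) = \<chi> (h (k y))"
      by (rule eventually_zar_compose[OF hk(2)], unfold hk(3), rule eventually_conj)
         (use hk(5) alg_surface_open[OF X *(1,2)] in auto)
    hence "\<forall>\<^sub>F y in zar (h a). y \<in> E \<longrightarrow> k y \<in> D \<and> inv_into (pts X) f (\<chi> y) = \<psi> (k y)"
      using hk(6)
    proof eventually_elim
      case (elim y)
      \<comment> \<open>This is where a right inverse in coordinates suffices: it supplies some
        preimage of \<open>\<chi> y\<close>, and injectivity of \<open>f\<close> identifies it with
        the chosen one.\<close>
      hence "\<chi> y = f (\<psi> (k y))" "\<psi> (k y) \<in> pts X" using ptsI[OF *(1)] by auto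
      thus ?case using bij elim inv_into_f_f[of f "pts X" "\<psi> (k y)"] by (simp add: bij_betw_def)
    qed
    hence "loc (inv_into (pts X) f) (E, \<chi>) (D, \<psi>) (h a)" by (rule locI[OF hk(2)])
    moreover have "f p = \<chi> (h a)" using eventually_zar_self[OF hk(5)] *(3) by simp
    ultimately show ?thesis using * hk(4) by (intro exI conjI)
  qed
  have "regular_map X Y f"
  proof (rule regular_map_localI[OF X Y])
    fix p assume "p \<in> pts X"
    from 1[OF this] show "\<exists>D \<psi> E \<chi> a. (D, \<psi>) \<in> X \<and> a \<in> D \<and> \<psi> a = p \<and> (E, \<chi>) \<in> Y \<and>
               loc f (D, \<psi>) (E, \<chi>) a"
      by (elim exE conjE) (intro exI conjI)
  qed
  moreover have "regular_map Y X (inv_into (pts X) f)"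
  proof (rule regular_map_localI[OF Y X])
    fix p' assume "p' \<in> pts Y"
    then obtain p where p: "p \<in> pts X" "f p = p'" using bij unfolding bij_betw_def by (metis imageE)
    from 1[OF p(1)] show "\<exists>D \<psi> E \<chi> a. (D, \<psi>) \<in> Y \<and> a \<in> D \<and> \<psi> a = p' \<and> (E, \<chi>) \<in> X \<and>
               loc (inv_into (pts X) f) (D, \<psi>) (E, \<chi>) a"
      by (elim exE conjE) (intro exI conjI, use p(2) in simp_all)
  qed
  ultimately show ?thesis using X Y bij by (simp add: biregular_def)
qed

section \<open>Blow-ups\<close>

text \<open>By irreducibility of the plane, one point of \<open>U\<close> in the domain of a chart
  makes \<open>U\<close> meet every nonempty open set seen in that chart.\<close>

lemma dense_openI:
  assumes X: "alg_surface X" and U: "zariski_open X U"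
    and meet: "\<And>D \<psi>. (D, \<psi>) \<in> X \<Longrightarrow> \<exists>b\<in>D. \<psi> b \<in> U"
  shows "dense_open X U"
proof -
  have "p \<in> zariski_closure X U" if p: "p \<in> pts X" for p
  proof (rule zariski_closureI[OF p])
    fix V assume V: "zariski_open X V" "p \<in> V"
    obtain D \<psi> a where D: "(D, \<psi>) \<in> X" "a \<in> D" "p = \<psi> a" using p by (rule ptsE)
    obtain b where b: "b \<in> D" "\<psi> b \<in> U" using meet[OF D(1)] by blast
    show "V \<inter> U \<noteq> {}"
      using zar_meet[OF zariski_openD[OF V(1) D(1,2)] zariski_openD[OF U D(1) b]] V(2) D(3) by auto
  qed
  hence "zariski_closure X U = pts X" by (intro equalityI zariski_closure_subset_pts subsetI)
  thus ?thesis using U unfolding dense_open_def by simp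
qed

text \<open>\<open>bd1\<close> and \<open>bd2\<close> are the blow-down in the two standard charts.
  With \<open>dom1\<close>, \<open>par1\<close> and their companions they restate the chart
  definitions by projections instead of nested tuple patterns, so that the calculus of regular
  functions applies.\<close>

definition bd1 :: "complex \<times> complex \<Rightarrow> complex \<times> complex \<Rightarrow> complex \<times> complex" where
  "bd1 a x = (fst a + fst x, snd a + snd x * fst x)"

definition bd2 :: "complex \<times> complex \<Rightarrow> complex \<times> complex \<Rightarrow> complex \<times> complex" where
  "bd2 a x = (fst a + fst x * snd x, snd a + snd x)"

definition dom1 :: "'p set \<Rightarrow> (complex \<times> complex) set \<Rightarrow> (complex \<times> complex \<Rightarrow> 'p) \<Rightarrow> complex \<times> complex \<Rightarrow>
    (complex \<times> complex) set" where
  "dom1 S D \<psi> a = {x. fst x = 0 \<or> bd1 a x \<in> D \<and> \<psi> (bd1 a x) \<notin> S}"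

definition dom2 :: "'p set \<Rightarrow> (complex \<times> complex) set \<Rightarrow> (complex \<times> complex \<Rightarrow> 'p) \<Rightarrow> complex \<times> complex \<Rightarrow>
    (complex \<times> complex) set" where
  "dom2 S D \<psi> a = {x. snd x = 0 \<or> bd2 a x \<in> D \<and> \<psi> (bd2 a x) \<notin> S}"

definition par1 :: "(complex \<times> complex \<Rightarrow> 'p) \<Rightarrow> complex \<times> complex \<Rightarrow> complex \<times> complex \<Rightarrow> 'p blown" where
  "par1 \<psi> a x = (if fst x = 0 then Exc (\<psi> a) (Fin (snd x)) else Away (\<psi> (bd1 a x)))"

definition par2 :: "(complex \<times> complex \<Rightarrow> 'p) \<Rightarrow> complex \<times> complex \<Rightarrow> complex \<times> complex \<Rightarrow> 'p blown" where
  "par2 \<psi> a x = (if snd x = 0 then Exc (\<psi> a) (p1_inv (Fin (fst x))) else Away (\<psi> (bd2 a x)))"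

lemma blowup_chart1_eq: "blowup_chart1 S ((D, \<psi>), a) = (dom1 S D \<psi> a, par1 \<psi> a)"
  by (cases a) (auto simp: blowup_chart1_def dom1_def par1_def bd1_def fun_eq_iff)

lemma blowup_chart2_eq: "blowup_chart2 S ((D, \<psi>), a) = (dom2 S D \<psi> a, par2 \<psi> a)"
  by (cases a) (auto simp: blowup_chart2_def dom2_def par2_def bd2_def fun_eq_iff)

lemma p1_inv_inv [simp]: "p1_inv (p1_inv w) = w"
  by (cases w) auto

lemma p1_inv_inject [simp]: "p1_inv w = p1_inv w' \<longleftrightarrow> w = w'"
  by (metis p1_inv_inv)

lemma reg2_bd1 [reg_intros]: "reg2 (bd1 a) x"
  unfolding bd1_def by (intro reg_intros)

lemma reg2_bd2 [reg_intros]: "reg2 (bd2 a) x"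
  unfolding bd2_def by (intro reg_intros)

lemma bd1_eq_centre: "bd1 a x = a \<longleftrightarrow> fst x = 0"
  by (cases a) (auto simp: bd1_def)

lemma bd2_eq_centre: "bd2 a x = a \<longleftrightarrow> snd x = 0"
  by (cases a) (auto simp: bd2_def)

lemma bd1_inj: "bd1 a x = bd1 a y \<Longrightarrow> fst x \<noteq> 0 \<Longrightarrow> x = y"
  by (cases x; cases y) (auto simp: bd1_def)

lemma bd2_inj: "bd2 a x = bd2 a y \<Longrightarrow> snd x \<noteq> 0 \<Longrightarrow> x = y"
  by (cases x; cases y) (auto simp: bd2_def)

section \<open>The blow-up as an algebraic surface\<close>

locale blowup_data =
  fixes X :: "'p surface" and K :: "'p centre set" and S :: "'p set"
  assumes X: "alg_surface X" and fin: "finite K"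
    and centre: "\<And>D \<psi> a. ((D, \<psi>), a) \<in> K \<Longrightarrow> (D, \<psi>) \<in> X \<and> a \<in> D"
    and inj: "inj_on centre_pt K"
  defines "S \<equiv> centre_pt ` K"
begin

lemma finS: "finite S"
  unfolding S_def using fin by simp

lemma centre_in_S: "((D, \<psi>), a) \<in> K \<Longrightarrow> \<psi> a \<in> S"
  unfolding S_def by (force simp: centre_pt_def)

lemma SE:
  assumes "p \<in> S"
  obtains D \<psi> a where "((D, \<psi>), a) \<in> K" "p = \<psi> a"
proof -
  obtain k where k: "k \<in> K" "p = centre_pt k" using assms unfolding S_def by blast
  obtain D \<psi> a where "k = ((D, \<psi>), a)" by (metis surj_pair)
  thus ?thesis using that[of D \<psi> a] k by (simp add: centre_pt_def)
qed

lemma blowup_cases [consumes 1, case_names away c1 c2]: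
  assumes "(E, \<chi>) \<in> blowup X K"
  obtains D \<psi> where "(D, \<psi>) \<in> X" "E = {a \<in> D. \<psi> a \<notin> S}" "\<chi> = Away \<circ> \<psi>"
  | D \<psi> a where "((D, \<psi>), a) \<in> K" "E = dom1 S D \<psi> a" "\<chi> = par1 \<psi> a"
  | D \<psi> a where "((D, \<psi>), a) \<in> K" "E = dom2 S D \<psi> a" "\<chi> = par2 \<psi> a"
proof -
  from assms consider C where "C \<in> X" "(E, \<chi>) = (\<lambda>(D, \<psi>). ({a \<in> D. \<psi> a \<notin> S}, Away \<circ> \<psi>)) C"
    | k where "k \<in> K" "(E, \<chi>) = blowup_chart1 S k" | k where "k \<in> K" "(E, \<chi>) = blowup_chart2 S k"
    unfolding blowup_def S_def[symmetric] by blast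
  thus thesis
  proof cases
    case 1
    thus ?thesis by (cases C) (auto intro: that(1))
  next
    case 2
    obtain D \<psi> a where "k = ((D, \<psi>), a)" by (metis surj_pair)
    thus ?thesis using 2 that(2)[of D \<psi> a] by (simp add: blowup_chart1_eq)
  next
    case 3
    obtain D \<psi> a where "k = ((D, \<psi>), a)" by (metis surj_pair)
    thus ?thesis using 3 that(3)[of D \<psi> a] by (simp add: blowup_chart2_eq)
  qed
qed

lemma away_chart: "(D, \<psi>) \<in> X \<Longrightarrow> ({a \<in> D. \<psi> a \<notin> S}, Away \<circ> \<psi>) \<in> blowup X K"
  unfolding blowup_def S_def[symmetric] by force

lemma chart1: "((D, \<psi>), a) \<in> K \<Longrightarrow> (dom1 S D \<psi> a, par1 \<psi> a) \<in> blowup X K"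
  unfolding blowup_def S_def[symmetric] blowup_chart1_eq[symmetric] by blast

lemma chart2: "((D, \<psi>), a) \<in> K \<Longrightarrow> (dom2 S D \<psi> a, par2 \<psi> a) \<in> blowup X K"
  unfolding blowup_def S_def[symmetric] blowup_chart2_eq[symmetric] by blast

lemma pts_Away_iff: "Away p \<in> pts (blowup X K) \<longleftrightarrow> p \<in> pts X \<and> p \<notin> S"
proof
  assume "Away p \<in> pts (blowup X K)"
  then obtain E \<chi> x where x: "(E, \<chi>) \<in> blowup X K" "x \<in> E" "Away p = \<chi> x" by (rule ptsE)
  from x(1) show "p \<in> pts X \<and> p \<notin> S"
  proof (cases rule: blowup_cases)
    case (away D \<psi>)
    thus ?thesis using x ptsI[OF away(1), of x] by simp
  next
    case (c1 D \<psi> a)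
    thus ?thesis using x centre[OF c1(1)] ptsI[of D \<psi> X "bd1 a x"]
      by (auto simp: par1_def dom1_def split: if_splits)
  next
    case (c2 D \<psi> a)
    thus ?thesis using x centre[OF c2(1)] ptsI[of D \<psi> X "bd2 a x"]
      by (auto simp: par2_def dom2_def split: if_splits)
  qed
next
  assume p: "p \<in> pts X \<and> p \<notin> S"
  then obtain D \<psi> a where D: "(D, \<psi>) \<in> X" "a \<in> D" "p = \<psi> a" by (blast elim: ptsE)
  thus "Away p \<in> pts (blowup X K)" using ptsI[OF away_chart[OF D(1)], of a] p by simp
qed

lemma pts_Exc_iff: "Exc p m \<in> pts (blowup X K) \<longleftrightarrow> p \<in> S"
proof
  assume "Exc p m \<in> pts (blowup X K)"
  then obtain E \<chi> x where x: "(E, \<chi>) \<in> blowup X K" "x \<in> E" "Exc p m = \<chi> x" by (rule ptsE)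
  from x(1) show "p \<in> S"
    by (cases rule: blowup_cases)
       (use x centre_in_S in \<open>auto simp: par1_def par2_def split: if_splits\<close>)
next
  assume "p \<in> S"
  then obtain D \<psi> a where D: "((D, \<psi>), a) \<in> K" "p = \<psi> a" by (rule SE)
  show "Exc p m \<in> pts (blowup X K)"
  proof (cases m)
    case (Fin x)
    thus ?thesis using ptsI[OF chart1[OF D(1)], of "(0, x)"] D by (simp add: dom1_def par1_def)
  next
    case Infty
    thus ?thesis using ptsI[OF chart2[OF D(1)], of "(0, 0)"] D by (simp add: dom2_def par2_def)
  qed
qed

text \<open>\<open>S\<close> is finite and the chart injective, so only finitely many coordinates
  are bad. The exempted point \<open>a\<close> lets \<open>b\<close> be a centre itself, as happens
  on the exceptional line.\<close>

lemma eventually_avoid: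
  assumes "(D, \<psi>) \<in> X" "b \<in> D" "\<psi> b \<notin> S \<or> b = a"
  shows "\<forall>\<^sub>F x in zar b. x \<in> D \<and> (\<psi> x \<in> S \<longrightarrow> x = a)"
proof -
  have "finite {x \<in> D. \<psi> x \<in> S}"
    using finite_vimage_IntI[OF finS alg_surface_chart(2)[OF X assms(1)]]
    by (rule back_subst[of finite]) auto
  hence "\<forall>\<^sub>F x in zar b. x \<notin> {x \<in> D. \<psi> x \<in> S} - {a}"
    using assms by (intro eventually_zar_finite) auto
  with alg_surface_open[OF X assms(1,2)] show ?thesis by eventually_elim simp
qed

lemma open_dom1:
  assumes "((D, \<psi>), a) \<in> K"
  shows "plane_open (dom1 S D \<psi> a)"
  unfolding plane_open_iff
proof
  fix x assume x: "x \<in> dom1 S D \<psi> a"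
  have 1: "bd1 a x \<in> D" "\<psi> (bd1 a x) \<notin> S \<or> bd1 a x = a" and D: "(D, \<psi>) \<in> X"
    using x centre[OF assms] bd1_eq_centre[of a x] by (auto simp: dom1_def)
  from eventually_zar_compose[OF reg2_bd1 eventually_avoid[of D \<psi> "bd1 a x" a, OF D 1]]
  have "\<forall>\<^sub>F x in zar x. bd1 a x \<in> D \<and> (\<psi> (bd1 a x) \<in> S \<longrightarrow> bd1 a x = a)" .
  thus "\<forall>\<^sub>F x in zar x. x \<in> dom1 S D \<psi> a"
    by eventually_elim (auto simp: dom1_def bd1_eq_centre)
qed

lemma open_dom2:
  assumes "((D, \<psi>), a) \<in> K"
  shows "plane_open (dom2 S D \<psi> a)"
  unfolding plane_open_iff
proof
  fix x assume x: "x \<in> dom2 S D \<psi> a"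
  have 1: "bd2 a x \<in> D" "\<psi> (bd2 a x) \<notin> S \<or> bd2 a x = a" and D: "(D, \<psi>) \<in> X"
    using x centre[OF assms] bd2_eq_centre[of a x] by (auto simp: dom2_def)
  from eventually_zar_compose[OF reg2_bd2 eventually_avoid[of D \<psi> "bd2 a x" a, OF D 1]]
  have "\<forall>\<^sub>F x in zar x. bd2 a x \<in> D \<and> (\<psi> (bd2 a x) \<in> S \<longrightarrow> bd2 a x = a)" .
  thus "\<forall>\<^sub>F x in zar x. x \<in> dom2 S D \<psi> a"
    by eventually_elim (auto simp: dom2_def bd2_eq_centre)
qed

lemma open_away:
  assumes "(D, \<psi>) \<in> X"
  shows "plane_open {a \<in> D. \<psi> a \<notin> S}"
  unfolding plane_open_iff
proof
  fix b assume "b \<in> {a \<in> D. \<psi> a \<notin> S}"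
  \<comment> \<open>Any such \<open>c\<close>, for instance \<open>b\<close>, makes the exemption in
    \<open>eventually_avoid\<close> vacuous.\<close>
  moreover obtain c where c: "\<psi> c \<notin> S \<or> c \<notin> D" using calculation by blast
  ultimately have "\<forall>\<^sub>F x in zar b. x \<in> D \<and> (\<psi> x \<in> S \<longrightarrow> x = c)"
    by (intro eventually_avoid[OF assms]) auto
  thus "\<forall>\<^sub>F x in zar b. x \<in> {a \<in> D. \<psi> a \<notin> S}"
    by eventually_elim (use c in auto)
qed

lemma inj_par1:
  assumes "((D, \<psi>), a) \<in> K"
  shows "inj_on (par1 \<psi> a) (dom1 S D \<psi> a)"
proof (rule inj_onI)
  fix x y assume *: "x \<in> dom1 S D \<psi> a" "y \<in> dom1 S D \<psi> a" "par1 \<psi> a x = par1 \<psi> a y"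
  have i: "inj_on \<psi> D" using alg_surface_chart(2)[OF X] centre[OF assms] by blast
  show "x = y"
  proof (cases "fst x = 0")
    case True
    thus ?thesis using *(3) by (auto simp: par1_def prod_eq_iff split: if_splits)
  next
    case False
    hence "bd1 a x = bd1 a y"
      using * i by (auto simp: par1_def dom1_def split: if_splits dest: inj_onD)
    thus ?thesis using False by (rule bd1_inj)
  qed
qed

lemma inj_par2:
  assumes "((D, \<psi>), a) \<in> K"
  shows "inj_on (par2 \<psi> a) (dom2 S D \<psi> a)"
proof (rule inj_onI)
  fix x y assume *: "x \<in> dom2 S D \<psi> a" "y \<in> dom2 S D \<psi> a" "par2 \<psi> a x = par2 \<psi> a y"
  have i: "inj_on \<psi> D" using alg_surface_chart(2)[OF X] centre[OF assms] by blast
  show "x = y"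
  proof (cases "snd x = 0")
    case True
    thus ?thesis using *(3) by (auto simp: par2_def prod_eq_iff simp del: p1_inv.simps split: if_splits)
  next
    case False
    hence "bd2 a x = bd2 a y"
      using * i by (auto simp: par2_def dom2_def split: if_splits dest: inj_onD)
    thus ?thesis using False by (rule bd2_inj)
  qed
qed

lemma inj_chart:
  assumes "(E, \<chi>) \<in> blowup X K"
  shows "inj_on \<chi> E"
  using assms
proof (cases rule: blowup_cases)
  case (away D \<psi>)
  thus ?thesis using alg_surface_chart(2)[OF X away(1)] by (auto simp: inj_on_def)
qed (auto simp: inj_par1 inj_par2)

lemma open_chart:
  assumes "(E, \<chi>) \<in> blowup X K"
  shows "plane_open E"
  using assms by (cases rule: blowup_cases) (auto simp: open_away open_dom1 open_dom2)

text \<open>Off the exceptional lines the coordinate change is the blow-down followed by a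
  coordinate change of \<open>X\<close>.\<close>

lemma loc_to_away:
  assumes C: "(E, \<chi>) \<in> blowup X K" and D: "(D, \<psi>) \<in> X" and xb: "x \<in> E" "b \<in> D" "\<chi> x = Away (\<psi> b)"
  shows "loc (\<lambda>p. p) (E, \<chi>) ({a \<in> D. \<psi> a \<notin> S}, Away \<circ> \<psi>) x"
  using C
proof (cases rule: blowup_cases)
  case (away D' \<psi>')
  have "loc (\<lambda>p. p) (D', \<psi>') (D, \<psi>) x"
    by (rule regular_mapD[OF alg_surface_id[OF X] away(1) D _ xb(2)]) (use xb away in auto)
  then obtain h where h: "reg2 h x" "\<forall>\<^sub>F y in zar x. y \<in> D' \<longrightarrow> h y \<in> D \<and> \<psi>' y = \<psi> (h y)"
    by (rule locE)
  show ?thesis unfolding away(2,3)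
    by (rule locI[OF h(1)]) (use h(2) in \<open>eventually_elim, auto\<close>)
next
  case (c1 D' \<psi>' a)
  have nz: "fst x \<noteq> 0" using xb(3) c1(3) by (auto simp: par1_def)
  have D': "(D', \<psi>') \<in> X" using centre[OF c1(1)] by blast
  have "loc (\<lambda>p. p) (D', \<psi>') (D, \<psi>) (bd1 a x)"
    by (rule regular_mapD[OF alg_surface_id[OF X] D' D _ xb(2)])
       (use xb c1 nz in \<open>auto simp: dom1_def par1_def\<close>)
  then obtain h where h: "reg2 h (bd1 a x)" "\<forall>\<^sub>F y in zar (bd1 a x). y \<in> D' \<longrightarrow> h y \<in> D \<and> \<psi>' y = \<psi> (h y)"
    by (rule locE)
  have "\<forall>\<^sub>F y in zar x. fst y \<noteq> 0" by (rule reg_nonzero[OF reg_fst nz])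
  with eventually_zar_compose[OF reg2_bd1 h(2)]
  have "\<forall>\<^sub>F y in zar x. y \<in> dom1 S D' \<psi>' a \<longrightarrow>
      h (bd1 a y) \<in> {a \<in> D. \<psi> a \<notin> S} \<and> par1 \<psi>' a y = (Away \<circ> \<psi>) (h (bd1 a y))"
    by eventually_elim (auto simp: dom1_def par1_def)
  thus ?thesis unfolding c1(2,3)
    by (intro locI[OF reg2_compose[OF h(1) reg2_bd1]])
next
  case (c2 D' \<psi>' a)
  have nz: "snd x \<noteq> 0" using xb(3) c2(3) by (auto simp: par2_def)
  have D': "(D', \<psi>') \<in> X" using centre[OF c2(1)] by blast
  have "loc (\<lambda>p. p) (D', \<psi>') (D, \<psi>) (bd2 a x)"
    by (rule regular_mapD[OF alg_surface_id[OF X] D' D _ xb(2)])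
       (use xb c2 nz in \<open>auto simp: dom2_def par2_def\<close>)
  then obtain h where h: "reg2 h (bd2 a x)" "\<forall>\<^sub>F y in zar (bd2 a x). y \<in> D' \<longrightarrow> h y \<in> D \<and> \<psi>' y = \<psi> (h y)"
    by (rule locE)
  have "\<forall>\<^sub>F y in zar x. snd y \<noteq> 0" by (rule reg_nonzero[OF reg_snd nz])
  with eventually_zar_compose[OF reg2_bd2 h(2)]
  have "\<forall>\<^sub>F y in zar x. y \<in> dom2 S D' \<psi>' a \<longrightarrow>
      h (bd2 a y) \<in> {a \<in> D. \<psi> a \<notin> S} \<and> par2 \<psi>' a y = (Away \<circ> \<psi>) (h (bd2 a y))"
    by eventually_elim (auto simp: dom2_def par2_def)
  thus ?thesis unfolding c2(2,3)
    by (intro locI[OF reg2_compose[OF h(1) reg2_bd2]])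
qed

text \<open>In a chart over a centre the blow-down is inverted by dividing by the coordinate that
  cuts out the exceptional line. That coordinate is nonzero at a point of the form
  \<open>Away\<close>, hence also near it.\<close>

lemma loc_from_away:
  assumes C: "(E, \<chi>) \<in> blowup X K" and D: "(D, \<psi>) \<in> X" and xb: "x \<in> E" "b \<in> D" "\<chi> x = Away (\<psi> b)"
  shows "loc (\<lambda>p. p) ({a \<in> D. \<psi> a \<notin> S}, Away \<circ> \<psi>) (E, \<chi>) b"
  using C
proof (cases rule: blowup_cases)
  case (away D' \<psi>')
  have "loc (\<lambda>p. p) (D, \<psi>) (D', \<psi>') b"
    by (rule regular_mapD[OF alg_surface_id[OF X] D away(1) xb(2), of x]) (use xb away in auto)
  then obtain h where h: "reg2 h b" "\<forall>\<^sub>F y in zar b. y \<in> D \<longrightarrow> h y \<in> D' \<and> \<psi> y = \<psi>' (h y)"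
    by (rule locE)
  show ?thesis unfolding away(2,3)
    by (rule locI[OF h(1)]) (use h(2) in \<open>eventually_elim, auto\<close>)
next
  case (c1 D' \<psi>' a)
  have nz: "fst x \<noteq> 0" using xb(3) c1(3) by (auto simp: par1_def)
  have D': "(D', \<psi>') \<in> X" using centre[OF c1(1)] by blast
  have x: "bd1 a x \<in> D'" "\<psi> b = \<psi>' (bd1 a x)"
    using xb c1 nz by (auto simp: dom1_def par1_def)
  have "loc (\<lambda>p. p) (D, \<psi>) (D', \<psi>') b"
    by (rule regular_mapD[OF alg_surface_id[OF X] D D' xb(2) x])
  then obtain h where h: "reg2 h b" "\<forall>\<^sub>F y in zar b. y \<in> D \<longrightarrow> h y \<in> D' \<and> \<psi> y = \<psi>' (h y)"
    by (rule locE)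
  have hb: "h b = bd1 a x"
    using eventually_zar_self[OF h(2)] x xb(2) inj_onD[OF alg_surface_chart(2)[OF X D'], of "h b" "bd1 a x"]
    by simp
  have hnz: "fst (h b) - fst a \<noteq> 0" using hb nz by (simp add: bd1_def)
  have r: "reg (\<lambda>y. fst (h y)) b" "reg (\<lambda>y. snd (h y)) b" using h(1) by (auto simp: reg2_def)
  show ?thesis unfolding c1(2,3)
  proof (rule locI)
    show "reg2 (\<lambda>y. (fst (h y) - fst a, (snd (h y) - snd a) / (fst (h y) - fst a))) b"
      by (intro reg_intros r hnz)
    have "\<forall>\<^sub>F y in zar b. fst (h y) - fst a \<noteq> 0"
      by (rule reg_nonzero) (intro reg_intros r, rule hnz)
    with h(2) show "\<forall>\<^sub>F y in zar b. y \<in> {a \<in> D. \<psi> a \<notin> S} \<longrightarrow>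
        (fst (h y) - fst a, (snd (h y) - snd a) / (fst (h y) - fst a)) \<in> dom1 S D' \<psi>' a \<and>
        (Away \<circ> \<psi>) y = par1 \<psi>' a (fst (h y) - fst a, (snd (h y) - snd a) / (fst (h y) - fst a))"
    proof eventually_elim
      case (elim y)
      hence "bd1 a (fst (h y) - fst a, (snd (h y) - snd a) / (fst (h y) - fst a)) = h y"
        by (simp add: bd1_def)
      thus ?case using elim by (auto simp: dom1_def par1_def)
    qed
  qed
next
  case (c2 D' \<psi>' a)
  have nz: "snd x \<noteq> 0" using xb(3) c2(3) by (auto simp: par2_def)
  have D': "(D', \<psi>') \<in> X" using centre[OF c2(1)] by blast
  have x: "bd2 a x \<in> D'" "\<psi> b = \<psi>' (bd2 a x)"
    using xb c2 nz by (auto simp: dom2_def par2_def)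
  have "loc (\<lambda>p. p) (D, \<psi>) (D', \<psi>') b"
    by (rule regular_mapD[OF alg_surface_id[OF X] D D' xb(2) x])
  then obtain h where h: "reg2 h b" "\<forall>\<^sub>F y in zar b. y \<in> D \<longrightarrow> h y \<in> D' \<and> \<psi> y = \<psi>' (h y)"
    by (rule locE)
  have hb: "h b = bd2 a x"
    using eventually_zar_self[OF h(2)] x xb(2) inj_onD[OF alg_surface_chart(2)[OF X D'], of "h b" "bd2 a x"]
    by simp
  have hnz: "snd (h b) - snd a \<noteq> 0" using hb nz by (simp add: bd2_def)
  have r: "reg (\<lambda>y. fst (h y)) b" "reg (\<lambda>y. snd (h y)) b" using h(1) by (auto simp: reg2_def)
  show ?thesis unfolding c2(2,3)
  proof (rule locI)
    show "reg2 (\<lambda>y. ((fst (h y) - fst a) / (snd (h y) - snd a), snd (h y) - snd a)) b"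
      by (intro reg_intros r hnz)
    have "\<forall>\<^sub>F y in zar b. snd (h y) - snd a \<noteq> 0"
      by (rule reg_nonzero) (intro reg_intros r, rule hnz)
    with h(2) show "\<forall>\<^sub>F y in zar b. y \<in> {a \<in> D. \<psi> a \<notin> S} \<longrightarrow>
        ((fst (h y) - fst a) / (snd (h y) - snd a), snd (h y) - snd a) \<in> dom2 S D' \<psi>' a \<and>
        (Away \<circ> \<psi>) y = par2 \<psi>' a ((fst (h y) - fst a) / (snd (h y) - snd a), snd (h y) - snd a)"
    proof eventually_elim
      case (elim y)
      hence "bd2 a ((fst (h y) - fst a) / (snd (h y) - snd a), snd (h y) - snd a) = h y"
        by (simp add: bd2_def)
      thus ?case using elim by (auto simp: dom2_def par2_def)
    qed
  qed
qed

lemma loc_chart_1_2: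
  assumes "m \<noteq> 0"
  shows "loc (\<lambda>p. p) (dom1 S D \<psi> a, par1 \<psi> a) (dom2 S D \<psi> a, par2 \<psi> a) (s, m)"
proof (rule locI)
  show "reg2 (\<lambda>x. (1 / snd x, snd x * fst x)) (s, m)"
    using assms by (intro reg_intros) auto
  have "\<forall>\<^sub>F x in zar (s, m). snd x \<noteq> 0" by (rule reg_nonzero[OF reg_snd]) (use assms in simp)
  thus "\<forall>\<^sub>F x in zar (s, m). x \<in> dom1 S D \<psi> a \<longrightarrow> (1 / snd x, snd x * fst x) \<in> dom2 S D \<psi> a \<and>
      par1 \<psi> a x = par2 \<psi> a (1 / snd x, snd x * fst x)"
    by eventually_elim (auto simp: dom1_def dom2_def par1_def par2_def bd1_def bd2_def)
qed

lemma loc_chart_2_1: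
  assumes "m \<noteq> 0"
  shows "loc (\<lambda>p. p) (dom2 S D \<psi> a, par2 \<psi> a) (dom1 S D \<psi> a, par1 \<psi> a) (m, s)"
proof (rule locI)
  show "reg2 (\<lambda>x. (fst x * snd x, 1 / fst x)) (m, s)"
    using assms by (intro reg_intros) auto
  have "\<forall>\<^sub>F x in zar (m, s). fst x \<noteq> 0" by (rule reg_nonzero[OF reg_fst]) (use assms in simp)
  thus "\<forall>\<^sub>F x in zar (m, s). x \<in> dom2 S D \<psi> a \<longrightarrow> (fst x * snd x, 1 / fst x) \<in> dom1 S D \<psi> a \<and>
      par2 \<psi> a x = par1 \<psi> a (fst x * snd x, 1 / fst x)"
    by eventually_elim (auto simp: dom1_def dom2_def par1_def par2_def bd1_def bd2_def)
qed

lemma loc_id: "loc (\<lambda>p. p) (D, \<psi>) (D, \<psi>) a"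
  by (rule locI[OF reg2_id]) auto

lemma centre_unique: "((D, \<psi>), a) \<in> K \<Longrightarrow> ((D', \<psi>'), a') \<in> K \<Longrightarrow> \<psi> a = \<psi>' a' \<Longrightarrow> D = D' \<and> \<psi> = \<psi>' \<and> a = a'"
  using inj_onD[OF inj, of "((D, \<psi>), a)" "((D', \<psi>'), a')"] by (simp add: centre_pt_def)

lemma alg_surface_blowup: "alg_surface (blowup X K)"
proof (rule alg_surfaceI)
  show "finite (blowup X K)" using X fin by (simp add: blowup_def alg_surface_def)
next
  fix E \<chi> E' \<chi>' x y
  assume *: "(E, \<chi>) \<in> blowup X K" "(E', \<chi>') \<in> blowup X K" "x \<in> E" "y \<in> E'" "\<chi> x = \<chi>' y"
  show "loc (\<lambda>p. p) (E, \<chi>) (E', \<chi>') x"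
  proof (cases "\<chi> x")
    \<comment> \<open>Off the exceptional lines the change of charts factors through the chart
      induced by a chart of \<open>X\<close> around the point.\<close>
    case (Away p)
    have "p \<in> pts X" "p \<notin> S" using ptsI[OF *(1,3)] Away pts_Away_iff by auto
    then obtain D \<psi> b where D: "(D, \<psi>) \<in> X" "b \<in> D" "p = \<psi> b" by (blast elim: ptsE)
    show ?thesis
      by (rule loc_comp[OF loc_to_away[OF *(1) D(1) *(3) D(2)] *(3) _ _ inj_chart[OF away_chart[OF D(1)]]
            loc_from_away[OF *(2) D(1) *(4) D(2)]])
         (use * D Away \<open>p \<notin> S\<close> in auto)
  next
    case (Exc p m)
    \<comment> \<open>A point of an exceptional line lies only in charts over its own centre, and
      distinct elements of \<open>K\<close> are distinct points. What remains are the two standard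
      charts over a single centre.\<close>
    have 1: "\<exists>D \<psi> a. ((D, \<psi>), a) \<in> K \<and> p = \<psi> a \<and>
        (E = dom1 S D \<psi> a \<and> \<chi> = par1 \<psi> a \<and> fst x = 0 \<and> m = Fin (snd x) \<or>
         E = dom2 S D \<psi> a \<and> \<chi> = par2 \<psi> a \<and> snd x = 0 \<and> m = p1_inv (Fin (fst x)))"
      if "(E, \<chi>) \<in> blowup X K" "\<chi> x = Exc p m" for E \<chi> x
      using that(1)
    proof (cases rule: blowup_cases)
      case (c1 D \<psi> a)
      thus ?thesis using that(2) by (intro exI[of _ D] exI[of _ \<psi>] exI[of _ a])
         (auto simp: par1_def split: if_splits)
    next
      case (c2 D \<psi> a)
      thus ?thesis using that(2) by (intro exI[of _ D] exI[of _ \<psi>] exI[of _ a])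
         (auto simp: par2_def simp del: p1_inv.simps split: if_splits)
    qed (use that(2) in auto)
    obtain D \<psi> a where a: "((D, \<psi>), a) \<in> K" "p = \<psi> a"
        "E = dom1 S D \<psi> a \<and> \<chi> = par1 \<psi> a \<and> fst x = 0 \<and> m = Fin (snd x) \<or>
         E = dom2 S D \<psi> a \<and> \<chi> = par2 \<psi> a \<and> snd x = 0 \<and> m = p1_inv (Fin (fst x))"
      using 1[OF *(1) Exc] by blast
    obtain D' \<psi>' a' where a': "((D', \<psi>'), a') \<in> K" "p = \<psi>' a'"
        "E' = dom1 S D' \<psi>' a' \<and> \<chi>' = par1 \<psi>' a' \<and> fst y = 0 \<and> m = Fin (snd y) \<or>
         E' = dom2 S D' \<psi>' a' \<and> \<chi>' = par2 \<psi>' a' \<and> snd y = 0 \<and> m = p1_inv (Fin (fst y))"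
      using 1[OF *(2)] Exc *(5) by metis
    have eq: "D' = D" "\<psi>' = \<psi>" "a' = a" using centre_unique[OF a(1) a'(1)] a(2) a'(2) by auto
    \<comment> \<open>A finite slope that also occurs as a value of the second chart is a
      reciprocal, hence nonzero, and there the charts are related by inverting the slope.\<close>
    have "snd x \<noteq> 0" if "m = Fin (snd x)" "m = p1_inv (Fin (fst y))"
      using that by (auto split: if_splits)
    moreover have "fst x \<noteq> 0" if "m = Fin (snd y)" "m = p1_inv (Fin (fst x))"
      using that by (auto split: if_splits)
    ultimately show ?thesis
      using a(3) a'(3) loc_id loc_chart_1_2[of "snd x" D \<psi> a "fst x"] loc_chart_2_1[of "fst x" D \<psi> a "snd x"]
      unfolding eq by (metis prod.collapse)
  qed
qed (auto simp: inj_chart open_chart)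

section \<open>Exceptional lines and generic points\<close>

lemma closed_exc_line:
  assumes k: "k \<in> K"
  shows "zariski_open (blowup X K) (pts (blowup X K) - exc_line k)"
proof (rule zariski_open_localI[OF alg_surface_blowup])
  fix p assume p: "p \<in> pts (blowup X K) - exc_line k"
  then obtain E \<chi> x where x: "(E, \<chi>) \<in> blowup X K" "x \<in> E" "p = \<chi> x" by (blast elim: ptsE)
  have E: "\<forall>\<^sub>F x in zar x. x \<in> E" using alg_surface_open[OF alg_surface_blowup x(1,2)] .
  obtain D' \<psi>' a' where k': "k = ((D', \<psi>'), a')" by (metis surj_pair)
  hence exc: "exc_line k = range (Exc (\<psi>' a'))" by (simp add: exc_line_def centre_pt_def)
  from x(1) have "\<forall>\<^sub>F x in zar x. \<chi> x \<notin> exc_line k"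
  proof (cases rule: blowup_cases)
    case (c1 D \<psi> a)
    show ?thesis
    proof (cases "\<psi> a = \<psi>' a'")
      case True
      hence "fst x \<noteq> 0" using p x(3) c1(3) exc by (auto simp: par1_def)
      from reg_nonzero[OF reg_fst this] show ?thesis
        by eventually_elim (auto simp: c1 par1_def exc)
    qed (auto simp: c1 par1_def exc intro!: always_eventually)
  next
    case (c2 D \<psi> a)
    show ?thesis
    proof (cases "\<psi> a = \<psi>' a'")
      case True
      hence "snd x \<noteq> 0" using p x(3) c2(3) exc by (auto simp: par2_def)
      from reg_nonzero[OF reg_snd this] show ?thesis
        by eventually_elim (auto simp: c2 par2_def exc)
    qed (auto simp: c2 par2_def exc intro!: always_eventually)
  qed (auto simp: exc image_iff)
  with E have "\<forall>\<^sub>F x in zar x. \<chi> x \<in> pts (blowup X K) - exc_line k"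
    by eventually_elim (use ptsI[OF x(1)] in blast)
  thus "\<exists>D \<psi> a. (D, \<psi>) \<in> blowup X K \<and> a \<in> D \<and> \<psi> a = p \<and>
      (\<forall>\<^sub>F x in zar a. \<psi> x \<in> pts (blowup X K) - exc_line k)"
    using x by blast
qed

lemma exc_line_subset: "k \<in> K \<Longrightarrow> exc_line k \<subseteq> pts (blowup X K)"
  unfolding exc_line_def using pts_Exc_iff by (auto simp: S_def)

text \<open>In the second chart the exceptional line passes through the vertical direction at the
  origin and has finite slopes elsewhere, so these accumulate there. The lemma is used to compare
  closures: a fibre over a root, less its centre, corresponds to the finite slopes on the other side
  of the map.\<close>

lemma closure_exc_line:
  assumes k: "k \<in> K"
  shows "zariski_closure (blowup X K) (range (\<lambda>m. Exc (centre_pt k) (Fin m))) = exc_line k"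
proof
  obtain D \<psi> a where k': "k = ((D, \<psi>), a)" by (metis surj_pair)
  hence cp: "centre_pt k = \<psi> a" by (simp add: centre_pt_def)
  show "zariski_closure (blowup X K) (range (\<lambda>m. Exc (centre_pt k) (Fin m))) \<subseteq> exc_line k"
    by (rule zariski_closure_minimal[OF _ closed_exc_line[OF k]]) (auto simp: exc_line_def)
  have sub: "range (\<lambda>m. Exc (centre_pt k) (Fin m)) \<subseteq> pts (blowup X K)"
    using exc_line_subset[OF k] by (auto simp: exc_line_def)
  have "Exc (\<psi> a) Infty \<in> zariski_closure (blowup X K) (range (\<lambda>m. Exc (centre_pt k) (Fin m)))"
  proof (rule zariski_closureI)
    show "Exc (\<psi> a) Infty \<in> pts (blowup X K)"
      using exc_line_subset[OF k] by (auto simp: exc_line_def cp)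
    fix U assume U: "zariski_open (blowup X K) U" "Exc (\<psi> a) Infty \<in> U"
    let ?h = "\<lambda>x::complex \<times> complex. (fst x, 0 :: complex)"
    have ev: "\<forall>\<^sub>F x in zar (?h (0, 0)). x \<in> dom2 S D \<psi> a \<and> par2 \<psi> a x \<in> U"
      using zariski_openD[OF U(1) chart2[OF k[unfolded k']], of "(0, 0)"] U(2)
      by (simp add: dom2_def par2_def)
    obtain x :: "complex \<times> complex" where x: "fst x \<notin> {0}" "par2 \<psi> a (fst x, 0) \<in> U"
      using zar_curve[where h = ?h, OF ev reg2_Pair[OF reg_fst reg_const], of "{0}"] by (meson finite.intros)
    hence "Exc (\<psi> a) (Fin (1 / fst x)) \<in> U" by (simp add: par2_def)
    thus "U \<inter> range (\<lambda>m. Exc (centre_pt k) (Fin m)) \<noteq> {}" using cp by auto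
  qed
  moreover have "Exc (\<psi> a) (Fin m) \<in> zariski_closure (blowup X K) (range (\<lambda>m. Exc (centre_pt k) (Fin m)))"
    for m
    using subset_zariski_closure[OF sub] cp by auto
  ultimately have "Exc (\<psi> a) m \<in> zariski_closure (blowup X K) (range (\<lambda>m. Exc (centre_pt k) (Fin m)))"
    for m
    by (cases m) simp_all
  thus "exc_line k \<subseteq> zariski_closure (blowup X K) (range (\<lambda>m. Exc (centre_pt k) (Fin m)))"
    unfolding exc_line_def cp by (rule image_subsetI)
qed

text \<open>Supplies the points required by \<open>dense_openI\<close>: a generic point of a chart
  of \<open>X\<close> lies in \<open>U\<close>, and its coordinates in a blow-up chart are found by
  inverting the blow-down.\<close>

lemma chart_meets:
  assumes gen: "\<And>D \<psi>. (D, \<psi>) \<in> X \<Longrightarrow> \<exists>Y. finite Y \<and> (\<forall>y c. y \<notin> Y \<longrightarrow> c \<noteq> 0 \<longrightarrow> (y, c) \<in> D \<and> \<psi> (y, c) \<in> U)"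
    and U: "U \<inter> S = {}" and C: "(E, \<chi>) \<in> blowup X K"
  shows "\<exists>x\<in>E. \<chi> x \<in> Away ` U"
  using C
proof (cases rule: blowup_cases)
  case (away D \<psi>)
  obtain Y where Y: "finite Y" "\<And>y c. y \<notin> Y \<Longrightarrow> c \<noteq> 0 \<Longrightarrow> (y, c) \<in> D \<and> \<psi> (y, c) \<in> U"
    using gen[OF away(1)] by blast
  obtain y where "y \<notin> Y" using ex_new_if_finite[OF infinite_UNIV_char_0 Y(1)] by blast
  hence "(y, 1) \<in> D" "\<psi> (y, 1) \<in> U" using Y(2) by auto
  thus ?thesis using away U by (intro bexI[of _ "(y, 1)"]) auto
next
  case (c1 D \<psi> a)
  obtain Y where Y: "finite Y" "\<And>y c. y \<notin> Y \<Longrightarrow> c \<noteq> 0 \<Longrightarrow> (y, c) \<in> D \<and> \<psi> (y, c) \<in> U"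
    using gen[OF conjunct1[OF centre[OF c1(1)]]] by blast
  \<comment> \<open>Avoiding \<open>fst a\<close> keeps the point off the locus where the blow-down
    of the first chart cannot be inverted.\<close>
  obtain y where y: "y \<notin> insert (fst a) Y" 
    using ex_new_if_finite[OF infinite_UNIV_char_0 finite.insertI[OF Y(1)]] by blast
  hence "(y, 1) \<in> D" "\<psi> (y, 1) \<in> U" using Y(2) by auto
  moreover have "bd1 a (y - fst a, (1 - snd a) / (y - fst a)) = (y, 1)"
    using y by (auto simp: bd1_def)
  ultimately show ?thesis using c1 U y
    by (intro bexI[of _ "(y - fst a, (1 - snd a) / (y - fst a))"]) (auto simp: dom1_def par1_def)
next
  case (c2 D \<psi> a)
  obtain Y where Y: "finite Y" "\<And>y c. y \<notin> Y \<Longrightarrow> c \<noteq> 0 \<Longrightarrow> (y, c) \<in> D \<and> \<psi> (y, c) \<in> U"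
    using gen[OF conjunct1[OF centre[OF c2(1)]]] by blast
  obtain y where y: "y \<notin> Y" using ex_new_if_finite[OF infinite_UNIV_char_0 Y(1)] by blast
  obtain c :: complex where c: "c \<notin> {0, snd a}"
    using ex_new_if_finite[OF infinite_UNIV_char_0, of "{0, snd a}"] by blast
  have "(y, c) \<in> D" "\<psi> (y, c) \<in> U" using Y(2) y c by auto
  moreover have "bd2 a ((y - fst a) / (c - snd a), c - snd a) = (y, c)"
    using c by (auto simp: bd2_def)
  ultimately show ?thesis using c2 U c
    by (intro bexI[of _ "((y - fst a) / (c - snd a), c - snd a)"]) (auto simp: dom2_def par2_def)
qed

end

text \<open>A local isomorphism \<open>(y, z) \<mapsto> (y, v)\<close> with
  \<open>v = v0 + A (y - a1) + B (z - a2)\<close> and \<open>B \<noteq> 0\<close> at the centre acts on slopes by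
  \<open>m \<mapsto> A + B m\<close> and lifts to the blow-ups. The inverse of the lift is expressed through the inverse
  \<open>K\<close> of the map itself.\<close>

lemma
  fixes A B K :: "complex \<times> complex \<Rightarrow> complex"
  assumes A: "reg A (a1, a2)" and B: "reg B (a1, a2)" "B (a1, a2) \<noteq> 0"
    and K: "reg K (a1, v0)" "K (a1, v0) = a2"
    and K_inv: "\<forall>\<^sub>F y in zar (a1, v0).
      v0 + A (fst y, K y) * (fst y - a1) + B (fst y, K y) * (K y - a2) = snd y"
    and f_Away: "\<forall>\<^sub>F x in zar (a1, a2). x \<noteq> (a1, a2) \<longrightarrow>
      f (Away (\<psi> x)) = Away (\<chi> (fst x, v0 + A x * (fst x - a1) + B x * (snd x - a2)))"
    and f_Fin: "\<And>m. f (Exc (\<psi> (a1, a2)) (Fin m)) = Exc (\<chi> (a1, v0)) (Fin (A (a1, a2) + B (a1, a2) * m))"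
    and f_Infty: "f (Exc (\<psi> (a1, a2)) Infty) = Exc (\<chi> (a1, v0)) Infty"
  shows liso_blowup1: "liso f (dom1 S D \<psi> (a1, a2), par1 \<psi> (a1, a2))
      (dom1 S' E \<chi> (a1, v0), par1 \<chi> (a1, v0)) (0, m)" (is ?th1)
    and liso_blowup2: "liso f (dom2 S D \<psi> (a1, a2), par2 \<psi> (a1, a2))
      (dom2 S' E \<chi> (a1, v0), par2 \<chi> (a1, v0)) (0, 0)" (is ?th2)
proof -
  define k where "k y = (fst y, K y)" for y
  have k: "reg2 k (a1, v0)" "k (a1, v0) = (a1, a2)"
    unfolding k_def using K by (auto intro!: reg_intros)
  have nzB: "\<forall>\<^sub>F y in zar (a1, v0). B (k y) \<noteq> 0"
    by (rule eventually_zar_compose[OF k(1)]) (simp add: k(2) reg_nonzero[OF B])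
  note rAk = reg_compose[of A k "(a1, v0)", unfolded k(2), OF A k(1)]
  note rBk = reg_compose[of B k "(a1, v0)", unfolded k(2), OF B(1) k(1)]
  show ?th1
  proof (rule lisoI)
    let ?a = "(a1, a2)" and ?b = "(a1, v0)"
    \<comment> \<open>To undo m' = A + B m, the coefficients are needed at the unknown source point;
      \<open>k\<close>, applied to the blown-down image, recovers that point.\<close>
    let ?h = "\<lambda>x. (fst x, A (bd1 ?a x) + B (bd1 ?a x) * snd x)"
    let ?k = "\<lambda>y. (fst y, (snd y - A (k (bd1 ?b y))) / B (k (bd1 ?b y)))"
    have c: "bd1 ?a (0, m) = ?a" "bd1 ?b (0, m') = ?b" for m' by (auto simp: bd1_def)
    have rb: "reg2 (bd1 ?a) x" "reg2 (bd1 ?b) x" for x by (rule reg2_bd1)+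
    show "reg2 ?h (0, m)"
      using A B(1) by (intro reg_intros reg_compose[OF _ rb(1)]) (simp_all only: c)
    have h0: "?h (0, m) = (0, A ?a + B ?a * m)" by (simp add: c)
    show "reg2 ?k (?h (0, m))"
      unfolding h0 using rAk rBk B(2)
      by (intro reg_intros reg_compose[OF _ rb(2), of "\<lambda>x. A (k x)"] reg_compose[OF _ rb(2), of "\<lambda>x. B (k x)"])
         (simp_all only: c k(2) simp_thms)
    show "?k (?h (0, m)) = (0, m)" unfolding h0 using B(2) by (simp add: c k(2))
    show "?h (0, m) \<in> dom1 S' E \<chi> (a1, v0)" by (simp add: dom1_def)
    from f_Away have "\<forall>\<^sub>F x in zar (0, m). bd1 ?a x \<noteq> ?a \<longrightarrow> f (Away (\<psi> (bd1 ?a x))) =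
       Away (\<chi> (fst (bd1 ?a x), v0 + A (bd1 ?a x) * (fst (bd1 ?a x) - a1) + B (bd1 ?a x) * (snd (bd1 ?a x) - a2)))"
      by (intro eventually_zar_compose[OF reg2_bd1]) (simp add: c)
    thus "\<forall>\<^sub>F x in zar (0, m). f (par1 \<psi> ?a x) = par1 \<chi> ?b (?h x)"
    proof eventually_elim
      case (elim x)
      show ?case
      proof (cases "fst x = 0")
        case True
        hence "bd1 ?a x = ?a" by (simp add: bd1_eq_centre)
        thus ?thesis using True by (simp add: par1_def f_Fin)
      next
        case False
        hence "bd1 ?a x \<noteq> ?a" by (simp add: bd1_eq_centre)
        with elim have "f (Away (\<psi> (bd1 ?a x))) =
          Away (\<chi> (fst (bd1 ?a x), v0 + A (bd1 ?a x) * (fst (bd1 ?a x) - a1) + B (bd1 ?a x) * (snd (bd1 ?a x) - a2)))"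
          by blast
        moreover have "bd1 ?b (?h x) =
          (fst (bd1 ?a x), v0 + A (bd1 ?a x) * (fst (bd1 ?a x) - a1) + B (bd1 ?a x) * (snd (bd1 ?a x) - a2))"
          by (simp add: bd1_def algebra_simps)
        ultimately show ?thesis using False by (simp add: par1_def)
      qed
    qed
    have "\<forall>\<^sub>F y in zar (?h (0, m)). B (k (bd1 ?b y)) \<noteq> 0 \<and>
        v0 + A (k (bd1 ?b y)) * (fst (bd1 ?b y) - a1) + B (k (bd1 ?b y)) * (K (bd1 ?b y) - a2) = snd (bd1 ?b y)"
      unfolding h0 using nzB K_inv
      by (intro eventually_zar_compose[OF reg2_bd1, of "\<lambda>y. B (k y) \<noteq> 0 \<and>
         v0 + A (k y) * (fst y - a1) + B (k y) * (K y - a2) = snd y"]) (simp add: c k_def eventually_conj_iff)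
    thus "\<forall>\<^sub>F y in zar (?h (0, m)). ?h (?k y) = y"
    proof eventually_elim
      case (elim y)
      have "B (k (bd1 ?b y)) * (K (bd1 ?b y) - a2) = fst y * (snd y - A (k (bd1 ?b y)))"
        using elim by (simp add: bd1_def algebra_simps)
      hence "K (bd1 ?b y) = a2 + (snd y - A (k (bd1 ?b y))) / B (k (bd1 ?b y)) * fst y"
        using elim by (simp add: field_simps)
      hence "bd1 ?a (?k y) = k (bd1 ?b y)" 
        unfolding bd1_def[of ?a] k_def[of "bd1 ?b y"] by (simp add: bd1_def k_def)
      thus ?case using elim by (cases y) simp
    qed
  qed
  show ?th2
  proof (rule lisoI)
    let ?a = "(a1, a2)" and ?b = "(a1, v0)"
    \<comment> \<open>In the second charts z - a2 = s and y - a1 = m s, whence v - v0 = s (A m + B).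
      The factor A m + B is a unit at the origin, and the new reciprocal slope is m' = m / (A m +
      B). Solving for m turns this factor into B / (1 - A m').\<close>
    let ?g = "\<lambda>x. A (bd2 ?a x) * fst x + B (bd2 ?a x)"
    let ?h = "\<lambda>x. (fst x / ?g x, ?g x * snd x)"
    let ?A = "\<lambda>y. A (k (bd2 ?b y))" and ?B = "\<lambda>y. B (k (bd2 ?b y))"
    let ?k = "\<lambda>y. (fst y * ?B y / (1 - ?A y * fst y), snd y * (1 - ?A y * fst y) / ?B y)"
    have c: "bd2 ?a (0, 0) = ?a" "bd2 ?b (0, 0) = ?b" by (auto simp: bd2_def)
    have rb: "reg2 (bd2 ?a) x" "reg2 (bd2 ?b) x" for x by (rule reg2_bd2)+
    have rg: "reg ?g (0, 0)"
      using A B(1) by (intro reg_intros reg_compose[OF _ rb(1)]) (simp_all only: c)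
    have rA: "reg ?A (0, 0)" and rB: "reg ?B (0, 0)"
      using rAk rBk by (auto intro!: reg_compose[OF _ rb(2), of "\<lambda>x. A (k x)"] reg_compose[OF _ rb(2), of "\<lambda>x. B (k x)"]
          simp: c simp del: split_paired_All)
    have nz: "?g (0, 0) \<noteq> 0" "?B (0, 0) \<noteq> 0" using B(2) by (simp_all add: c k(2))
    show "reg2 ?h (0, 0)"
      by (intro reg2_Pair reg_divide reg_mult rg nz reg_fst reg_snd)
    have h0: "?h (0, 0) = (0, 0)" by simp
    show "reg2 ?k (?h (0, 0))"
      unfolding h0 by (intro reg_intros rA rB nz) simp
    show "?k (?h (0, 0)) = (0, 0)" by simp
    show "?h (0, 0) \<in> dom2 S' E \<chi> ?b" by (simp add: dom2_def)
    from f_Away have "\<forall>\<^sub>F x in zar (0, 0). bd2 ?a x \<noteq> ?a \<longrightarrow> f (Away (\<psi> (bd2 ?a x))) =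
       Away (\<chi> (fst (bd2 ?a x), v0 + A (bd2 ?a x) * (fst (bd2 ?a x) - a1) + B (bd2 ?a x) * (snd (bd2 ?a x) - a2)))"
      by (intro eventually_zar_compose[OF reg2_bd2]) (simp add: c)
    with reg_nonzero[OF rg nz(1)]
    show "\<forall>\<^sub>F x in zar (0, 0). f (par2 \<psi> ?a x) = par2 \<chi> ?b (?h x)"
    proof eventually_elim
      case (elim x)
      show ?case
      proof (cases "snd x = 0")
        case True
        hence eq: "bd2 ?a x = ?a" by (simp add: bd2_eq_centre)
        show ?thesis
        proof (cases "fst x = 0")
          case False
          have "A ?a * fst x + B ?a \<noteq> 0" using elim(1) by (simp only: eq not_False_eq_True)
          thus ?thesis using True False by (simp add: par2_def eq f_Fin add_divide_distrib)
        qed (use True in \<open>simp add: par2_def f_Infty\<close>)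
      next
        case False
        hence "bd2 ?a x \<noteq> ?a" by (simp add: bd2_eq_centre)
        with elim(2) have "f (Away (\<psi> (bd2 ?a x))) =
          Away (\<chi> (fst (bd2 ?a x), v0 + A (bd2 ?a x) * (fst (bd2 ?a x) - a1) + B (bd2 ?a x) * (snd (bd2 ?a x) - a2)))"
          by blast
        moreover have "bd2 ?b (?h x) =
          (fst (bd2 ?a x), v0 + A (bd2 ?a x) * (fst (bd2 ?a x) - a1) + B (bd2 ?a x) * (snd (bd2 ?a x) - a2))"
          using elim(1) by (simp add: bd2_def[of ?b]) (simp add: bd2_def algebra_simps)
        ultimately show ?thesis using False elim(1) by (simp add: par2_def)
      qed
    qed
    have "\<forall>\<^sub>F y in zar (?h (0, 0)). B (k (bd2 ?b y)) \<noteq> 0 \<and>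
        v0 + A (k (bd2 ?b y)) * (fst (bd2 ?b y) - a1) + B (k (bd2 ?b y)) * (K (bd2 ?b y) - a2) = snd (bd2 ?b y)"
      unfolding h0 using nzB K_inv
      by (intro eventually_zar_compose[OF reg2_bd2, of "\<lambda>y. B (k y) \<noteq> 0 \<and>
         v0 + A (k y) * (fst y - a1) + B (k y) * (K y - a2) = snd y"]) (simp add: c k_def eventually_conj_iff)
    moreover have "\<forall>\<^sub>F y in zar (?h (0, 0)). 1 - ?A y * fst y \<noteq> 0"
      unfolding h0 by (rule reg_nonzero) (intro reg_intros rA, simp)
    ultimately show "\<forall>\<^sub>F y in zar (?h (0, 0)). ?h (?k y) = y"
    proof eventually_elim
      case (elim y)
      have "?B y * (K (bd2 ?b y) - a2) = snd y * (1 - ?A y * fst y)"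
        using elim by (simp add: bd2_def algebra_simps)
      hence "K (bd2 ?b y) = a2 + snd y * (1 - ?A y * fst y) / ?B y"
        using elim by (simp add: field_simps)
      moreover have "fst (?k y) * snd (?k y) = fst y * snd y" using elim by simp
      ultimately have eq: "bd2 ?a (?k y) = k (bd2 ?b y)" 
        unfolding bd2_def[of ?a] k_def[of "bd2 ?b y"] by (simp add: bd2_def)
      have "?g (?k y) = ?B y / (1 - ?A y * fst y)"
        unfolding eq using elim by (simp add: field_simps)
      thus ?case using elim by (cases y) simp
    qed
  qed
qed

section \<open>Hirzebruch surfaces\<close>

text \<open>The two surfaces are the cases \<open>d = 0\<close> and \<open>d = 2\<close> of the Hirzebruch surface of
  degree \<open>d\<close>. The first flag of a chart says whether the base coordinate is inverted, the second
  one does so for the fibre coordinate.\<close>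

definition fl :: "bool \<Rightarrow> complex \<Rightarrow> p1" where
  "fl j w = (if j then p1_inv (Fin w) else Fin w)"

text \<open>The gluing of the fibre coordinate, with the reciprocal version where that coordinate is
  inverted. Each side uses the reciprocal of the other's base coordinate, so one formula serves both
  directions.\<close>

definition tw :: "nat \<Rightarrow> bool \<Rightarrow> complex \<Rightarrow> complex \<Rightarrow> complex" where
  "tw d j u w = (if j then w * u ^ d else w / u ^ d)"

definition hch :: "nat \<Rightarrow> bool \<Rightarrow> bool \<Rightarrow> complex \<times> complex \<Rightarrow> p1 \<times> p1" where
  "hch d i j = (\<lambda>(u, w). if \<not> i then (Fin u, fl j w) else if u = 0 then (Infty, fl j w)
                          else (Fin (1 / u), fl j (tw d j u w)))"

definition hirz :: "nat \<Rightarrow> (p1 \<times> p1) surface" where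
  "hirz d = {(UNIV, hch d i j) | i j. True}"

lemma F0_charts: "F0_0 = hch 0 False False" "F0_1 = hch 0 False True"
  "F0_2 = hch 0 True False" "F0_3 = hch 0 True True"
  by (auto simp: F0_0_def F0_1_def F0_2_def F0_3_def hch_def fl_def tw_def fun_eq_iff)

lemma F2_charts: "F2_0 = hch 2 False False" "F2_1 = hch 2 False True"
  "F2_2 = hch 2 True False" "F2_3 = hch 2 True True"
  by (auto simp: F2_0_def F2_1_def F2_2_def F2_3_def hch_def fl_def tw_def fun_eq_iff mult.commute)

lemma hirz_eq: "hirz d = {(UNIV, hch d False False), (UNIV, hch d False True),
    (UNIV, hch d True False), (UNIV, hch d True True)}"
  unfolding hirz_def by (auto, (metis (full_types))+)

lemma F0_eq: "F0 = hirz 0" and F2_eq: "F2 = hirz 2"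
  by (simp_all add: hirz_eq F0_def F2_def F0_charts F2_charts)

lemma hirzI: "(UNIV, hch d i j) \<in> hirz d"
  unfolding hirz_def by blast

lemma fl_inject [simp]: "fl j w = fl j w' \<longleftrightarrow> w = w'"
  by (simp add: fl_def del: p1_inv.simps)

lemma inj_hch: "inj (hch d i j)"
  by (rule injI) (auto simp: hch_def tw_def split: if_splits)

definition htrans :: "nat \<Rightarrow> bool \<Rightarrow> bool \<Rightarrow> bool \<Rightarrow> bool \<Rightarrow> complex \<times> complex \<Rightarrow> complex \<times> complex" where
  "htrans d i j k l x = (let w = (if i = k then snd x else tw d j (fst x) (snd x))
     in (if i = k then fst x else 1 / fst x, if j = l then w else 1 / w))"

lemma hch_htrans:
  assumes "i \<noteq> k \<longrightarrow> fst x \<noteq> 0" "j \<noteq> l \<longrightarrow> snd x \<noteq> 0"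
  shows "hch d i j x = hch d k l (htrans d i j k l x)"
  using assms
  by (cases x; cases i; cases j; cases k; cases l)
     (simp_all add: hch_def htrans_def tw_def fl_def power_one_over)

lemma reg_htrans:
  assumes "i \<noteq> k \<longrightarrow> fst a \<noteq> 0" "j \<noteq> l \<longrightarrow> snd a \<noteq> 0"
  shows "reg2 (htrans d i j k l) a"
proof -
  have "reg (\<lambda>x. if i = k then snd x else tw d j (fst x) (snd x)) a"
    using assms by (cases "i = k"; cases j) (auto simp: tw_def intro!: reg_intros)
  moreover have "(if i = k then snd a else tw d j (fst a) (snd a)) \<noteq> 0" if "j \<noteq> l"
    using assms that by (auto simp: tw_def)
  moreover have "reg (\<lambda>x. if i = k then fst x else 1 / fst x) a"
    using assms by (cases "i = k") (auto intro!: reg_intros)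
  ultimately show ?thesis
    unfolding htrans_def Let_def by (cases "j = l") (auto intro!: reg_intros)
qed

text \<open>If two charts differ in a flag, the zero line of that coordinate in one of them is
  exactly what the other misses.\<close>

lemma hch_overlap:
  assumes "hch d i j a = hch d k l b"
  shows "i \<noteq> k \<longrightarrow> fst a \<noteq> 0" "j \<noteq> l \<longrightarrow> snd a \<noteq> 0"
  using assms
  by (cases a; cases b; auto simp: hch_def fl_def tw_def split: if_splits)+

lemma alg_surface_hirz: "alg_surface (hirz d)"
proof (rule alg_surfaceI)
  show "finite (hirz d)" by (simp add: hirz_eq)
next
  fix D \<psi> E \<chi> a b
  assume *: "(D, \<psi>) \<in> hirz d" "(E, \<chi>) \<in> hirz d" "a \<in> D" "b \<in> E" "\<psi> a = \<chi> b"
  obtain i j k l where c: "D = UNIV" "\<psi> = hch d i j" "E = UNIV" "\<chi> = hch d k l"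
    using *(1,2) unfolding hirz_def by blast
  note ov = hch_overlap[OF *(5)[unfolded c]]
  have "\<forall>\<^sub>F x in zar a. i \<noteq> k \<longrightarrow> fst x \<noteq> 0"
    using ov(1) reg_nonzero[OF reg_fst, of a] by (cases "i = k") auto
  moreover have "\<forall>\<^sub>F x in zar a. j \<noteq> l \<longrightarrow> snd x \<noteq> 0"
    using ov(2) reg_nonzero[OF reg_snd, of a] by (cases "j = l") auto
  ultimately have "\<forall>\<^sub>F x in zar a. hch d i j x = hch d k l (htrans d i j k l x)"
    by eventually_elim (rule hch_htrans)
  thus "loc (\<lambda>p. p) (D, \<psi>) (E, \<chi>) a"
    unfolding c by (intro locI[OF reg_htrans[OF ov]]) simp
qed (auto simp: hirz_def inj_hch)

lemma pts_hirz: "pts (hirz d) = UNIV"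
proof -
  have "p \<in> pts (hirz d)" for p :: "p1 \<times> p1"
  proof -
    obtain u w where p: "p = (u, w)" by (cases p)
    define i where "i = (u = Infty)"
    define j where "j = (w = Infty)"
    have "hch d i j (if i then 0 else (THE x. u = Fin x), if j then 0 else (THE x. w = Fin x)) = p"
      unfolding p i_def j_def by (cases u; cases w) (auto simp: hch_def fl_def)
    thus ?thesis using ptsI[OF hirzI[of d i j]] by (metis UNIV_I)
  qed
  thus ?thesis by blast
qed

section \<open>Fractional linear maps of the fibres\<close>

locale fibre =
  fixes c :: complex
  assumes c: "c \<noteq> 0"
begin

text \<open>The fractional linear map of the matrix with rows \<open>(-r, n)\<close> and
  \<open>(c, 0)\<close>, of determinant \<open>- n * c\<close>; \<open>gm\<close> belongs to the
  inverse matrix up to a scalar. For \<open>n = 0\<close> every nonzero \<open>z\<close> is sent to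
  \<open>- r / c\<close>.\<close>

fun fm :: "complex \<Rightarrow> complex \<Rightarrow> p1 \<Rightarrow> p1" where
  "fm n r (Fin z) = (if z = 0 then Infty else Fin ((n - r * z) / (c * z)))"
| "fm n r Infty = Fin (- r / c)"

fun gm :: "complex \<Rightarrow> complex \<Rightarrow> p1 \<Rightarrow> p1" where
  "gm n r (Fin v) = (if c * v + r = 0 then Infty else Fin (n / (c * v + r)))"
| "gm n r Infty = Fin 0"

lemma gm_fm: "n \<noteq> 0 \<Longrightarrow> gm n r (fm n r w) = w"
  using c by (cases w) (auto simp: field_simps)

lemma fibre_inverse:
  assumes "n \<noteq> 0" "c * v + r \<noteq> 0"
  shows "(n - r * (n / (c * v + r))) / (c * (n / (c * v + r))) = v"
proof -
  define e where "e = c * v + r"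
  have "e \<noteq> 0" using assms by (simp add: e_def)
  hence "(n - r * (n / e)) / (c * (n / e)) = (e - r) / c"
    using assms(1) c by (simp add: field_simps)
  also have "\<dots> = v" using c by (simp add: e_def)
  finally show ?thesis by (simp add: e_def)
qed

lemma fm_gm:
  assumes n: "n \<noteq> 0"
  shows "fm n r (gm n r w) = w"
proof (cases w)
  case (Fin v)
  show ?thesis
  proof (cases "c * v + r = 0")
    case True
    hence "- r = c * v" by (simp add: add_eq_0_iff)
    thus ?thesis using c True Fin by simp
  next
    case False
    thus ?thesis using fibre_inverse[OF n False] n Fin by simp
  qed
qed simp

lemma fm_fl_False: "z \<noteq> 0 \<Longrightarrow> fm n r (fl False z) = fl False ((n - r * z) / (c * z))"
  by (simp add: fl_def)

lemma fm_fl_False': "n - r * z \<noteq> 0 \<Longrightarrow> fm n r (fl False z) = fl True (c * z / (n - r * z))"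
  using c by (simp add: fl_def)

lemma fm_fl_True: "fm n r (fl True z) = fl False ((n * z - r) / c)"
  using c by (simp add: fl_def field_simps)

lemma fm_Infty_iff: "fm n r w = Infty \<longleftrightarrow> w = Fin 0"
  by (cases w) auto

lemma gm_Infty_iff: "gm n r w = Infty \<longleftrightarrow> w = Fin (- r / c)"
  using c by (cases w) (auto simp: field_simps eq_neg_iff_add_eq_0 add.commute)

lemma gm_Fin_0_iff: "n \<noteq> 0 \<Longrightarrow> gm n r w = Fin 0 \<longleftrightarrow> w = Infty"
  by (cases w) auto

lemma fm_eq_centre_iff: "n \<noteq> 0 \<Longrightarrow> fm n r w = Fin (- r / c) \<longleftrightarrow> w = Infty"
  by (metis fm.simps(2) gm_fm)

text \<open>The shift \<open>s0\<close> allows for the coordinates of a blow-up, which are centred at a point of the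
  base.\<close>

context
  fixes n r :: "complex \<Rightarrow> complex" and s0 :: complex and a :: "complex \<times> complex"
  assumes n: "\<And>a. reg (\<lambda>x. n (fst x)) a" and r: "\<And>a. reg (\<lambda>x. r (fst x)) a" and nz: "n (fst a) \<noteq> 0"
begin

lemma reg_shift: "reg (\<lambda>x. n (fst x - s0)) b" "reg (\<lambda>x. r (fst x - s0)) b"
  by (rule reg_compose[of "\<lambda>x. n (fst x)" "\<lambda>x. (fst x - s0, 0)" b, simplified],
      rule n, intro reg_intros)
     (rule reg_compose[of "\<lambda>x. r (fst x)" "\<lambda>x. (fst x - s0, 0)" b, simplified],
      rule r, intro reg_intros)

lemma ev_n: "fst b = fst a + s0 \<Longrightarrow> \<forall>\<^sub>F y in zar b. n (fst y - s0) \<noteq> 0"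
  using nz by (intro reg_nonzero reg_shift) simp

text \<open>Three pairs of fibre coordinates cover all cases: \<open>z\<close> and \<open>v\<close>
  here, \<open>z\<close> and \<open>1 / v\<close> near \<open>z = 0\<close>, and
  \<open>1 / z\<close> and \<open>v\<close> near infinity.\<close>

lemma liso_fibre_nonzero:
  assumes f: "\<forall>\<^sub>F x in zar a. snd x \<noteq> 0 \<longrightarrow> f (\<psi> x) = \<chi> (fst x + s0, (n (fst x) - r (fst x) * snd x) / (c * snd x))"
    and z: "snd a \<noteq> 0" and E: "(fst a + s0, (n (fst a) - r (fst a) * snd a) / (c * snd a)) \<in> E"
  shows "liso f (D, \<psi>) (E, \<chi>) a"
proof (rule lisoI[of "\<lambda>x. (fst x + s0, (n (fst x) - r (fst x) * snd x) / (c * snd x))" _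
      "\<lambda>y. (fst y - s0, n (fst y - s0) / (c * snd y + r (fst y - s0)))"])
  let ?b = "(fst a + s0, (n (fst a) - r (fst a) * snd a) / (c * snd a))"
  show "reg2 (\<lambda>x. (fst x + s0, (n (fst x) - r (fst x) * snd x) / (c * snd x))) a"
    using z c by (intro reg_intros n r) auto
  have eq: "c * snd ?b + r (fst ?b - s0) = n (fst a) / snd a" using z c by (simp add: field_simps)
  hence nz': "c * snd ?b + r (fst ?b - s0) \<noteq> 0" using z nz by simp
  have rd: "reg (\<lambda>y. c * snd y + r (fst y - s0)) ?b" by (intro reg_intros reg_shift)
  show "reg2 (\<lambda>y. (fst y - s0, n (fst y - s0) / (c * snd y + r (fst y - s0)))) ?b"
    by (intro reg2_Pair reg_divide rd nz' reg_shift reg_diff reg_fst reg_const)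
  show "(fst ?b - s0, n (fst ?b - s0) / (c * snd ?b + r (fst ?b - s0))) = a"
    unfolding eq using z nz by (simp add: prod_eq_iff)
  show "\<forall>\<^sub>F x in zar a. f (\<psi> x) = \<chi> (fst x + s0, (n (fst x) - r (fst x) * snd x) / (c * snd x))"
    using f reg_nonzero[OF reg_snd z] by eventually_elim blast
  show "\<forall>\<^sub>F y in zar ?b.
      (fst (fst y - s0, n (fst y - s0) / (c * snd y + r (fst y - s0))) + s0,
       (n (fst (fst y - s0, n (fst y - s0) / (c * snd y + r (fst y - s0)))) -
        r (fst (fst y - s0, n (fst y - s0) / (c * snd y + r (fst y - s0)))) *
        snd (fst y - s0, n (fst y - s0) / (c * snd y + r (fst y - s0)))) /
       (c * snd (fst y - s0, n (fst y - s0) / (c * snd y + r (fst y - s0))))) = y"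
    using reg_nonzero[OF rd nz'] ev_n[of ?b, simplified]
    by eventually_elim (simp only: prod_eq_iff fst_conv snd_conv fibre_inverse not_False_eq_True, simp)
qed (rule E)

text \<open>The denominator \<open>n - r z\<close> reduces to \<open>n\<close> at
  \<open>z = 0\<close> and is therefore a unit there.\<close>

lemma liso_fibre_zero:
  assumes f: "\<forall>\<^sub>F x in zar a. n (fst x) - r (fst x) * snd x \<noteq> 0 \<longrightarrow>
       f (\<psi> x) = \<chi> (fst x + s0, c * snd x / (n (fst x) - r (fst x) * snd x))"
    and z: "snd a = 0" and E: "(fst a + s0, 0) \<in> E"
  shows "liso f (D, \<psi>) (E, \<chi>) a"
proof (rule lisoI[of "\<lambda>x. (fst x + s0, c * snd x / (n (fst x) - r (fst x) * snd x))" _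
      "\<lambda>y. (fst y - s0, n (fst y - s0) * snd y / (c + r (fst y - s0) * snd y))"])
  let ?b = "(fst a + s0, c * snd a / (n (fst a) - r (fst a) * snd a))"
  have rh: "reg (\<lambda>x. n (fst x) - r (fst x) * snd x) a" by (intro reg_intros n r)
  have nzh: "n (fst a) - r (fst a) * snd a \<noteq> 0" using z nz by simp
  show "reg2 (\<lambda>x. (fst x + s0, c * snd x / (n (fst x) - r (fst x) * snd x))) a"
    by (intro reg2_Pair reg_divide rh nzh reg_add reg_mult reg_fst reg_snd reg_const)
  have nz': "c + r (fst ?b - s0) * snd ?b \<noteq> 0" using z c by simp
  have rd: "reg (\<lambda>y. c + r (fst y - s0) * snd y) ?b" by (intro reg_intros reg_shift)
  show "reg2 (\<lambda>y. (fst y - s0, n (fst y - s0) * snd y / (c + r (fst y - s0) * snd y))) ?b"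
    by (intro reg2_Pair reg_divide rd nz' reg_shift reg_diff reg_fst reg_const reg_mult reg_snd)
  show "(fst ?b - s0, n (fst ?b - s0) * snd ?b / (c + r (fst ?b - s0) * snd ?b)) = a"
    using z by (simp add: prod_eq_iff)
  show "?b \<in> E" using E z by simp
  show "\<forall>\<^sub>F x in zar a. f (\<psi> x) = \<chi> (fst x + s0, c * snd x / (n (fst x) - r (fst x) * snd x))"
    using f reg_nonzero[OF rh nzh] by eventually_elim blast
  show "\<forall>\<^sub>F y in zar ?b.
      (fst (fst y - s0, n (fst y - s0) * snd y / (c + r (fst y - s0) * snd y)) + s0,
       c * snd (fst y - s0, n (fst y - s0) * snd y / (c + r (fst y - s0) * snd y)) /
       (n (fst (fst y - s0, n (fst y - s0) * snd y / (c + r (fst y - s0) * snd y))) -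
        r (fst (fst y - s0, n (fst y - s0) * snd y / (c + r (fst y - s0) * snd y))) *
        snd (fst y - s0, n (fst y - s0) * snd y / (c + r (fst y - s0) * snd y)))) = y"
    using reg_nonzero[OF rd nz'] ev_n[of ?b, simplified]
  proof eventually_elim
    case (elim y)
    have "n (fst y - s0) - r (fst y - s0) * (n (fst y - s0) * snd y / (c + r (fst y - s0) * snd y)) =
        n (fst y - s0) * c / (c + r (fst y - s0) * snd y)"
      using elim by (simp add: field_simps)
    thus ?case using elim c by (simp add: prod_eq_iff)
  qed
qed

text \<open>In the coordinate \<open>1 / z\<close> the map is affine on each fibre, and its linear
  coefficient \<open>n / c\<close> is a unit.\<close>

lemma liso_fibre_Infty:
  assumes f: "\<forall>\<^sub>F x in zar a. f (\<psi> x) = \<chi> (fst x + s0, (n (fst x) * snd x - r (fst x)) / c)"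
    and E: "(fst a + s0, (n (fst a) * snd a - r (fst a)) / c) \<in> E"
  shows "liso f (D, \<psi>) (E, \<chi>) a"
proof (rule lisoI[of "\<lambda>x. (fst x + s0, (n (fst x) * snd x - r (fst x)) / c)" _
      "\<lambda>y. (fst y - s0, (c * snd y + r (fst y - s0)) / n (fst y - s0))"])
  let ?b = "(fst a + s0, (n (fst a) * snd a - r (fst a)) / c)"
  show "reg2 (\<lambda>x. (fst x + s0, (n (fst x) * snd x - r (fst x)) / c)) a"
    using c by (intro reg_intros n r)
  show "reg2 (\<lambda>y. (fst y - s0, (c * snd y + r (fst y - s0)) / n (fst y - s0))) ?b"
    using nz by (intro reg_intros reg_shift) simp
  show "(fst ?b - s0, (c * snd ?b + r (fst ?b - s0)) / n (fst ?b - s0)) = a"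
    using c nz by (simp add: prod_eq_iff)
  show "\<forall>\<^sub>F y in zar ?b.
      (fst (fst y - s0, (c * snd y + r (fst y - s0)) / n (fst y - s0)) + s0,
       (n (fst (fst y - s0, (c * snd y + r (fst y - s0)) / n (fst y - s0))) *
        snd (fst y - s0, (c * snd y + r (fst y - s0)) / n (fst y - s0)) -
        r (fst (fst y - s0, (c * snd y + r (fst y - s0)) / n (fst y - s0)))) / c) = y"
    using ev_n[of ?b, simplified] by eventually_elim (use c in \<open>simp add: prod_eq_iff\<close>)
qed (rule f E)+

end

end

section \<open>The two surfaces of the theorem\<close>

locale oka = fibre c for c :: complex +
  fixes q t :: complex and \<Theta> :: "idx \<Rightarrow> complex"
  assumes c_eq: "c = q * (q - 1)" and q: "q \<noteq> 0" "q \<noteq> 1" and \<Theta>: "\<Theta> i \<noteq> 0"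
    and \<Theta>0: "(\<Theta> I0)\<^sup>2 \<noteq> 1" and \<Theta>1: "(\<Theta> I1)\<^sup>2 \<noteq> 1" and \<Theta>t: "(\<Theta> It)\<^sup>2 \<noteq> 1" and \<Theta>inf: "(\<Theta> Iinf)\<^sup>2 \<noteq> q"
    and t: "t \<noteq> 0" and t_Sq: "t \<notin> Sq q \<Theta>"
begin

text \<open>On both base charts (\<open>i\<close> tells whether the base coordinate is inverted) the map is
  \<open>z \<mapsto> (N - R z) / (c z)\<close> on the fibres, with quadratic polynomials \<open>N\<close>, \<open>R\<close>. Their divided
  differences \<open>N1\<close>, \<open>R1\<close> are the derivatives on the diagonal.\<close>

definition "\<sigma> = t * \<Theta> It + t * (1 / \<Theta> It)"
text \<open>Passing from \<open>y\<close> to \<open>1 / y\<close> reverses the coefficients of a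
  quadratic polynomial. The numbers \<open>t\<close> and \<open>1\<close>, exchanged by this
  reversal, occur squared in \<open>N\<close> and unsquared in \<open>R\<close>.\<close>

definition "e i = (if i then 1 else t)"
definition "e' i = (if i then t else 1)"
definition "N i y = (e i)\<^sup>2 - \<sigma> * y + (e' i)\<^sup>2 * y\<^sup>2"
definition "R i y = q * (e i - (1 + t) * y + e' i * y\<^sup>2)"
definition "N1 i y y' = - \<sigma> + (e' i)\<^sup>2 * (y + y')"
definition "R1 i y y' = q * (- (1 + t) + e' i * (y + y'))"

lemma N_diff: "N i y = N i y' + N1 i y y' * (y - y')"
  by (simp add: N_def N1_def algebra_simps power2_eq_square)

lemma R_diff: "R i y = R i y' + R1 i y y' * (y - y')"
  by (simp add: R_def R1_def algebra_simps power2_eq_square)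

lemma N_False: "N False y = (y - t * \<Theta> It) * (y - t * (1 / \<Theta> It))"
  using \<Theta>[of It] by (simp add: N_def e_def e'_def \<sigma>_def field_simps power2_eq_square)

lemma R_False: "R False y = q * (y - 1) * (y - t)"
  by (simp add: R_def e_def e'_def field_simps power2_eq_square)

lemma N_True: "y \<noteq> 0 \<Longrightarrow> N True y = y\<^sup>2 * N False (1 / y)"
  by (simp add: N_def e_def e'_def field_simps power2_eq_square)

lemma R_True: "y \<noteq> 0 \<Longrightarrow> R True y = y\<^sup>2 * R False (1 / y)"
  by (simp add: R_def e_def e'_def field_simps power2_eq_square)

lemma R_True_0: "R True 0 = q" and N_True_0 [simp]: "N True 0 = 1"
  by (simp_all add: R_def N_def e_def)

lemma N_zero_iff: "N False y = 0 \<longleftrightarrow> (\<exists>s. y = tTheta t \<Theta> s)"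
proof
  assume "N False y = 0"
  hence "y = t * \<Theta> It \<or> y = t * (1 / \<Theta> It)" by (simp add: N_False)
  thus "\<exists>s. y = tTheta t \<Theta> s" using tTheta.simps by metis
next
  assume "\<exists>s. y = tTheta t \<Theta> s"
  then obtain s where "y = tTheta t \<Theta> s" ..
  thus "N False y = 0" by (cases s) (simp_all add: N_False)
qed

lemma N_tTheta [simp]: "N False (tTheta t \<Theta> s) = 0"
  using N_zero_iff by blast

lemma N_False_0 [simp]: "N False 0 \<noteq> 0"
  using t by (simp add: N_def e_def)

lemma inv_neq: "x \<noteq> 0 \<Longrightarrow> x\<^sup>2 \<noteq> 1 \<Longrightarrow> 1 / x \<noteq> x" for x :: complex
  by (simp add: field_simps power2_eq_square)

lemma tTheta_neq: "t * \<Theta> It \<noteq> t * (1 / \<Theta> It)"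
  using inv_neq[OF \<Theta> \<Theta>t] t by (metis mult_left_cancel)

text \<open>The divided difference becomes the derivative at the root, and the two roots are
  distinct.\<close>

lemma N1_root: "N False y = 0 \<Longrightarrow> N1 False y y \<noteq> 0"
  using tTheta_neq by (auto simp: N_False N1_def e'_def \<sigma>_def)

text \<open>If \<Theta>_1 or its inverse were a root t \<Theta>_t or t / \<Theta>_t, then t would
  lie in the first family of \<open>Sq\<close>. Consequently the centres \<gamma>_1 are not on the
  contracted fibres.\<close>

lemma N_\<Theta>1: "N False (\<Theta> I1) \<noteq> 0" "N False (1 / \<Theta> I1) \<noteq> 0"
proof -
  have *: "t \<noteq> \<Theta> I1 powi e1 * \<Theta> It powi et" if "e1 \<in> {-1, 1}" "et \<in> {-1, 1}" for e1 et
  proof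
    assume "t = \<Theta> I1 powi e1 * \<Theta> It powi et"
    \<comment> \<open>The trivial factor exhibits the product as an element of \<open>Sq\<close>
      with exponent 0 of \<open>q\<close>.\<close>
    hence "t = \<Theta> I1 powi e1 * \<Theta> It powi et * q powi 0" by simp
    thus False using t_Sq that unfolding Sq_def by blast
  qed
  have "t \<noteq> \<Theta> I1 * \<Theta> It" "t \<noteq> \<Theta> I1 / \<Theta> It" "t \<noteq> \<Theta> It / \<Theta> I1" "t \<noteq> 1 / (\<Theta> I1 * \<Theta> It)"
    using *[of 1 1] *[of 1 "-1"] *[of "-1" 1] *[of "-1" "-1"] by (simp_all add: power_int_minus field_simps)
  thus "N False (\<Theta> I1) \<noteq> 0" "N False (1 / \<Theta> I1) \<noteq> 0"
    using \<Theta>[of I1] \<Theta>[of It] unfolding N_False mult_eq_0_iff by (auto simp: field_simps)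
qed

lemma reg_N [reg_intros]: "reg f a \<Longrightarrow> reg (\<lambda>x. N i (f x)) a"
  unfolding N_def by (intro reg_intros)
lemma reg_R [reg_intros]: "reg f a \<Longrightarrow> reg (\<lambda>x. R i (f x)) a"
  unfolding R_def by (intro reg_intros)
lemma reg_N1 [reg_intros]: "reg f a \<Longrightarrow> reg g a \<Longrightarrow> reg (\<lambda>x. N1 i (f x) (g x)) a"
  unfolding N1_def by (intro reg_intros)
lemma reg_R1 [reg_intros]: "reg f a \<Longrightarrow> reg g a \<Longrightarrow> reg (\<lambda>x. R1 i (f x) (g x)) a"
  unfolding R1_def by (intro reg_intros)

text \<open>The fibrewise map before blowing up, and in \<open>bi\<close> its inverse. They are
  mutually inverse off the fibres over the roots, which \<open>root\<close> singles out.\<close>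

fun bm :: "p1 \<times> p1 \<Rightarrow> p1 \<times> p1" where
  "bm (Fin y, w) = (Fin y, fm (N False y) (R False y) w)"
| "bm (Infty, w) = (Infty, fm (N True 0) (R True 0) w)"

fun bi :: "p1 \<times> p1 \<Rightarrow> p1 \<times> p1" where
  "bi (Fin y, w) = (Fin y, gm (N False y) (R False y) w)"
| "bi (Infty, w) = (Infty, gm (N True 0) (R True 0) w)"

fun root :: "p1 \<times> p1 \<Rightarrow> bool" where
  "root (Fin y, w) = (N False y = 0)"
| "root (Infty, w) = False"

lemma bi_bm: "\<not> root p \<Longrightarrow> bi (bm p) = p"
  by (cases p rule: root.cases) (simp_all add: gm_fm)

lemma bm_bi: "\<not> root p \<Longrightarrow> bm (bi p) = p"
  by (cases p rule: root.cases) (simp_all add: fm_gm)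

lemma root_bm [simp]: "root (bm p) = root p" and root_bi [simp]: "root (bi p) = root p"
  by (cases p rule: root.cases; simp)+

text \<open>\<open>N\<close> and \<open>R\<close> acquire the same factor \<open>y^2\<close> under
  the change of base chart. This is the twist of degree 2 of the target, so the map has the same
  formula over both base charts.\<close>

lemma NR_True: "y \<noteq> 0 \<Longrightarrow> N True y * w - R True y * z = y\<^sup>2 * (N False (1 / y) * w - R False (1 / y) * z)"
  by (simp add: N_True R_True right_diff_distrib)

lemma bm_hch_nonzero:
  assumes "z \<noteq> 0"
  shows "bm (hch 0 i False (y, z)) = hch 2 i False (y, (N i y - R i y * z) / (c * z))"
proof (cases "i \<and> y \<noteq> 0")
  case True
  thus ?thesis using assms NR_True[of y 1 z] by (simp add: hch_def fm_fl_False tw_def)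
qed (use assms in \<open>auto simp: hch_def fm_fl_False\<close>)

lemma bm_hch_denominator:
  assumes "N i y - R i y * z \<noteq> 0"
  shows "bm (hch 0 i False (y, z)) = hch 2 i True (y, c * z / (N i y - R i y * z))"
proof (cases "i \<and> y \<noteq> 0")
  case True
  hence *: "N True y - R True y * z = y\<^sup>2 * (N False (1 / y) - R False (1 / y) * z)"
    using NR_True[of y 1 z] by simp
  hence "N False (1 / y) - R False (1 / y) * z \<noteq> 0" using assms True by auto
  thus ?thesis using True * by (simp add: hch_def tw_def fm_fl_False')
qed (use assms in \<open>auto simp: hch_def fm_fl_False'\<close>)

lemma bm_hch_Infty: "bm (hch 0 i True (y, z)) = hch 2 i False (y, (N i y * z - R i y) / c)"
proof (cases "i \<and> y \<noteq> 0")
  case True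
  thus ?thesis using NR_True[of y z 1] by (simp add: hch_def fm_fl_True tw_def)
qed (auto simp: hch_def fm_fl_True)

lemma root_hch: "root (hch d i j (y, w)) \<longleftrightarrow> N i y = 0"
  by (cases "i \<and> y \<noteq> 0") (auto simp: hch_def N_True)

section \<open>The centres and their images\<close>

lemma centre_gamma:
  "centre_pt (gamma q t \<Theta> I0 Mns) = (Fin 0, Fin (t * \<Theta> I0 / q))"
  "centre_pt (gamma q t \<Theta> I0 Pls) = (Fin 0, Fin (t * (1 / \<Theta> I0) / q))"
  "centre_pt (gamma q t \<Theta> I1 Mns) = (Fin (1 / \<Theta> I1), Infty)"
  "centre_pt (gamma q t \<Theta> I1 Pls) = (Fin (\<Theta> I1), Infty)"
  "centre_pt (gamma q t \<Theta> It s) = (Fin (tTheta t \<Theta> s), Fin 0)"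
  "centre_pt (gamma q t \<Theta> Iinf Mns) = (Infty, Fin (1 / \<Theta> Iinf))"
  "centre_pt (gamma q t \<Theta> Iinf Pls) = (Infty, Fin (\<Theta> Iinf / q))"
  by (simp_all add: centre_pt_def F0_0_def F0_1_def F0_2_def, cases s, simp_all add: F0_0_def)

lemma R_c: "R False y / c = (y - 1) * (y - t) / (q - 1)"
  using q by (simp add: R_False c_eq mult.assoc)

text \<open>For \<open>It\<close> the fibre coordinate is written as \<open>- R / c\<close>, the
  constant value taken on the contracted fibre.\<close>

lemma centre_beta:
  "centre_pt (beta q t \<Theta> I0 Mns) = (Fin 0, Fin (t * (1 / \<Theta> I0 - 1) / (q - 1)))"
  "centre_pt (beta q t \<Theta> I0 Pls) = (Fin 0, Fin (t * (\<Theta> I0 - 1) / (q - 1)))"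
  "centre_pt (beta q t \<Theta> I1 Mns) = (Fin (1 / \<Theta> I1), Fin ((1 / \<Theta> I1 - 1) * (t - 1 / \<Theta> I1) / (q - 1)))"
  "centre_pt (beta q t \<Theta> I1 Pls) = (Fin (\<Theta> I1), Fin ((\<Theta> I1 - 1) * (t - \<Theta> I1) / (q - 1)))"
  "centre_pt (beta q t \<Theta> It s) = (Fin (tTheta t \<Theta> s), Fin (- R False (tTheta t \<Theta> s) / c))"
  "centre_pt (beta q t \<Theta> Iinf Mns) = (Infty, Fin ((1 / \<Theta> Iinf - 1) / (q - 1)))"
  "centre_pt (beta q t \<Theta> Iinf Pls) = (Infty, Fin ((\<Theta> Iinf - q) / (q * (q - 1))))"
  by (simp_all add: centre_pt_def F2_0_def F2_2_def R_c minus_divide_left[symmetric] del: minus_divide_left,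
      cases s, simp_all add: F2_0_def right_diff_distrib mult.commute)

declare gamma.simps [simp del] beta.simps [simp del] tTheta.simps [simp del]

lemma R_c': "- (R False y / c) = (y - 1) * (t - y) / (q - 1)"
  by (metis R_c minus_diff_eq minus_divide_left mult_minus_right)

text \<open>Direct substitution: N = t^2 and R = q t over y = 0; the value is \<open>- R / c\<close>
  on z = \<infinity>; and N = 1, R = q over y = \<infinity>.\<close>

lemma bm_centre:
  "bm (centre_pt (gamma q t \<Theta> I0 s)) = centre_pt (beta q t \<Theta> I0 s)"
  "bm (centre_pt (gamma q t \<Theta> I1 s)) = centre_pt (beta q t \<Theta> I1 s)"
  "bm (centre_pt (gamma q t \<Theta> Iinf s)) = centre_pt (beta q t \<Theta> Iinf (opp s))"
proof -
  have q1: "q - 1 \<noteq> 0" using q by simp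
  have N0: "N False 0 = t * t" and R0: "R False 0 = q * t"
    by (simp_all add: N_def R_def e_def power2_eq_square)
  show "bm (centre_pt (gamma q t \<Theta> I0 s)) = centre_pt (beta q t \<Theta> I0 s)"
    using q q1 t \<Theta>[of I0] by (cases s) (simp_all add: centre_gamma centre_beta N0 R0, simp_all add: c_eq field_simps)
  show "bm (centre_pt (gamma q t \<Theta> I1 s)) = centre_pt (beta q t \<Theta> I1 s)"
    by (cases s) (simp_all add: centre_gamma centre_beta R_c' del: minus_divide_left)
  show "bm (centre_pt (gamma q t \<Theta> Iinf s)) = centre_pt (beta q t \<Theta> Iinf (opp s))"
    using q q1 \<Theta>[of Iinf] by (cases s) (simp_all add: centre_gamma centre_beta R_True_0, simp_all add: c_eq field_simps)
qed

lemma root_gamma: "root (centre_pt (gamma q t \<Theta> i s)) \<longleftrightarrow> i = It"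
  using N_\<Theta>1 by (cases i; cases s) (simp_all add: centre_gamma)

lemma root_beta: "root (centre_pt (beta q t \<Theta> i s)) \<longleftrightarrow> i = It"
  using N_\<Theta>1 by (cases i; cases s) (simp_all add: centre_beta)

lemma tTheta_inject: "tTheta t \<Theta> s = tTheta t \<Theta> s' \<longleftrightarrow> s = s'"
  using tTheta_neq by (cases s; cases s') (auto simp: tTheta.simps)

text \<open>The four pairs lie on the lines y = 0, z = \<infinity>, z = 0 and y = \<infinity>, away
  from their intersections. Within a pair the two signs are separated by the condition on the square
  of \<Theta>_i.\<close>

lemma gamma_inj:
  assumes "centre_pt (gamma q t \<Theta> i s) = centre_pt (gamma q t \<Theta> i' s')"
  shows "i = i' \<and> s = s'"
proof (cases "i = It \<or> i' = It")
  case True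
  hence "i = It" "i' = It" using assms root_gamma by metis+
  thus ?thesis using assms by (simp add: centre_gamma tTheta_inject)
next
  case False
  have "\<Theta> I1 \<noteq> 0" "\<Theta> I0 \<noteq> 1 / \<Theta> I0" "\<Theta> I1 \<noteq> 1 / \<Theta> I1" using \<Theta> inv_neq[OF \<Theta> \<Theta>0] inv_neq[OF \<Theta> \<Theta>1] by auto
  moreover have "\<Theta> Iinf / q \<noteq> 1 / \<Theta> Iinf" using \<Theta>[of Iinf] q \<Theta>inf by (simp add: field_simps power2_eq_square)
  moreover have "t / (\<Theta> I0 * q) \<noteq> t * \<Theta> I0 / q"
    using \<Theta>[of I0] q \<Theta>0 t by (simp add: field_simps power2_eq_square)
  ultimately show ?thesis
    using assms False q t by (cases i; cases i'; cases s; cases s') (auto simp: centre_gamma)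
qed

lemma opp_opp [simp]: "opp (opp s) = s"
  by (cases s) auto

lemma bi_centre:
  "i \<noteq> It \<Longrightarrow> bi (centre_pt (beta q t \<Theta> i s)) = centre_pt (gamma q t \<Theta> i (if i = Iinf then opp s else s))"
proof (cases i)
  case Iinf
  thus ?thesis using bi_bm[of "centre_pt (gamma q t \<Theta> i (opp s))"] by (simp add: bm_centre root_gamma)
qed (metis bi_bm bm_centre root_gamma idx.distinct)+

text \<open>Off the root fibres the claim is transported to the source by \<open>bi\<close>; for
  \<open>It\<close> the base coordinates already differ.\<close>

lemma beta_inj:
  assumes "centre_pt (beta q t \<Theta> i s) = centre_pt (beta q t \<Theta> i' s')"
  shows "i = i' \<and> s = s'"
proof (cases "i = It \<or> i' = It")
  case True
  hence "i = It" "i' = It" using assms root_beta by metis+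
  thus ?thesis using assms by (simp add: centre_beta tTheta_inject)
next
  case False
  have "centre_pt (gamma q t \<Theta> i (if i = Iinf then opp s else s)) =
      centre_pt (gamma q t \<Theta> i' (if i' = Iinf then opp s' else s'))"
    using False assms bi_centre[of i s] bi_centre[of i' s'] by simp
  from gamma_inj[OF this] show ?thesis by (auto split: if_splits) (metis opp_opp)
qed

abbreviation "GK \<equiv> gammas q t \<Theta>"
abbreviation "BK \<equiv> betas q t \<Theta>"
abbreviation "GS \<equiv> centre_pt ` GK"
abbreviation "BS \<equiv> centre_pt ` BK"

lemma finite_idx: "finite (UNIV :: idx set)"
  by (rule finite_subset[of _ "{I0, I1, It, Iinf}"]) (auto intro: idx.exhaust)

lemma finite_pm: "finite (UNIV :: pm set)"
  by (rule finite_subset[of _ "{Pls, Mns}"]) (auto intro: pm.exhaust)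

sublocale G: blowup_data F0 GK GS
proof unfold_locales
  have "GK = (\<Union>i. range (gamma q t \<Theta> i))" unfolding gammas_def by blast
  thus "finite GK" using finite_idx finite_pm by simp
  show "alg_surface F0" by (simp add: F0_eq alg_surface_hirz)
  show "(D, \<psi>) \<in> F0 \<and> a \<in> D" if k: "((D, \<psi>), a) \<in> GK" for D \<psi> a
  proof -
    obtain i s where "((D, \<psi>), a) = gamma q t \<Theta> i s" using k unfolding gammas_def by blast
    thus ?thesis by (cases i; cases s) (simp_all add: F0_def gamma.simps)
  qed
  show "inj_on centre_pt GK"
  proof (rule inj_onI)
    fix k k' assume k: "k \<in> GK" "k' \<in> GK" "centre_pt k = centre_pt k'"
    obtain i s i' s' where "k = gamma q t \<Theta> i s" "k' = gamma q t \<Theta> i' s'"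
      using k(1,2) unfolding gammas_def by blast
    thus "k = k'" using k(3) gamma_inj by metis
  qed
qed simp_all

sublocale B: blowup_data F2 BK BS
proof unfold_locales
  have "BK = (\<Union>i. range (beta q t \<Theta> i))" unfolding betas_def by blast
  thus "finite BK" using finite_idx finite_pm by simp
  show "alg_surface F2" by (simp add: F2_eq alg_surface_hirz)
  show "(D, \<psi>) \<in> F2 \<and> a \<in> D" if k: "((D, \<psi>), a) \<in> BK" for D \<psi> a
  proof -
    obtain i s where "((D, \<psi>), a) = beta q t \<Theta> i s" using k unfolding betas_def by blast
    thus ?thesis by (cases i; cases s) (simp_all add: F2_def beta.simps)
  qed
  show "inj_on centre_pt BK"
  proof (rule inj_onI)
    fix k k' assume k: "k \<in> BK" "k' \<in> BK" "centre_pt k = centre_pt k'"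
    obtain i s i' s' where "k = beta q t \<Theta> i s" "k' = beta q t \<Theta> i' s'"
      using k(1,2) unfolding betas_def by blast
    thus "k = k'" using k(3) beta_inj by metis
  qed
qed simp_all

lemma gammaI: "gamma q t \<Theta> i s \<in> GK" and betaI: "beta q t \<Theta> i s \<in> BK"
  unfolding gammas_def betas_def by blast+

lemma GS_iff: "p \<in> GS \<longleftrightarrow> (\<exists>i s. p = centre_pt (gamma q t \<Theta> i s))"
  unfolding gammas_def by blast

lemma BS_iff: "p \<in> BS \<longleftrightarrow> (\<exists>i s. p = centre_pt (beta q t \<Theta> i s))"
  unfolding betas_def by blast

lemma GS_root_iff:
  assumes "N False y = 0"
  shows "(Fin y, w) \<in> GS \<longleftrightarrow> w = Fin 0"
proof
  assume "(Fin y, w) \<in> GS"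
  then obtain i s where "(Fin y, w) = centre_pt (gamma q t \<Theta> i s)" unfolding GS_iff by blast
  thus "w = Fin 0" using assms root_gamma[of i s] by (metis Pair_inject centre_gamma(5) root.simps(1))
next
  obtain s where "y = tTheta t \<Theta> s" using assms N_zero_iff by blast
  moreover assume "w = Fin 0"
  ultimately show "(Fin y, w) \<in> GS" unfolding GS_iff by (metis centre_gamma(5))
qed

lemma BS_root_iff:
  assumes "N False y = 0"
  shows "(Fin y, w) \<in> BS \<longleftrightarrow> w = Fin (- R False y / c)"
proof
  assume "(Fin y, w) \<in> BS"
  then obtain i s where *: "(Fin y, w) = centre_pt (beta q t \<Theta> i s)" unfolding BS_iff by blast
  hence "i = It" using assms root_beta[of i s] by (metis root.simps(1))
  thus "w = Fin (- R False y / c)" using * by (simp add: centre_beta)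
next
  obtain s where "y = tTheta t \<Theta> s" using assms N_zero_iff by blast
  moreover assume "w = Fin (- R False y / c)"
  ultimately show "(Fin y, w) \<in> BS" unfolding BS_iff by (metis centre_beta(5))
qed

lemma bm_BS_iff:
  assumes "\<not> root p"
  shows "bm p \<in> BS \<longleftrightarrow> p \<in> GS"
proof
  assume "bm p \<in> BS"
  then obtain i s where *: "bm p = centre_pt (beta q t \<Theta> i s)" unfolding BS_iff by blast
  hence "i \<noteq> It" using assms root_beta by (metis root_bm)
  hence "p = centre_pt (gamma q t \<Theta> i (if i = Iinf then opp s else s))"
    using bi_centre[of i s] * bi_bm[OF assms] by simp
  thus "p \<in> GS" unfolding GS_iff by blast
next
  assume "p \<in> GS"
  then obtain i s where *: "p = centre_pt (gamma q t \<Theta> i s)" unfolding GS_iff by blast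
  hence "i \<noteq> It" using assms root_gamma by metis
  thus "bm p \<in> BS" unfolding BS_iff * by (cases i) (metis bm_centre)+
qed

lemma bi_GS_iff: "\<not> root p \<Longrightarrow> bi p \<in> GS \<longleftrightarrow> p \<in> BS"
  using bm_BS_iff[of "bi p"] bm_bi[of p] by simp

section \<open>The isomorphism\<close>

text \<open>\<open>dA\<close> and \<open>dB\<close> are the partial derivatives of the target fibre
  coordinate along the base and the fibre, in the chart that carries a centre at the given point.
  Since the base coordinate is unchanged, a slope \<open>m\<close> goes to
  \<open>dA + dB * m\<close>. No centre lies at \<open>(Infty, Infty)\<close>; the values there are
  fillers.\<close>

fun dA :: "p1 \<times> p1 \<Rightarrow> complex" where
  "dA (Fin y, Fin z) = (N1 False y y - R1 False y y * z) / (c * z)"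
| "dA (Fin y, Infty) = - R1 False y y / c"
| "dA (Infty, Fin z) = (N1 True 0 0 - R1 True 0 0 * z) / (c * z)"
| "dA (Infty, Infty) = 0"

fun dB :: "p1 \<times> p1 \<Rightarrow> complex" where
  "dB (Fin y, Fin z) = - N False y / (c * z\<^sup>2)"
| "dB (Fin y, Infty) = N False y / c"
| "dB (Infty, Fin z) = - N True 0 / (c * z\<^sup>2)"
| "dB (Infty, Infty) = 1"

fun aff :: "complex \<Rightarrow> complex \<Rightarrow> p1 \<Rightarrow> p1" where
  "aff A B (Fin m) = Fin (A + B * m)"
| "aff A B Infty = Infty"

text \<open>On the fibres over the two roots of \<open>N\<close> the map \<open>z \<mapsto> (N - R z) / (c z)\<close> is constant; there
  the derivative along the base takes over, and it has the same shape.\<close>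

fun Phi :: "(p1 \<times> p1) blown \<Rightarrow> (p1 \<times> p1) blown" where
  "Phi (Away (Fin y, w)) = (if N False y = 0
     then Exc (Fin y, Fin (- R False y / c)) (fm (N1 False y y) (R1 False y y) w)
     else Away (bm (Fin y, w)))"
| "Phi (Away (Infty, w)) = Away (bm (Infty, w))"
| "Phi (Exc (Fin y, w) m) = (if N False y = 0
     then (if m = Infty then Exc (Fin y, Fin (- R False y / c)) Infty
           else Away (Fin y, fm (N1 False y y) (R False y) m))
     else Exc (bm (Fin y, w)) (aff (dA (Fin y, w)) (dB (Fin y, w)) m))"
| "Phi (Exc (Infty, w) m) = Exc (bm (Infty, w)) (aff (dA (Infty, w)) (dB (Infty, w)) m)"

text \<open>Each case undoes one of \<open>Phi\<close>: \<open>gm\<close> undoes \<open>fm\<close>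
  with the same coefficients, and m \<mapsto> (m - A) / B, again an \<open>aff\<close>, undoes the
  action on slopes.\<close>

fun Psi :: "(p1 \<times> p1) blown \<Rightarrow> (p1 \<times> p1) blown" where
  "Psi (Away (Fin y, w)) = (if N False y = 0
     then Exc (Fin y, Fin 0) (gm (N1 False y y) (R False y) w)
     else Away (bi (Fin y, w)))"
| "Psi (Away (Infty, w)) = Away (bi (Infty, w))"
| "Psi (Exc (Fin y, w) m) = (if N False y = 0
     then (if m = Infty then Exc (Fin y, Fin 0) Infty
           else Away (Fin y, gm (N1 False y y) (R1 False y y) m))
     else let p = bi (Fin y, w) in Exc p (aff (- dA p / dB p) (1 / dB p) m))"
| "Psi (Exc (Infty, w) m) =
     (let p = bi (Infty, w) in Exc p (aff (- dA p / dB p) (1 / dB p) m))"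

lemma Phi_Away: "\<not> root p \<Longrightarrow> Phi (Away p) = Away (bm p)"
  by (cases p rule: root.cases) simp_all

lemma Phi_Exc: "\<not> root p \<Longrightarrow> Phi (Exc p m) = Exc (bm p) (aff (dA p) (dB p) m)"
  by (cases p rule: root.cases) simp_all

lemma Psi_Away: "\<not> root p \<Longrightarrow> Psi (Away p) = Away (bi p)"
  by (cases p rule: root.cases) simp_all

lemma Psi_Exc: "\<not> root p \<Longrightarrow> Psi (Exc p m) =
    Exc (bi p) (aff (- dA (bi p) / dB (bi p)) (1 / dB (bi p)) m)"
  by (cases p rule: root.cases) (simp_all add: Let_def)

lemma aff_inverse: "B \<noteq> 0 \<Longrightarrow> aff (- A / B) (1 / B) (aff A B m) = m"
  "B \<noteq> 0 \<Longrightarrow> aff A B (aff (- A / B) (1 / B) m) = m"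
  by (cases m; simp add: field_simps)+

lemma dB_nonzero:
  assumes "p \<in> GS" "\<not> root p"
  shows "dB p \<noteq> 0"
proof -
  obtain i s where *: "p = centre_pt (gamma q t \<Theta> i s)" using assms(1) unfolding GS_iff by blast
  thus ?thesis using root_gamma[of i s] assms(2) \<Theta> c q t N_\<Theta>1
    by (cases i; cases s) (auto simp: centre_gamma)
qed

section \<open>Bijectivity on points\<close>

lemma Away_pts [simp]: "Away p \<in> pts (blowup F0 GK) \<longleftrightarrow> p \<notin> GS" "Away p \<in> pts (blowup F2 BK) \<longleftrightarrow> p \<notin> BS"
  unfolding G.pts_Away_iff B.pts_Away_iff by (simp_all add: F0_eq F2_eq pts_hirz)

lemma Exc_pts [simp]: "Exc p m \<in> pts (blowup F0 GK) \<longleftrightarrow> p \<in> GS" "Exc p m \<in> pts (blowup F2 BK) \<longleftrightarrow> p \<in> BS"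
  by (simp_all add: G.pts_Exc_iff B.pts_Exc_iff)

lemma rootE:
  assumes "root p"
  obtains y w where "p = (Fin y, w)" "N False y = 0"
  using assms by (cases p rule: root.cases) auto

text \<open>On a root fibre the removed centre z = 0 is exactly the argument at which
  \<open>fm\<close> is infinite, so the other points fill the finite slopes and the vertical
  direction is left for the vertical direction. Likewise, finite slopes at \<gamma>_t miss exactly
  the value \<open>- R / c\<close>, which is \<beta>_t.\<close>

lemma Psi_Phi:
  assumes "p \<in> pts (blowup F0 GK)"
  shows "Phi p \<in> pts (blowup F2 BK) \<and> Psi (Phi p) = p"
proof (cases p)
  case (Away x)
  show ?thesis
  proof (cases "root x")
    case True
    then obtain y w where x: "x = (Fin y, w)" and y: "N False y = 0" by (rule rootE)
    have w: "w \<noteq> Fin 0" using assms Away x GS_root_iff[OF y] by simp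
    thus ?thesis using y N1_root[OF y] 
      by (simp add: Away x BS_root_iff fm_Infty_iff gm_fm)
  next
    case False
    thus ?thesis using assms by (simp add: Away Phi_Away Psi_Away bm_BS_iff bi_bm)
  qed
next
  case (Exc x m)
  show ?thesis
  proof (cases "root x")
    case True
    then obtain y w where x: "x = (Fin y, w)" and y: "N False y = 0" by (rule rootE)
    have w: "w = Fin 0" using assms Exc x GS_root_iff[OF y] by simp
    thus ?thesis using y N1_root[OF y] 
      by (simp add: Exc x BS_root_iff fm_eq_centre_iff[unfolded minus_divide_left[symmetric]] gm_fm)
  next
    case False
    moreover have "x \<in> GS" using assms Exc by simp
    ultimately show ?thesis
      using dB_nonzero by (simp add: Exc Phi_Exc Psi_Exc bm_BS_iff bi_bm aff_inverse[unfolded minus_divide_left[symmetric]])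
  qed
qed

lemma Phi_Psi:
  assumes "p \<in> pts (blowup F2 BK)"
  shows "Psi p \<in> pts (blowup F0 GK) \<and> Phi (Psi p) = p"
proof (cases p)
  case (Away x)
  show ?thesis
  proof (cases "root x")
    case True
    then obtain y w where x: "x = (Fin y, w)" and y: "N False y = 0" by (rule rootE)
    have w: "w \<noteq> Fin (- R False y / c)" using assms Away x BS_root_iff[OF y] by simp
    thus ?thesis using y N1_root[OF y] 
      by (simp add: Away x GS_root_iff gm_Infty_iff fm_gm)
  next
    case False
    thus ?thesis using assms by (simp add: Away Phi_Away Psi_Away bi_GS_iff bm_bi)
  qed
next
  case (Exc x m)
  show ?thesis
  proof (cases "root x")
    case True
    then obtain y w where x: "x = (Fin y, w)" and y: "N False y = 0" by (rule rootE)
    have w: "w = Fin (- R False y / c)" using assms Exc x BS_root_iff[OF y] by simp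
    thus ?thesis using y N1_root[OF y] 
      by (simp add: Exc x GS_root_iff gm_Fin_0_iff fm_gm)
  next
    case False
    moreover have "x \<in> BS" using assms Exc by simp
    ultimately show ?thesis
      using dB_nonzero[of "bi x"] by (simp add: Exc Phi_Exc Psi_Exc bi_GS_iff bm_bi aff_inverse[unfolded minus_divide_left[symmetric]])
  qed
qed

lemma bij_Phi: "bij_betw Phi (pts (blowup F0 GK)) (pts (blowup F2 BK))"
  by (rule bij_betw_byWitness[of _ Psi]) (use Psi_Phi Phi_Psi in auto)


section \<open>Local isomorphisms off the centres and the root fibres\<close>

lemma eventually_N: "N i (fst a) \<noteq> 0 \<Longrightarrow> \<forall>\<^sub>F x in zar a. N i (fst x) \<noteq> 0"
  by (intro reg_nonzero reg_intros)

lemma eventually_N1: "N1 i (fst a) y \<noteq> 0 \<Longrightarrow> \<forall>\<^sub>F x in zar a. N1 i (fst x) y \<noteq> 0"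
  by (intro reg_nonzero reg_intros)

lemma liso_away_nonzero:
  assumes "N i (fst a) \<noteq> 0" "snd a \<noteq> 0" "hch 0 i False a \<notin> GS"
  shows "liso Phi ({a \<in> UNIV. hch 0 i False a \<notin> GS}, Away \<circ> hch 0 i False)
      ({b \<in> UNIV. hch 2 i False b \<notin> BS}, Away \<circ> hch 2 i False) a"
proof (rule liso_fibre_nonzero[where n = "N i" and r = "R i" and ?s0.0 = 0])
  show "\<forall>\<^sub>F x in zar a. snd x \<noteq> 0 \<longrightarrow> Phi ((Away \<circ> hch 0 i False) x) =
      (Away \<circ> hch 2 i False) (fst x + 0, (N i (fst x) - R i (fst x) * snd x) / (c * snd x))"
    using eventually_N[OF assms(1)]
    by eventually_elim (auto simp: Phi_Away root_hch bm_hch_nonzero)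
  have "hch 2 i False (fst a, (N i (fst a) - R i (fst a) * snd a) / (c * snd a)) = bm (hch 0 i False a)"
    using assms(2) bm_hch_nonzero[of "snd a" i "fst a"] by simp
  thus "(fst a + 0, (N i (fst a) - R i (fst a) * snd a) / (c * snd a)) \<in> {b \<in> UNIV. hch 2 i False b \<notin> BS}"
    using assms(1,3) root_hch[of 0 i False "fst a" "snd a"] bm_BS_iff[of "hch 0 i False a"] by simp
qed (use assms in \<open>auto intro: reg_intros\<close>)

lemma liso_away_zero:
  assumes "N i (fst a) \<noteq> 0" "snd a = 0" "hch 0 i False a \<notin> GS"
  shows "liso Phi ({a \<in> UNIV. hch 0 i False a \<notin> GS}, Away \<circ> hch 0 i False)
      ({b \<in> UNIV. hch 2 i True b \<notin> BS}, Away \<circ> hch 2 i True) a"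
proof (rule liso_fibre_zero[where n = "N i" and r = "R i" and ?s0.0 = 0])
  show "\<forall>\<^sub>F x in zar a. N i (fst x) - R i (fst x) * snd x \<noteq> 0 \<longrightarrow> Phi ((Away \<circ> hch 0 i False) x) =
      (Away \<circ> hch 2 i True) (fst x + 0, c * snd x / (N i (fst x) - R i (fst x) * snd x))"
    using eventually_N[OF assms(1)]
    by eventually_elim (auto simp: Phi_Away root_hch bm_hch_denominator)
  have "hch 2 i True (fst a, 0) = bm (hch 0 i False a)"
    using assms(1,2) bm_hch_denominator[of i "fst a" 0] by (metis prod.collapse diff_zero div_0 mult_zero_right)
  thus "(fst a + 0, 0) \<in> {b \<in> UNIV. hch 2 i True b \<notin> BS}"
    using assms(1,3) root_hch[of 0 i False "fst a" "snd a"] bm_BS_iff[of "hch 0 i False a"] by simp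
qed (use assms in \<open>auto intro: reg_intros\<close>)

lemma liso_away_Infty:
  assumes "N i (fst a) \<noteq> 0" "hch 0 i True a \<notin> GS"
  shows "liso Phi ({a \<in> UNIV. hch 0 i True a \<notin> GS}, Away \<circ> hch 0 i True)
      ({b \<in> UNIV. hch 2 i False b \<notin> BS}, Away \<circ> hch 2 i False) a"
proof (rule liso_fibre_Infty[where n = "N i" and r = "R i" and ?s0.0 = 0])
  show "\<forall>\<^sub>F x in zar a. Phi ((Away \<circ> hch 0 i True) x) =
      (Away \<circ> hch 2 i False) (fst x + 0, (N i (fst x) * snd x - R i (fst x)) / c)"
    using eventually_N[OF assms(1)]
    by eventually_elim (auto simp: Phi_Away root_hch bm_hch_Infty)
  have "hch 2 i False (fst a, (N i (fst a) * snd a - R i (fst a)) / c) = bm (hch 0 i True a)"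
    using bm_hch_Infty[of i "fst a" "snd a"] by simp
  thus "(fst a + 0, (N i (fst a) * snd a - R i (fst a)) / c) \<in> {b \<in> UNIV. hch 2 i False b \<notin> BS}"
    using assms(1,2) root_hch[of 0 i True "fst a" "snd a"] bm_BS_iff[of "hch 0 i True a"] by simp
qed (use assms in \<open>auto intro: reg_intros\<close>)

section \<open>Local isomorphisms on exceptional lines off the root fibres\<close>

lemma liso_exc_finite:
  assumes N: "N i a1 \<noteq> 0" and a2: "a2 \<noteq> 0" and i: "i \<longrightarrow> a1 = 0"
    and b: "bm (hch 0 i False (a1, a2)) = hch 2 i False (a1, v0)"
  shows "liso Phi (dom1 S D (hch 0 i False) (a1, a2), par1 (hch 0 i False) (a1, a2))
      (dom1 S' E (hch 2 i False) (a1, v0), par1 (hch 2 i False) (a1, v0)) (0, m)" (is ?th1)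
    and "liso Phi (dom2 S D (hch 0 i False) (a1, a2), par2 (hch 0 i False) (a1, a2))
      (dom2 S' E (hch 2 i False) (a1, v0), par2 (hch 2 i False) (a1, v0)) (0, 0)" (is ?th2)
proof -
  \<comment> \<open>The increment of (N - R z)/(c z) is split by divided differences: the change in
    y is taken at the current z, and the change in z over the fixed base point
    \<open>a1\<close>.\<close>
  define A where "A x = N1 i (fst x) a1 / (c * snd x) - R1 i (fst x) a1 / c" for x
  define B where "B x = - N i a1 / (c * snd x * a2)" for x :: "complex \<times> complex"
  \<comment> \<open>The coordinate form of \<open>gm\<close>.\<close>
  define K where "K y = N i (fst y) / (c * snd y + R i (fst y))" for y
  have v0: "v0 = (N i a1 - R i a1 * a2) / (c * a2)"
    using b bm_hch_nonzero[OF a2, of i a1] injD[OF inj_hch[of 2 i False]] by fastforce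
  have den: "c * v0 + R i a1 = N i a1 / a2" using c a2 by (simp add: v0 field_simps)
  have H: "v0 + A (y, z) * (y - a1) + B (y, z) * (z - a2) = (N i y - R i y * z) / (c * z)"
    if "z \<noteq> 0" for y z
    using c a2 that unfolding N_diff[of i y a1] R_diff[of i y a1] A_def B_def v0
    by (simp add: divide_simps) (simp add: algebra_simps)
  have rA: "reg A (a1, a2)" unfolding A_def using c a2 by (intro reg_intros) auto
  have rB: "reg B (a1, a2)" unfolding B_def using c a2 by (intro reg_intros) auto
  have nzB: "B (a1, a2) \<noteq> 0" unfolding B_def using c a2 N by simp
  have nzd: "c * snd (a1, v0) + R i (fst (a1, v0)) \<noteq> 0" using den N a2 by simp
  have rd: "reg (\<lambda>y. c * snd y + R i (fst y)) (a1, v0)" by (intro reg_intros)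
  have rK: "reg K (a1, v0)" unfolding K_def by (intro reg_divide rd nzd reg_N reg_fst)
  have K0: "K (a1, v0) = a2" unfolding K_def fst_conv snd_conv den using N a2 by simp
  have ev: "\<forall>\<^sub>F y in zar (a1, v0). v0 + A (fst y, K y) * (fst y - a1) + B (fst y, K y) * (K y - a2) = snd y"
    using eventually_N[of i "(a1, v0)", unfolded fst_conv, OF N] reg_nonzero[OF rd nzd]
  proof eventually_elim
    case (elim y)
    hence "K y \<noteq> 0" by (simp add: K_def)
    thus ?case using H fibre_inverse[OF elim] by (simp add: K_def)
  qed
  have fA: "\<forall>\<^sub>F x in zar (a1, a2). x \<noteq> (a1, a2) \<longrightarrow> Phi (Away (hch 0 i False x)) =
      Away (hch 2 i False (fst x, v0 + A x * (fst x - a1) + B x * (snd x - a2)))"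
    using eventually_N[of i "(a1, a2)", unfolded fst_conv, OF N]
      reg_nonzero[OF reg_snd, of "(a1, a2)", unfolded snd_conv, OF a2]
  proof eventually_elim
    case (elim x)
    thus ?case using H[of "snd x" "fst x"] root_hch[of 0 i False "fst x" "snd x"]
        bm_hch_nonzero[of "snd x" i "fst x"] by (simp add: Phi_Away)
  qed
  have nr: "\<not> root (hch 0 i False (a1, a2))" using N by (simp add: root_hch)
  \<comment> \<open>\<open>i \<longrightarrow> a1 = 0\<close> enters here, since \<open>dA\<close>
    and \<open>dB\<close> refer to the inverted base coordinate only over infinity.\<close>
  have d: "dA (hch 0 i False (a1, a2)) = A (a1, a2)" "dB (hch 0 i False (a1, a2)) = B (a1, a2)"
    using i c a2 by (auto simp: hch_def fl_def A_def B_def field_simps power2_eq_square)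
  have fF: "Phi (Exc (hch 0 i False (a1, a2)) (Fin m)) =
      Exc (hch 2 i False (a1, v0)) (Fin (A (a1, a2) + B (a1, a2) * m))" for m
    by (simp add: Phi_Exc[OF nr] b d)
  have fI: "Phi (Exc (hch 0 i False (a1, a2)) Infty) = Exc (hch 2 i False (a1, v0)) Infty"
    by (simp add: Phi_Exc[OF nr] b)
  show ?th1 by (rule liso_blowup1[OF rA rB nzB rK K0 ev fA fF fI])
  show ?th2 by (rule liso_blowup2[OF rA rB nzB rK K0 ev fA fF fI])
qed

lemma liso_exc_infinite:
  assumes N: "N False a1 \<noteq> 0"
    and b: "bm (hch 0 False True (a1, 0)) = hch 2 False False (a1, v0)"
  shows "liso Phi (dom1 S D (hch 0 False True) (a1, 0), par1 (hch 0 False True) (a1, 0))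
      (dom1 S' E (hch 2 False False) (a1, v0), par1 (hch 2 False False) (a1, v0)) (0, m)" (is ?th1)
    and "liso Phi (dom2 S D (hch 0 False True) (a1, 0), par2 (hch 0 False True) (a1, 0))
      (dom2 S' E (hch 2 False False) (a1, v0), par2 (hch 2 False False) (a1, v0)) (0, 0)" (is ?th2)
proof -
  \<comment> \<open>With w = 1/z the map is (N w - R)/c. The term N w/c vanishes at w = 0 and goes
    wholly into \<open>B\<close>, which leaves only the increment of \<open>R\<close> for
    \<open>A\<close>.\<close>
  define A where "A x = - R1 False (fst x) a1 / c" for x :: "complex \<times> complex"
  define B where "B x = N False (fst x) / c" for x :: "complex \<times> complex"
  define K where "K y = (c * snd y + R False (fst y)) / N False (fst y)" for y
  have v0: "v0 = - R False a1 / c"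
    using b bm_hch_Infty[of False a1 0] injD[OF inj_hch[of 2 False False]] by fastforce
  have H: "v0 + A (y, z) * (y - a1) + B (y, z) * (z - 0) = (N False y * z - R False y) / c" for y z
    using c unfolding R_diff[of False y a1] A_def B_def v0
    by (simp add: divide_simps)
  have rA: "reg A (a1, 0)" unfolding A_def using c by (intro reg_intros) auto
  have rB: "reg B (a1, 0)" unfolding B_def using c by (intro reg_intros) auto
  have nzB: "B (a1, 0) \<noteq> 0" unfolding B_def using c N by simp
  have rK: "reg K (a1, v0)" unfolding K_def using N by (intro reg_intros) simp
  have K0: "K (a1, v0) = 0" unfolding K_def using c by (simp add: v0)
  have ev: "\<forall>\<^sub>F y in zar (a1, v0). v0 + A (fst y, K y) * (fst y - a1) + B (fst y, K y) * (K y - 0) = snd y"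
    using eventually_N[of False "(a1, v0)", unfolded fst_conv, OF N]
  proof eventually_elim
    case (elim y)
    thus ?case using H[of "fst y" "K y"] c by (simp add: K_def)
  qed
  have fA: "\<forall>\<^sub>F x in zar (a1, 0). x \<noteq> (a1, 0) \<longrightarrow> Phi (Away (hch 0 False True x)) =
      Away (hch 2 False False (fst x, v0 + A x * (fst x - a1) + B x * (snd x - 0)))"
    using eventually_N[of False "(a1, 0)", unfolded fst_conv, OF N]
  proof eventually_elim
    case (elim x)
    thus ?case using H[of "fst x" "snd x"] root_hch[of 0 False True "fst x" "snd x"]
        bm_hch_Infty[of False "fst x" "snd x"] by (simp add: Phi_Away)
  qed
  have nr: "\<not> root (hch 0 False True (a1, 0))" using N by (simp add: root_hch)
  have d: "dA (hch 0 False True (a1, 0)) = A (a1, 0)" "dB (hch 0 False True (a1, 0)) = B (a1, 0)"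
    by (auto simp: hch_def fl_def A_def B_def)
  have fF: "Phi (Exc (hch 0 False True (a1, 0)) (Fin m)) =
      Exc (hch 2 False False (a1, v0)) (Fin (A (a1, 0) + B (a1, 0) * m))" for m
    by (simp add: Phi_Exc[OF nr] b d)
  have fI: "Phi (Exc (hch 0 False True (a1, 0)) Infty) = Exc (hch 2 False False (a1, v0)) Infty"
    by (simp add: Phi_Exc[OF nr] b)
  show ?th1 by (rule liso_blowup1[OF rA rB nzB rK K0 ev fA fF fI])
  show ?th2 by (rule liso_blowup2[OF rA rB nzB rK K0 ev fA fF fI])
qed

section \<open>Local isomorphisms over the roots\<close>

lemma root_factor: "N False y0 = 0 \<Longrightarrow> N False y = N1 False y y0 * (y - y0)"
  using N_diff[of False y y0] by simp

text \<open>The second coordinate of the first chart over \<beta>_t is the slope (v - v0)/(y - y0),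
  which equals (N1 w - R1)/c with w = 1/z. The first coordinate is y - y0, hence the shift by
  \<open>- y0\<close>.\<close>

lemma liso_root_away:
  assumes y0: "N False y0 = 0"
  shows "liso Phi ({a \<in> UNIV. hch 0 False True a \<notin> GS}, Away \<circ> hch 0 False True)
      (dom1 BS UNIV (hch 2 False False) (y0, - R False y0 / c),
       par1 (hch 2 False False) (y0, - R False y0 / c)) (y0, z)"
proof (rule liso_fibre_Infty[where n = "\<lambda>y. N1 False y y0" and r = "\<lambda>y. R1 False y y0" and ?s0.0 = "- y0"])
  have nz: "N1 False (fst (y0, z)) y0 \<noteq> 0" using N1_root[OF y0] by simp
  thus "N1 False (fst (y0, z)) y0 \<noteq> 0" .
  show "\<forall>\<^sub>F x in zar (y0, z). Phi ((Away \<circ> hch 0 False True) x) =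
      par1 (hch 2 False False) (y0, - R False y0 / c)
        (fst x + - y0, (N1 False (fst x) y0 * snd x - R1 False (fst x) y0) / c)"
    using eventually_N1[OF nz]
  proof eventually_elim
    case (elim x)
    obtain y w where x: "x = (y, w)" by (cases x)
    show ?case
    proof (cases "y = y0")
      case True
      thus ?thesis using y0 fm_fl_True[of "N1 False y y" "R1 False y y" w]
        by (simp add: x hch_def par1_def fl_def)
    next
      case False
      hence "N False y \<noteq> 0" using elim root_factor[OF y0, of y] by (simp add: x)
      hence "Phi (Away (hch 0 False True x)) = Away (hch 2 False False (y, (N False y * w - R False y) / c))"
        by (simp add: x Phi_Away root_hch bm_hch_Infty)
      moreover have "(N False y * w - R False y) / c =
          - R False y0 / c + (N1 False y y0 * w - R1 False y y0) / c * (y - y0)"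
        using c unfolding root_factor[OF y0, of y] R_diff[of False y y0] by (simp add: field_simps)
      ultimately show ?thesis using False by (simp add: x par1_def bd1_def)
    qed
  qed
qed (auto intro: reg_intros simp: dom1_def)

lemma hch_root_notin_BS:
  assumes "N False y0 = 0" "w \<noteq> Fin (- R False y0 / c)"
  shows "(Fin y0, w) \<notin> BS"
  using assms BS_root_iff by blast

text \<open>With z = m s and N = N1 s the factor s cancels, so a single formula describes the map on
  the exceptional line and near it.\<close>

lemma Phi_par1_root:
  assumes y0: "N False y0 = 0" and "N1 False (y0 + s) y0 \<noteq> 0"
  shows "Phi (par1 (hch 0 False False) (y0, 0) (s, m)) =
    Away (Fin (y0 + s), fm (N1 False (y0 + s) y0) (R False (y0 + s)) (Fin m))"
proof (cases "s = 0")
  case True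
  thus ?thesis using y0 by (simp add: par1_def hch_def fl_def)
next
  case False
  have eq: "N False (y0 + s) = N1 False (y0 + s) y0 * s" using root_factor[OF y0, of "y0 + s"] by simp
  hence "N False (y0 + s) \<noteq> 0" using False assms(2) by simp
  thus ?thesis using False eq c by (simp add: par1_def hch_def fl_def bd1_def field_simps)
qed

text \<open>The shift \<open>y0\<close> leads from the coordinate s back to y = y0 + s. The image is
  not the centre \<beta>_t, because \<open>fm\<close> takes the value \<open>- R / c\<close> only at
  infinity.\<close>

lemma liso_root_exc1:
  assumes y0: "N False y0 = 0" and m: "m \<noteq> 0"
  shows "liso Phi (dom1 GS UNIV (hch 0 False False) (y0, 0), par1 (hch 0 False False) (y0, 0))
      ({a \<in> UNIV. hch 2 False False a \<notin> BS}, Away \<circ> hch 2 False False) (0, m)"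
proof (rule liso_fibre_nonzero[where n = "\<lambda>s. N1 False (y0 + s) y0" and r = "\<lambda>s. R False (y0 + s)" and ?s0.0 = y0])
  have nz: "N1 False (y0 + fst (0, m)) y0 \<noteq> 0" using N1_root[OF y0] by simp
  thus "N1 False (y0 + fst (0, m)) y0 \<noteq> 0" .
  have "\<forall>\<^sub>F x in zar (0, m). N1 False (y0 + fst x) y0 \<noteq> 0"
    using nz by (intro reg_nonzero reg_intros)
  thus "\<forall>\<^sub>F x in zar (0, m). snd x \<noteq> 0 \<longrightarrow> Phi (par1 (hch 0 False False) (y0, 0) x) =
      (Away \<circ> hch 2 False False) (fst x + y0,
         (N1 False (y0 + fst x) y0 - R False (y0 + fst x) * snd x) / (c * snd x))"
  proof eventually_elim
    case (elim x)
    thus ?case using Phi_par1_root[OF y0, of "fst x" "snd x"] by (simp add: hch_def fl_def add.commute)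
  qed
  have "fm (N1 False y0 y0) (R False y0) (Fin m) \<noteq> Fin (- R False y0 / c)"
    using fm_eq_centre_iff[OF N1_root[OF y0]] by blast
  from hch_root_notin_BS[OF y0 this]
  show "(fst (0, m) + y0, (N1 False (y0 + fst (0, m)) y0 - R False (y0 + fst (0, m)) * snd (0, m)) /
      (c * snd (0, m))) \<in> {a \<in> UNIV. hch 2 False False a \<notin> BS}"
    using m by (simp add: hch_def fl_def)
qed (use m in \<open>auto intro!: reg_intros\<close>)

text \<open>Slope 0 goes to v = \<infinity>, hence the target chart with fibre coordinate
  1/v.\<close>

lemma liso_root_exc2:
  assumes y0: "N False y0 = 0"
  shows "liso Phi (dom1 GS UNIV (hch 0 False False) (y0, 0), par1 (hch 0 False False) (y0, 0))
      ({a \<in> UNIV. hch 2 False True a \<notin> BS}, Away \<circ> hch 2 False True) (0, 0)"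
proof (rule liso_fibre_zero[where n = "\<lambda>s. N1 False (y0 + s) y0" and r = "\<lambda>s. R False (y0 + s)" and ?s0.0 = y0])
  have nz: "N1 False (y0 + fst (0, 0)) y0 \<noteq> 0" using N1_root[OF y0] by simp
  thus "N1 False (y0 + fst (0, 0)) y0 \<noteq> 0" .
  have "\<forall>\<^sub>F x in zar (0, 0). N1 False (y0 + fst x) y0 \<noteq> 0"
    using nz by (intro reg_nonzero reg_intros)
  thus "\<forall>\<^sub>F x in zar (0, 0). N1 False (y0 + fst x) y0 - R False (y0 + fst x) * snd x \<noteq> 0 \<longrightarrow>
      Phi (par1 (hch 0 False False) (y0, 0) x) =
      (Away \<circ> hch 2 False True) (fst x + y0,
         c * snd x / (N1 False (y0 + fst x) y0 - R False (y0 + fst x) * snd x))"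
  proof eventually_elim
    case (elim x)
    show ?case
    proof
      assume *: "N1 False (y0 + fst x) y0 - R False (y0 + fst x) * snd x \<noteq> 0"
      show "Phi (par1 (hch 0 False False) (y0, 0) x) =
        (Away \<circ> hch 2 False True) (fst x + y0,
           c * snd x / (N1 False (y0 + fst x) y0 - R False (y0 + fst x) * snd x))"
        using Phi_par1_root[OF y0 elim, of "snd x"] fm_fl_False'[OF *]
        by (simp only: prod.collapse fl_def if_False) (simp add: hch_def fl_def add.commute)
    qed
  qed
  have "fl True 0 \<noteq> Fin (- R False y0 / c)" by (simp add: fl_def)
  from hch_root_notin_BS[OF y0 this]
  show "(fst (0, 0) + y0, 0) \<in> {a \<in> UNIV. hch 2 False True a \<notin> BS}" by (simp add: hch_def)
qed (auto intro!: reg_intros)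

text \<open>Where the exceptional line meets the strict transform of the fibre over a root, the map is \<open>(m, s) \<mapsto> (s / g, m g)\<close> in the second charts, with a unit \<open>g\<close>.\<close>

lemma liso_root_corner:
  assumes y0: "N False y0 = 0"
  shows "liso Phi (dom2 GS UNIV (hch 0 False False) (y0, 0), par2 (hch 0 False False) (y0, 0))
      (dom2 BS UNIV (hch 2 False False) (y0, - R False y0 / c),
       par2 (hch 2 False False) (y0, - R False y0 / c)) (0, 0)"
proof (rule lisoI)
  let ?y = "\<lambda>x. y0 + fst x * snd x"
  let ?n = "\<lambda>x. N1 False (?y x) y0" and ?r = "\<lambda>x. R1 False (?y x) y0"
  \<comment> \<open>Substituting y = y0 + m s and z = s gives v + R(y0)/c = m g. As y - y0 = m s,
    the reciprocal slope is s/g.\<close>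
  let ?g = "\<lambda>x. (?n x - snd x * ?r x) / c"
  let ?h = "\<lambda>x. (snd x / ?g x, fst x * ?g x)"
  \<comment> \<open>The product of the two coordinates is preserved, so \<open>?n\<close> and
    \<open>?r\<close> may be evaluated at the image (m', s'). Putting s = m' g into c g = n - s r
    gives g = n/(c + m' r).\<close>
  let ?k = "\<lambda>x. (snd x * (c + fst x * ?r x) / ?n x, fst x * ?n x / (c + fst x * ?r x))"
  have rn: "reg ?n (0, 0)" and rr: "reg ?r (0, 0)" by (intro reg_intros)+
  have rg: "reg ?g (0, 0)" by (intro reg_intros c rn rr)
  have nzn: "?n (0, 0) \<noteq> 0" using N1_root[OF y0] by simp
  hence nzg: "?g (0, 0) \<noteq> 0" using c by simp
  have rd: "reg (\<lambda>x. c + fst x * ?r x) (0, 0)" by (intro reg_intros rr)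
  have nzd: "c + fst (0, 0) * ?r (0, 0) \<noteq> 0" using c by simp
  show "reg2 ?h (0, 0)" by (intro reg2_Pair reg_mult reg_divide rg nzg reg_fst reg_snd)
  have h0: "?h (0, 0) = (0, 0)" by simp
  show "reg2 ?k (?h (0, 0))" unfolding h0
    by (intro reg2_Pair reg_mult reg_divide rd rn nzd nzn reg_fst reg_snd)
  show "?k (?h (0, 0)) = (0, 0)" by simp
  show "?h (0, 0) \<in> dom2 BS UNIV (hch 2 False False) (y0, - R False y0 / c)" by (simp add: dom2_def)
  show "\<forall>\<^sub>F x in zar (0, 0). Phi (par2 (hch 0 False False) (y0, 0) x) =
      par2 (hch 2 False False) (y0, - R False y0 / c) (?h x)"
    using reg_nonzero[OF rg nzg] reg_nonzero[OF rn nzn]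
  proof eventually_elim
    case (elim x)
    obtain m s where x: "x = (m, s)" by (cases x)
    define g where "g = ?g x"
    have g: "g \<noteq> 0" using elim(1) unfolding g_def .
    have hx: "?h x = (s / g, m * g)" unfolding g_def x by simp
    \<comment> \<open>The corner, the rest of the exceptional line, the rest of the strict transform
      of the fibre, and points off both.\<close>
    consider "s = 0" "m = 0" | "s = 0" "m \<noteq> 0" | "s \<noteq> 0" "m = 0" | "s \<noteq> 0" "m \<noteq> 0" by blast
    hence "Phi (par2 (hch 0 False False) (y0, 0) x) =
      par2 (hch 2 False False) (y0, - R False y0 / c) (s / g, m * g)"
    proof cases
      case 1
      thus ?thesis using y0 by (simp add: x par2_def hch_def fl_def)
    next
      case 2
      have "c * g = N1 False y0 y0" using 2 c by (simp add: g_def x)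
      hence "fm (N1 False y0 y0) (R False y0) (Fin (1 / m)) = Fin (- R False y0 / c + m * g)"
        using 2 c by (simp add: field_simps)
      thus ?thesis using 2 g y0 by (simp add: x par2_def hch_def fl_def bd2_def)
    next
      case 3
      have "N1 False y0 y0 - R1 False y0 y0 * s = c * g" using 3 c by (simp add: g_def x)
      hence "fm (N1 False y0 y0) (R1 False y0 y0) (Fin s) = p1_inv (Fin (s / g))"
        using 3 c g by simp
      thus ?thesis using 3 y0 by (simp add: x par2_def hch_def fl_def bd2_def del: p1_inv.simps fm.simps)
    next
      case 4
      define y where "y = y0 + m * s"
      have n: "N False y = N1 False y y0 * (m * s)" and r: "R False y = R False y0 + R1 False y y0 * (m * s)"
        using root_factor[OF y0, of y] R_diff[of False y y0] by (simp_all add: y_def)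
      have cg: "c * g = N1 False y y0 - s * R1 False y y0" using c by (simp add: g_def x y_def)
      have "N False y \<noteq> 0" using n 4 elim(2) by (simp add: x y_def)
      moreover have "(N False y - R False y * s) / (c * s) = - R False y0 / c + m * g"
      proof -
        have "N False y - R False y * s = s * (m * (c * g) - R False y0)"
          unfolding n r cg by (simp add: algebra_simps)
        thus ?thesis using c 4 by (simp add: diff_divide_distrib)
      qed
      ultimately show ?thesis using 4 g by (simp add: x par2_def hch_def fl_def bd2_def y_def)
    qed
    thus ?case unfolding hx .
  qed
  show "\<forall>\<^sub>F x in zar (?h (0, 0)). ?h (?k x) = x"
    unfolding h0 using reg_nonzero[OF rd nzd] reg_nonzero[OF rn nzn]
  proof eventually_elim
    case (elim x)
    define n where "n = ?n x"
    define d where "d = c + fst x * ?r x"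
    have nd: "n \<noteq> 0" "d \<noteq> 0" using elim unfolding n_def d_def by blast+
    have k: "?k x = (snd x * d / n, fst x * n / d)" by (simp only: n_def d_def)
    have y: "?y (?k x) = ?y x" unfolding k using nd by simp
    have fr: "fst x * ?r x = d - c" by (simp add: d_def)
    have "?g (?k x) = (n - fst x * n / d * ?r x) / c" unfolding y by (simp only: k snd_conv n_def)
    also have "\<dots> = (n - n * (fst x * ?r x) / d) / c" by (simp add: ac_simps)
    also have "\<dots> = n / d" unfolding fr using nd c by (simp add: field_simps)
    finally have g: "?g (?k x) = n / d" .
    show ?case unfolding g using nd by (simp add: k)
  qed
qed


text \<open>The centres \<gamma>_0 and \<gamma>_\<infinity> have a finite nonzero fibre coordinate
  and fall under the first case; the centres \<gamma>_1 on z = \<infinity> fall under the second. In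
  both cases the image is a centre with the same base coordinate, as the lifting to blow-ups
  requires.\<close>

lemma gamma_chart:
  assumes p: "p \<in> GS" "\<not> root p"
  obtains i a1 a2 v0 where "((UNIV, hch 0 i False), (a1, a2)) \<in> GK" "p = hch 0 i False (a1, a2)"
      "((UNIV, hch 2 i False), (a1, v0)) \<in> BK" "bm p = hch 2 i False (a1, v0)"
      "a2 \<noteq> 0" "N i a1 \<noteq> 0" "i \<longrightarrow> a1 = 0"
  | a1 v0 where "((UNIV, hch 0 False True), (a1, 0)) \<in> GK" "p = hch 0 False True (a1, 0)"
      "((UNIV, hch 2 False False), (a1, v0)) \<in> BK" "bm p = hch 2 False False (a1, v0)"
      "N False a1 \<noteq> 0"
proof -
  obtain i s where p': "p = centre_pt (gamma q t \<Theta> i s)" using p(1) unfolding GS_iff by blast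
  have i: "i \<noteq> It" using p(2) root_gamma p' by blast
  define i' where "i' = (i = Iinf)"
  define j' where "j' = (i = I1)"
  obtain a1 a2 where g: "gamma q t \<Theta> i s = ((UNIV, hch 0 i' j'), (a1, a2))"
    "(if j' then a2 = 0 else a2 \<noteq> 0)" "i' \<longrightarrow> a1 = 0"
    using i \<Theta> q t by (cases i; cases s) (auto simp: gamma.simps F0_charts i'_def j'_def)
  let ?s = "if i = Iinf then opp s else s"
  obtain b1 v0 where b: "beta q t \<Theta> i ?s = ((UNIV, hch 2 i' False), (b1, v0))"
    using i by (cases i; cases s) (auto simp: beta.simps F2_charts i'_def)
  have pe: "p = hch 0 i' j' (a1, a2)" using p' g by (simp add: centre_pt_def)
  have be: "bm p = hch 2 i' False (b1, v0)"
    using p' b bm_centre[of s] i by (cases i) (auto simp: centre_pt_def)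
  have "b1 = a1"
    using pe be bm_hch_nonzero[of a2 i' a1] bm_hch_Infty[of i' a1 a2] g(2) injD[OF inj_hch, of 2 i' False]
    by (cases j') fastforce+
  moreover have "N i' a1 \<noteq> 0" using p(2) pe root_hch by blast
  ultimately show thesis
    using that g b pe be gammaI[of i s] betaI[of i ?s] by (cases j') (auto simp: i'_def j'_def)
qed

lemma gammaI_root:
  assumes "N False y = 0"
  shows "((UNIV, hch 0 False False), (y, 0)) \<in> GK"
proof -
  obtain s where "y = tTheta t \<Theta> s" using assms N_zero_iff by blast
  thus ?thesis using gammaI[of It s] by (cases s) (simp_all add: gamma.simps tTheta.simps F0_charts)
qed

lemma betaI_root:
  assumes "N False y = 0"
  shows "((UNIV, hch 2 False False), (y, - R False y / c)) \<in> BK"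
proof -
  obtain s where s: "y = tTheta t \<Theta> s" using assms N_zero_iff by blast
  obtain v where "beta q t \<Theta> It s = ((UNIV, hch 2 False False), (y, v))"
    using s by (cases s) (auto simp: beta.simps tTheta.simps F2_charts)
  moreover from this have "v = - R False y / c"
    using centre_beta(5)[of s] s by (simp add: centre_pt_def hch_def fl_def)
  ultimately show ?thesis using betaI[of It s] by simp
qed

lemma liso_Phi:
  assumes p: "p \<in> pts (blowup F0 GK)"
  shows "\<exists>D \<psi> E \<chi> a. (D, \<psi>) \<in> blowup F0 GK \<and> a \<in> D \<and> \<psi> a = p \<and> (E, \<chi>) \<in> blowup F2 BK \<and>
    liso Phi (D, \<psi>) (E, \<chi>) a" (is ?th)
proof -
  have I: ?th if "(D, \<psi>) \<in> blowup F0 GK" "(E, \<chi>) \<in> blowup F2 BK" "liso Phi (D, \<psi>) (E, \<chi>) a"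
    "a \<in> D" "\<psi> a = p" for D \<psi> E \<chi> a using that by blast
  have cG: "(UNIV, hch 0 i j) \<in> F0" and cB: "(UNIV, hch 2 i j) \<in> F2" for i j
    by (simp_all add: F0_eq F2_eq hirzI)
  show ?th
  proof (cases p)
    case (Away x)
    have x: "x \<notin> GS" using p Away by simp
    show ?th
    proof (cases "root x")
      case True
      then obtain y w where y: "x = (Fin y, w)" "N False y = 0" by (rule rootE)
      \<comment> \<open>On a root fibre z = 0 is a centre; so 1/z is a coordinate at every other
        point.\<close>
      have "w \<noteq> Fin 0" using x GS_root_iff[OF y(2), of w] y(1) by auto
      then obtain z where "w = fl True z"
        by (metis fl_def p1.exhaust p1_inv.simps(1) p1_inv_inv)
      hence h: "hch 0 False True (y, z) = x" by (simp add: y hch_def)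
      show ?th
        by (rule I[OF G.away_chart[OF cG] B.chart1[OF betaI_root[OF y(2)]] liso_root_away[OF y(2), of z]])
           (use h x Away in simp_all)
    next
      case False
      obtain i j y z where h: "x = hch 0 i j (y, z)"
      proof -
        have "x \<in> pts (hirz 0)" by (simp add: pts_hirz)
        then obtain D \<psi> a where "(D, \<psi>) \<in> hirz 0" "x = \<psi> a" by (rule ptsE)
        thus ?thesis using that unfolding hirz_def by (cases a) blast
      qed
      have N: "N i (fst (y, z)) \<noteq> 0" using False by (simp add: h root_hch)
      consider "j" | "\<not> j" "z = 0" | "\<not> j" "z \<noteq> 0" by blast
      thus ?th
      proof cases
        case 1
        show ?th
          by (rule I[OF G.away_chart[OF cG] B.away_chart[OF cB] liso_away_Infty[OF N]])
             (use h x Away 1 in simp_all)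
      next
        case 2
        show ?th
          by (rule I[OF G.away_chart[OF cG] B.away_chart[OF cB] liso_away_zero[OF N]])
             (use h x Away 2 in simp_all)
      next
        case 3
        show ?th
          by (rule I[OF G.away_chart[OF cG] B.away_chart[OF cB] liso_away_nonzero[OF N]])
             (use h x Away 3 in simp_all)
      qed
    qed
  next
    case (Exc x m)
    have x: "x \<in> GS" using p Exc by simp
    show ?th
    proof (cases "root x")
      case True
      then obtain y w where y: "x = (Fin y, w)" "N False y = 0" by (rule rootE)
      have w: "w = Fin 0" using x GS_root_iff[OF y(2), of w] y(1) by simp
      hence h: "hch 0 False False (y, 0) = x" by (simp add: y hch_def fl_def)
      note gc1 = G.chart1[OF gammaI_root[OF y(2)]] and gc2 = G.chart2[OF gammaI_root[OF y(2)]]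
      \<comment> \<open>The vertical direction stays on an exceptional line, slope 0 goes to v =
        \<infinity>, and every other slope goes to a finite v.\<close>
      consider "m = Infty" | "m = Fin 0" | m' where "m = Fin m'" "m' \<noteq> 0" by (cases m) auto
      thus ?th
      proof cases
        case 1
        show ?th
          by (rule I[OF gc2 B.chart2[OF betaI_root[OF y(2)]] liso_root_corner[OF y(2)]])
             (use h Exc 1 in \<open>simp_all add: par2_def dom2_def\<close>)
      next
        case 2
        show ?th
          by (rule I[OF gc1 B.away_chart[OF cB] liso_root_exc2[OF y(2)]])
             (use h Exc 2 in \<open>simp_all add: par1_def dom1_def\<close>)
      next
        case 3
        show ?th
          by (rule I[OF gc1 B.away_chart[OF cB] liso_root_exc1[OF y(2) 3(2)]])
             (use h Exc 3 in \<open>simp_all add: par1_def dom1_def\<close>)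
      qed
    next
      case False
      from x False show ?th
      proof (cases rule: gamma_chart)
        case (1 i a1 a2 v0)
        note b = 1(4)[unfolded 1(2)]
        show ?th
        proof (cases m)
          case (Fin m')
          show ?th
            by (rule I[OF G.chart1[OF 1(1)] B.chart1[OF 1(3)] liso_exc_finite(1)[OF 1(6,5,7) b, of _ _ _ _ m']])
               (use 1(2) Exc Fin in \<open>simp_all add: par1_def dom1_def\<close>)
        next
          case Infty
          show ?th
            by (rule I[OF G.chart2[OF 1(1)] B.chart2[OF 1(3)] liso_exc_finite(2)[OF 1(6,5,7) b]])
               (use 1(2) Exc Infty in \<open>simp_all add: par2_def dom2_def\<close>)
        qed
      next
        case (2 a1 v0)
        note b = 2(4)[unfolded 2(2)]
        show ?th
        proof (cases m)
          case (Fin m')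
          show ?th
            by (rule I[OF G.chart1[OF 2(1)] B.chart1[OF 2(3)] liso_exc_infinite(1)[OF 2(5) b, of _ _ _ _ m']])
               (use 2(2) Exc Fin in \<open>simp_all add: par1_def dom1_def\<close>)
        next
          case Infty
          show ?th
            by (rule I[OF G.chart2[OF 2(1)] B.chart2[OF 2(3)] liso_exc_infinite(2)[OF 2(5) b]])
               (use 2(2) Exc Infty in \<open>simp_all add: par2_def dom2_def\<close>)
        qed
      qed
    qed
  qed
qed

lemma biregular_Phi: "biregular (blowup F0 GK) (blowup F2 BK) Phi"
  by (rule biregularI[OF G.alg_surface_blowup B.alg_surface_blowup bij_Phi liso_Phi])

section \<open>The birational map\<close>

lemma phi_coord_eq: "phi_coord q t \<Theta> (y, z) = (y, (N False y - R False y * z) / (c * z))"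
  by (simp add: phi_coord_def N_False R_False c_eq)

text \<open>On a root fibre the formula has the constant value \<open>- R / c\<close>, which is a
  centre; elsewhere it sends no other point to a centre. So the condition on the image removes
  exactly the root fibres.\<close>

lemma phi_points_eq:
  "phi_points q t \<Theta> = {Away (Fin y, Fin z) | y z. z \<noteq> 0 \<and> N False y \<noteq> 0 \<and> (Fin y, Fin z) \<notin> GS}"
proof -
  have "F2_0 (phi_coord q t \<Theta> (y, z)) \<notin> BS \<longleftrightarrow> N False y \<noteq> 0" if "z \<noteq> 0" "(Fin y, Fin z) \<notin> GS" for y z
  proof -
    have "F2_0 (phi_coord q t \<Theta> (y, z)) = bm (Fin y, Fin z)"
      using that by (simp add: F2_0_def phi_coord_eq)
    thus ?thesis using bm_BS_iff[of "(Fin y, Fin z)"] BS_root_iff[of y] that c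
      by (cases "N False y = 0") simp_all
  qed
  thus ?thesis unfolding phi_points_def F0_0_def by auto
qed

lemma Phi_phi:
  assumes "p \<in> phi_points q t \<Theta>"
  shows "phi q t \<Theta> p = Phi p"
proof -
  obtain y z where "p = Away (Fin y, Fin z)" "z \<noteq> 0" "N False y \<noteq> 0"
    using assms unfolding phi_points_eq by blast
  thus ?thesis by (simp add: F2_0_def phi_coord_eq)
qed

lemma zariski_open_phi_points: "zariski_open (blowup F0 GK) (phi_points q t \<Theta>)"
proof (rule zariski_open_localI[OF G.alg_surface_blowup])
  fix p assume "p \<in> phi_points q t \<Theta>"
  then obtain y z where p: "p = Away (Fin y, Fin z)" "z \<noteq> 0" "N False y \<noteq> 0" "(Fin y, Fin z) \<notin> GS"
    unfolding phi_points_eq by blast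
  have F: "(UNIV, hch 0 False False) \<in> F0" by (simp add: F0_eq hirzI)
  have "\<forall>\<^sub>F x in zar (y, z). snd x \<noteq> 0" "\<forall>\<^sub>F x in zar (y, z). N False (fst x) \<noteq> 0"
    using p by (intro reg_nonzero reg_intros; simp)+
  moreover have "\<forall>\<^sub>F x in zar (y, z). x \<in> {a \<in> UNIV. hch 0 False False a \<notin> GS}"
    using p by (intro alg_surface_open[OF G.alg_surface_blowup G.away_chart[OF F]]) (simp add: hch_def fl_def)
  ultimately have "\<forall>\<^sub>F x in zar (y, z). (Away \<circ> hch 0 False False) x \<in> phi_points q t \<Theta>"
    by eventually_elim (auto simp: phi_points_eq hch_def fl_def)
  thus "\<exists>D \<psi> a. (D, \<psi>) \<in> blowup F0 GK \<and> a \<in> D \<and> \<psi> a = p \<and> (\<forall>\<^sub>F x in zar a. \<psi> x \<in> phi_points q t \<Theta>)"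
    using G.away_chart[OF F] p(1,4)
    by (intro exI[of _ "{a \<in> UNIV. hch 0 False False a \<notin> GS}"] exI[of _ "Away \<circ> hch 0 False False"]
        exI[of _ "(y, z)"]) (simp add: hch_def fl_def)
qed

lemma dense_phi_points: "dense_open (blowup F0 GK) (phi_points q t \<Theta>)"
proof (rule dense_openI[OF G.alg_surface_blowup zariski_open_phi_points])
  fix E \<chi> assume C: "(E, \<chi>) \<in> blowup F0 GK"
  \<comment> \<open>Every centre has y or z equal to 0 or \<infinity>, so this set contains none of
    them.\<close>
  let ?U = "{(Fin y, Fin z) | y z. y \<noteq> 0 \<and> z \<noteq> 0 \<and> N False y \<noteq> 0}"
  have US: "?U \<inter> GS = {}"
  proof -
    have "centre_pt (gamma q t \<Theta> i s) \<notin> ?U" for i s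
      by (cases i; cases s) (auto simp: centre_gamma)
    thus ?thesis using GS_iff by (metis (no_types, lifting) disjoint_iff)
  qed
  have gen: "\<exists>Y. finite Y \<and> (\<forall>y c. y \<notin> Y \<longrightarrow> c \<noteq> 0 \<longrightarrow> (y, c) \<in> D \<and> \<psi> (y, c) \<in> ?U)"
    if F: "(D, \<psi>) \<in> F0" for D \<psi>
  proof -
    have D: "D = UNIV" using that by (auto simp: F0_def)
    obtain i j where \<psi>: "\<psi> = hch 0 i j" using F unfolding F0_eq hirz_def by blast
    \<comment> \<open>The reciprocals are included because the base coordinate of a chart may be
      1/y.\<close>
    let ?Y = "{0, tTheta t \<Theta> Pls, tTheta t \<Theta> Mns, 1 / tTheta t \<Theta> Pls, 1 / tTheta t \<Theta> Mns}"
    have "\<psi> (y, c) \<in> ?U" if y: "y \<notin> ?Y" and "c \<noteq> 0" for y c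
    proof -
      have inv: "y = 1 / T" if "1 / y = T" for T using that by auto
      have "y \<noteq> tTheta t \<Theta> s \<and> 1 / y \<noteq> tTheta t \<Theta> s" for s
        using y by (cases s) (auto dest: inv)
      hence "N False y \<noteq> 0" "N False (1 / y) \<noteq> 0" using N_zero_iff by blast+
      thus ?thesis using y \<open>c \<noteq> 0\<close> by (auto simp: \<psi> hch_def fl_def tw_def)
    qed
    thus ?thesis using D by (intro exI[of _ ?Y]) simp
  qed
  have "\<exists>x\<in>E. \<chi> x \<in> Away ` ?U" by (rule G.chart_meets[OF gen US C])
  moreover have "Away ` ?U \<subseteq> phi_points q t \<Theta>" using US unfolding phi_points_eq by blast
  ultimately show "\<exists>b\<in>E. \<chi> b \<in> phi_points q t \<Theta>" by blast
qed

lemma birational_phi: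
  "birational_map (blowup F0 GK) (blowup F2 BK) (phi_points q t \<Theta>) (phi q t \<Theta>)"
  by (rule birational_map_of_biregular[OF biregular_Phi dense_phi_points Phi_phi])

section \<open>Images of curves\<close>

lemma Phi_closure: "A \<subseteq> pts (blowup F0 GK) \<Longrightarrow>
    Phi ` zariski_closure (blowup F0 GK) A = zariski_closure (blowup F2 BK) (Phi ` A)"
  by (rule biregular_closure_image[OF biregular_Phi])

lemma bij_Phi_image: "A \<subseteq> pts (blowup F0 GK) \<Longrightarrow> Phi ` A = B \<Longrightarrow> bij_betw Phi A B"
  using bij_betw_subset[OF bij_Phi] by blast

lemma Away_diff_subset: "Away ` (C - GS) \<subseteq> pts (blowup F0 GK)" "Away ` (C - BS) \<subseteq> pts (blowup F2 BK)"
  by auto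

lemma Phi_strict_transform:
  "Phi ` strict_transform F0 GK C = zariski_closure (blowup F2 BK) (Phi ` Away ` (C - GS))"
  unfolding strict_transform_def by (rule Phi_closure[OF Away_diff_subset(1)])

text \<open>The fibre less its centre is mapped onto the finite slopes at \<beta>_t; taking closures
  completes the exceptional line.\<close>

lemma Phi_Vt: "Phi ` Vt q t \<Theta> s = Eexc q t \<Theta> It s"
proof -
  let ?y = "tTheta t \<Theta> s" and ?p = "centre_pt (beta q t \<Theta> It s)"
  have n: "N1 False ?y ?y \<noteq> 0" using N1_root by simp
  have "Phi ` Away ` ({(y, z). y = Fin ?y} - GS) = range (\<lambda>m. Exc ?p (Fin m))" (is "?L = ?R")
  proof (intro equalityI subsetI)
    fix x assume "x \<in> ?L"
    then obtain w where w: "(Fin ?y, w) \<notin> GS" "x = Phi (Away (Fin ?y, w))" by auto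
    hence "w \<noteq> Fin 0" using GS_root_iff by simp
    then obtain m where "fm (N1 False ?y ?y) (R1 False ?y ?y) w = Fin m"
      using fm_Infty_iff by (metis p1.exhaust)
    thus "x \<in> ?R" using w(2) by (simp add: centre_beta)
  next
    fix x assume "x \<in> ?R"
    then obtain m where x: "x = Exc ?p (Fin m)" by blast
    define w where "w = gm (N1 False ?y ?y) (R1 False ?y ?y) (Fin m)"
    have "w \<noteq> Fin 0" unfolding w_def using gm_Fin_0_iff[OF n] by (metis p1.distinct(1))
    hence "(Fin ?y, w) \<in> {(y, z). y = Fin ?y} - GS" using GS_root_iff by simp
    moreover have "Phi (Away (Fin ?y, w)) = x"
      unfolding w_def using fm_gm[OF n] by (simp add: x centre_beta del: gm.simps)
    ultimately show "x \<in> ?L" by blast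
  qed
  thus ?thesis unfolding Vt_def Phi_strict_transform Eexc_def
    by (simp add: B.closure_exc_line[OF betaI])
qed

text \<open>The finite slopes at \<gamma>_t are mapped onto the fibre less \<beta>_t, and the
  closures of both sides are the two curves.\<close>

lemma Phi_Fexc_It: "Phi ` Fexc q t \<Theta> It s = Dt q t \<Theta> s"
proof -
  let ?y = "tTheta t \<Theta> s" and ?p = "centre_pt (gamma q t \<Theta> It s)"
  let ?D = "F2_0 ` {(u, v). u = ?y} \<union> F2_1 ` {(u1, v1). u1 = ?y}"
  have n: "N1 False ?y ?y \<noteq> 0" using N1_root by simp
  have D: "?D = {(Fin ?y, w) | w. True}"
  proof (intro equalityI subsetI)
    fix x :: "p1 \<times> p1" assume "x \<in> {(Fin ?y, w) | w. True}"
    then obtain w where x: "x = (Fin ?y, w)" by blast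
    show "x \<in> ?D"
    proof (cases w)
      case (Fin v)
      hence "x = F2_0 (?y, v)" by (simp add: x F2_0_def)
      thus ?thesis by blast
    next
      case Infty
      hence "x = F2_1 (?y, 0)" by (simp add: x F2_1_def)
      thus ?thesis by blast
    qed
  qed (auto simp: F2_0_def F2_1_def)
  have "Phi ` range (\<lambda>m. Exc ?p (Fin m)) = Away ` (?D - BS)" (is "?L = ?R")
    unfolding D
  proof (intro equalityI subsetI)
    fix x assume "x \<in> ?L"
    then obtain m where x: "x = Phi (Exc ?p (Fin m))" by blast
    thus "x \<in> Away ` ({(Fin ?y, w) | w. True} - BS)"
      using BS_root_iff fm_eq_centre_iff[OF n] by (auto simp: centre_gamma simp del: fm.simps)
  next
    fix x assume "x \<in> Away ` ({(Fin ?y, w) | w. True} - BS)"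
    then obtain w where w: "x = Away (Fin ?y, w)" "w \<noteq> Fin (- R False ?y / c)" using BS_root_iff by auto
    then obtain m where m: "gm (N1 False ?y ?y) (R False ?y) w = Fin m"
      using gm_Infty_iff by (metis p1.exhaust)
    have "x = Phi (Exc ?p (Fin m))"
      using fm_gm[OF n, of "R False ?y" w] m by (simp add: w(1) centre_gamma del: fm.simps)
    thus "x \<in> ?L" by blast
  qed
  moreover have "range (\<lambda>m. Exc ?p (Fin m)) \<subseteq> pts (blowup F0 GK)"
    using gammaI by auto
  ultimately show ?thesis
    unfolding Dt_def strict_transform_def Fexc_def G.closure_exc_line[OF gammaI, symmetric]
    by (simp add: Phi_closure)
qed

lemma Phi_exc_line:
  assumes "k \<in> GK" "k' \<in> BK" "bm (centre_pt k) = centre_pt k'" "\<not> root (centre_pt k)"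
  shows "Phi ` exc_line k = exc_line k'"
proof -
  have "dB (centre_pt k) \<noteq> 0" using assms by (intro dB_nonzero) auto
  from aff_inverse(2)[OF this] have "surj (aff (dA (centre_pt k)) (dB (centre_pt k)))"
    by (metis surjI)
  thus ?thesis unfolding exc_line_def
    by (auto simp: Phi_Exc[OF assms(4)] assms(3) image_iff) (metis surjD)
qed

lemma Phi_Away_image:
  assumes C: "\<forall>p\<in>C. \<not> root p"
  shows "Phi ` Away ` (C - GS) = Away ` (bm ` C - BS)"
proof (intro equalityI subsetI)
  fix x assume "x \<in> Phi ` Away ` (C - GS)"
  then obtain p where p: "p \<in> C" "p \<notin> GS" "x = Phi (Away p)" by blast
  thus "x \<in> Away ` (bm ` C - BS)" using bm_BS_iff[OF bspec[OF C p(1)]] Phi_Away[OF bspec[OF C p(1)]] by blast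
next
  fix x assume "x \<in> Away ` (bm ` C - BS)"
  then obtain p where p: "p \<in> C" "bm p \<notin> BS" "x = Away (bm p)" by blast
  hence "x = Phi (Away p)" "p \<notin> GS"
    using bm_BS_iff[OF bspec[OF C p(1)]] Phi_Away[OF bspec[OF C p(1)]] by simp_all
  thus "x \<in> Phi ` Away ` (C - GS)" using p(1) by blast
qed

text \<open>On root fibres \<open>Phi\<close> is not given by \<open>bm\<close>, so points of the
  section there are discarded. This does not change the closure: by \<open>zar_curve\<close>, points
  over other base values accumulate at them.\<close>

lemma closure_section:
  assumes X: "alg_surface (blowup X K)" and ch: "({a \<in> UNIV. hch d False True a \<notin> S}, Away \<circ> hch d False True) \<in> blowup X K"
  shows "zariski_closure (blowup X K) (Away ` ({(y, z). z = Infty} - S)) =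
    zariski_closure (blowup X K) (Away ` ({p. snd p = Infty \<and> \<not> root p} - S))"
proof (rule zariski_closure_eqI)
  fix p U
  assume p: "p \<in> Away ` ({(y, z). z = Infty} - S)" and U: "zariski_open (blowup X K) U" "p \<in> U"
  obtain x where x: "p = Away x" "snd x = Infty" "x \<notin> S" using p by auto
  show "U \<inter> Away ` ({p. snd p = Infty \<and> \<not> root p} - S) \<noteq> {}"
  proof (cases "root x")
    case True
    then obtain y where y: "x = (Fin y, Infty)" using x(2) by (cases x rule: root.cases) auto
    let ?h = "\<lambda>x :: complex \<times> complex. (fst x, 0 :: complex)"
    have "\<forall>\<^sub>F x in zar (?h (y, 0)). x \<in> {a \<in> UNIV. hch d False True a \<notin> S} \<and> (Away \<circ> hch d False True) x \<in> U"
      using zariski_openD[OF U(1) ch, of "(y, 0)"] x U(2) y by (simp add: hch_def fl_def)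
    from zar_curve[where h = ?h, OF this reg2_Pair[OF reg_fst reg_const], of "tTheta t \<Theta> ` UNIV"]
    obtain x' :: "complex \<times> complex" where x': "fst x' \<notin> range (tTheta t \<Theta>)" "hch d False True (fst x', 0) \<notin> S"
      "Away (hch d False True (fst x', 0)) \<in> U"
      using finite_pm by (auto simp del: split_paired_Ex)
    have "\<not> root (Fin (fst x'), Infty)" using x'(1) N_zero_iff by auto
    thus ?thesis using x' by (auto simp: hch_def fl_def)
  qed (use x U(2) in auto)
qed auto

text \<open>The lines z = 0, z = \<infinity>, y = 0 and y = \<infinity> correspond to
  \<open>H_curve\<close>, \<open>C_curve\<close>, \<open>D0_curve\<close> and
  \<open>Dinf_curve\<close>. The two sections cross the root fibres, so their images are compared
  through dense parts; the two fibres are mapped directly by \<open>bm\<close>.\<close>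

lemma Phi_Jt: "Phi ` Jt q t \<Theta> = It_curve q t \<Theta>"
proof -
  \<comment> \<open>Over finite u the curve C is the graph of \<open>- R / c\<close>, the image of z
    = \<infinity>.\<close>
  have eqC: "v = - (R False u / c)" if "(u - 1) * (u - t) = (1 - q) * v" for u v
    using that q by (simp add: R_c field_simps)
  \<comment> \<open>Over infinity R = q, so the image of z = \<infinity> has v2 = 1/(1 - q), which
    is the point (0, 1 - q) of the last chart of C.\<close>
  have bmI: "bm (Infty, Infty) = (Infty, Fin (1 / (1 - q)))"
  proof -
    have "q / c = 1 / (q - 1)" using q by (simp add: c_eq)
    hence "- (q / c) = 1 / (1 - q)" by (metis minus_diff_eq minus_divide_right)
    thus ?thesis by (simp add: R_True_0)
  qed
  note st = Phi_strict_transform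
  have F: "(UNIV, hch 0 False True) \<in> F0" "(UNIV, hch 2 False True) \<in> F2"
    by (simp_all add: F0_eq F2_eq hirzI)
  have D0: "D0_curve = {(y, w). y = Fin 0}"
  proof (intro equalityI subsetI)
    fix x :: "p1 \<times> p1" assume "x \<in> {(y, w). y = Fin 0}"
    then obtain w where x: "x = (Fin 0, w)" by auto
    show "x \<in> D0_curve"
    proof (cases w)
      case (Fin v)
      hence "x = F2_0 (0, v)" by (simp add: x F2_0_def)
      thus ?thesis unfolding D0_curve_def by blast
    next
      case Infty
      hence "x = F2_1 (0, 0)" by (simp add: x F2_1_def)
      thus ?thesis unfolding D0_curve_def by blast
    qed
  qed (auto simp: D0_curve_def F2_0_def F2_1_def)
  have Dinf: "Dinf_curve = {(y, w). y = Infty}"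
  proof (intro equalityI subsetI)
    fix x :: "p1 \<times> p1" assume "x \<in> {(y, w). y = Infty}"
    then obtain w where x: "x = (Infty, w)" by auto
    show "x \<in> Dinf_curve"
    proof (cases w)
      case (Fin v)
      hence "x = F2_2 (0, v)" by (simp add: x F2_2_def)
      thus ?thesis unfolding Dinf_curve_def by blast
    next
      case Infty
      hence "x = F2_3 (0, 0)" by (simp add: x F2_3_def)
      thus ?thesis unfolding Dinf_curve_def by blast
    qed
  qed (auto simp: Dinf_curve_def F2_2_def F2_3_def)
  have H: "H_curve = {(y, w). w = Infty}"
  proof (intro equalityI subsetI)
    fix x :: "p1 \<times> p1" assume "x \<in> {(y, w). w = Infty}"
    then obtain y where x: "x = (y, Infty)" by auto
    show "x \<in> H_curve"
    proof (cases y)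
      case (Fin u)
      hence "x = F2_1 (u, 0)" by (simp add: x F2_1_def)
      thus ?thesis unfolding H_curve_def by blast
    next
      case Infty
      hence "x = F2_3 (0, 0)" by (simp add: x F2_3_def)
      thus ?thesis unfolding H_curve_def by blast
    qed
  qed (auto simp: H_curve_def F2_1_def F2_3_def split: if_splits)
  have C: "C_curve q t = bm ` {(y, w). w = Infty}"
  proof (intro equalityI subsetI)
    fix x assume "x \<in> C_curve q t"
    then consider u v where "x = F2_0 (u, v)" "(u - 1) * (u - t) = (1 - q) * v"
      | u v where "x = F2_1 (u, v)" "(u - 1) * (u - t) * v = 1 - q"
      | u v where "x = F2_3 (u, v)" "(1 - u) * (1 - t * u) * v = 1 - q"
      unfolding C_curve_def by blast
    hence "(\<exists>u. x = bm (Fin u, Infty)) \<or> x = bm (Infty, Infty)"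
    proof cases
      case 1
      hence "x = bm (Fin u, Infty)" by (simp add: F2_0_def eqC[OF 1(2)])
      thus ?thesis by blast
    next
      case 2
      have "v \<noteq> 0" using 2(2) q by auto
      moreover from this have "(u - 1) * (u - t) = (1 - q) * (1 / v)" using 2(2) by (simp add: field_simps)
      ultimately have "x = bm (Fin u, Infty)" using 2(1) by (simp add: F2_1_def eqC)
      thus ?thesis by blast
    next
      case 3
      have v: "v \<noteq> 0" using 3(2) q by auto
      show ?thesis
      proof (cases "u = 0")
        case True
        thus ?thesis using 3 v q by (simp add: F2_3_def bmI del: bm.simps)
      next
        case False
        \<comment> \<open>Dividing the equation of the last chart by u^2 v gives the standard
          equation at (1/u, 1/(u^2 v)).\<close>
        have "(1 / u - 1) * (1 / u - t) = (1 - u) * (1 - t * u) * v * (1 / (u\<^sup>2 * v))"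
          using False v by (simp add: field_simps power2_eq_square)
        also have "\<dots> = (1 - q) * (1 / (u\<^sup>2 * v))" by (simp only: 3(2))
        finally have "x = bm (Fin (1 / u), Infty)" using 3(1) False v by (simp add: F2_3_def eqC)
        thus ?thesis by blast
      qed
    qed
    thus "x \<in> bm ` {(y, w). w = Infty}" by blast
  next
    fix x assume "x \<in> bm ` {(y, w). w = Infty}"
    then obtain y where y: "x = bm (y, Infty)" by blast
    show "x \<in> C_curve q t"
    proof (cases y)
      case (Fin u)
      have "x = F2_0 (u, - (R False u / c))" using y Fin by (simp add: F2_0_def)
      moreover have "(u - 1) * (u - t) = (1 - q) * - (R False u / c)"
        using q by (simp add: R_c field_simps)
      ultimately show ?thesis unfolding C_curve_def by blast
    next
      case Infty
      have "x = F2_3 (0, 1 - q)" using y Infty q by (simp add: F2_3_def bmI del: bm.simps)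
      thus ?thesis unfolding C_curve_def by (intro UnI2 image_eqI[of _ _ "(0, 1 - q)"]) simp_all
    qed
  qed
  have fib: "Phi ` strict_transform F0 GK {(y, z). y = u} = strict_transform F2 BK {(y, z). y = u}"
    if u: "u = Fin 0 \<or> u = Infty" for u
  proof -
    \<comment> \<open>Neither 0 nor infinity is a root, so \<open>bm\<close> permutes the points of
      these fibres.\<close>
    have nr: "\<forall>p\<in>{(y, z). y = u}. \<not> root p" using u by auto
    have "bm ` {(y, z). y = u} = {(y, z). y = u}"
    proof (intro equalityI subsetI)
      fix p :: "p1 \<times> p1" assume p: "p \<in> {(y, z). y = u}"
      hence "bi p \<in> {(y, z). y = u}" by (cases p rule: root.cases) auto
      thus "p \<in> bm ` {(y, z). y = u}" using bm_bi[OF bspec[OF nr p]] by (metis imageI)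
    next
      fix p :: "p1 \<times> p1" assume "p \<in> bm ` {(y, z). y = u}"
      then obtain p' where "p = bm p'" "p' \<in> {(y, z). y = u}" by blast
      thus "p \<in> {(y, z). y = u}" by (cases p' rule: root.cases) auto
    qed
    thus ?thesis unfolding st Phi_Away_image[OF nr] by (simp add: strict_transform_def)
  qed
  have z0: "Phi ` strict_transform F0 GK {(y, z). z = Fin 0} = strict_transform F2 BK H_curve"
  proof -
    have nr: "\<forall>p\<in>{p. snd p = Fin 0 \<and> \<not> root p}. \<not> root p" by simp
    \<comment> \<open>Where z = 0 crosses a root fibre there is a centre, which is removed
      anyway.\<close>
    have "{(y, z). z = Fin 0} - GS = {p. snd p = Fin 0 \<and> \<not> root p} - GS"
      using GS_root_iff by (auto elim!: rootE)
    moreover have "bm ` {p. snd p = Fin 0 \<and> \<not> root p} = {p. snd p = Infty \<and> \<not> root p}"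
    proof (intro equalityI subsetI)
      fix p :: "p1 \<times> p1" assume p: "p \<in> {p. snd p = Infty \<and> \<not> root p}"
      hence "bi p \<in> {p. snd p = Fin 0 \<and> \<not> root p}" by (cases p rule: root.cases) auto
      thus "p \<in> bm ` {p. snd p = Fin 0 \<and> \<not> root p}" using bm_bi p by (metis (mono_tags, lifting) imageI mem_Collect_eq)
    next
      fix p :: "p1 \<times> p1" assume "p \<in> bm ` {p. snd p = Fin 0 \<and> \<not> root p}"
      then obtain p' where "p = bm p'" "snd p' = Fin 0" "\<not> root p'" by blast
      thus "p \<in> {p. snd p = Infty \<and> \<not> root p}" by (cases p' rule: root.cases) auto
    qed
    ultimately show ?thesis
      unfolding st H using closure_section[OF B.alg_surface_blowup B.away_chart[OF F(2)]]
      by (simp add: strict_transform_def Phi_Away_image[OF nr])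
  qed
  have zinf: "Phi ` strict_transform F0 GK {(y, z). z = Infty} = strict_transform F2 BK (C_curve q t)"
  proof -
    have nr: "\<forall>p\<in>{p. snd p = Infty \<and> \<not> root p}. \<not> root p" by simp
    have "Phi ` strict_transform F0 GK {(y, z). z = Infty} =
        Phi ` zariski_closure (blowup F0 GK) (Away ` ({p. snd p = Infty \<and> \<not> root p} - GS))"
      unfolding strict_transform_def closure_section[OF G.alg_surface_blowup G.away_chart[OF F(1)]] ..
    also have "\<dots> = zariski_closure (blowup F2 BK) (Away ` (bm ` {p. snd p = Infty \<and> \<not> root p} - BS))"
      using Phi_closure[OF Away_diff_subset(1)] Phi_Away_image[OF nr] by simp
    \<comment> \<open>A point of z = \<infinity> on a root fibre is sent by \<open>bm\<close> to
      \<beta>_t, so removing \<open>BS\<close> discards exactly the points over the roots that were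
      left out.\<close>
    also have "bm ` {p. snd p = Infty \<and> \<not> root p} - BS = C_curve q t - BS"
      unfolding C
    proof (intro equalityI subsetI)
      fix x assume "x \<in> bm ` {(y, w). w = Infty} - BS"
      then obtain p where p: "x = bm p" "snd p = Infty" "bm p \<notin> BS" by auto
      have "\<not> root p"
      proof
        assume "root p"
        then obtain y w where y: "p = (Fin y, w)" "N False y = 0" by (rule rootE)
        hence "bm p \<in> BS" using p(2) BS_root_iff by simp
        thus False using p(3) by blast
      qed
      thus "x \<in> bm ` {p. snd p = Infty \<and> \<not> root p} - BS"
        using p by (intro DiffI image_eqI[of _ bm p]) simp_all
    qed auto
    finally show ?thesis unfolding strict_transform_def .
  qed
  show ?thesis
    unfolding Jt_def It_curve_def image_Un z0 zinf fib[of "Fin 0", simplified] fib[of Infty, simplified] D0 Dinf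
    by blast
qed

section \<open>Complements of the boundary curves\<close>

lemma Jt_subset: "Jt q t \<Theta> \<subseteq> pts (blowup F0 GK)"
  unfolding Jt_def strict_transform_def by (intro Un_least zariski_closure_subset_pts)

lemma zariski_open_complement_Jt: "zariski_open (blowup F0 GK) (pts (blowup F0 GK) - Jt q t \<Theta>)"
  unfolding Jt_def strict_transform_def Diff_Un
  by (intro zariski_open_Int zariski_open_closure)

lemma zariski_open_complement_It:
  "zariski_open (blowup F2 BK) (pts (blowup F2 BK) - It_curve q t \<Theta>)"
  unfolding It_curve_def strict_transform_def Diff_Un
  by (intro zariski_open_Int zariski_open_closure)

lemma biregular_qOka: "biregular (qOka q t \<Theta>) (qOka' q t \<Theta>) Phi"
  unfolding qOka_def qOka'_def Psurf_def Psurf'_def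
proof (rule biregular_restrict[OF biregular_Phi zariski_open_complement_Jt zariski_open_complement_It])
  show "Phi ` (pts (blowup F0 GK) - Jt q t \<Theta>) = pts (blowup F2 BK) - It_curve q t \<Theta>"
    using bij_Phi Jt_subset Phi_Jt by (metis bij_betw_def inj_on_image_set_diff Diff_subset)
qed

end

theorem proposition4p4:
  fixes q t :: complex and \<Theta> :: "idx \<Rightarrow> complex"
  assumes "q \<noteq> 0" and "q \<noteq> 1"
    and "\<forall>i. \<Theta> i \<noteq> 0"
    and "(\<Theta> I0)\<^sup>2 \<noteq> 1" and "(\<Theta> I1)\<^sup>2 \<noteq> 1" and "(\<Theta> It)\<^sup>2 \<noteq> 1" and "(\<Theta> Iinf)\<^sup>2 \<noteq> q"
    and "t \<noteq> 0" and "t \<notin> Sq q \<Theta>"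
  shows "birational_map (Psurf q t \<Theta>) (Psurf' q t \<Theta>) (phi_points q t \<Theta>) (phi q t \<Theta>) \<and>
    (\<exists>\<Phi>. (\<forall>p\<in>phi_points q t \<Theta>. \<Phi> p = phi q t \<Theta> p) \<and>
      biregular (Psurf q t \<Theta>) (Psurf' q t \<Theta>) \<Phi> \<and>
      (\<forall>s. bij_betw \<Phi> (Vt q t \<Theta> s) (Eexc q t \<Theta> It s)) \<and>
      (\<forall>s. bij_betw \<Phi> (Fexc q t \<Theta> It s) (Dt q t \<Theta> s)) \<and>
      (\<forall>i\<in>{I0, I1}. \<forall>s. bij_betw \<Phi> (Fexc q t \<Theta> i s) (Eexc q t \<Theta> i s)) \<and>
      (\<forall>s. bij_betw \<Phi> (Fexc q t \<Theta> Iinf s) (Eexc q t \<Theta> Iinf (opp s))) \<and>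
      bij_betw \<Phi> (Jt q t \<Theta>) (It_curve q t \<Theta>) \<and>
      biregular (qOka q t \<Theta>) (qOka' q t \<Theta>) \<Phi>)"
proof -
  \<comment> \<open>The parameter \<open>c\<close> is the constant factor in the denominator of the
    given formula; it is nonzero by the conditions on \<open>q\<close>.\<close>
  interpret oka "q * (q - 1)" q t \<Theta>
    by unfold_locales (use assms in auto)
  have Fexc: "Fexc q t \<Theta> i s \<subseteq> pts (blowup F0 GK)" for i s
    unfolding Fexc_def by (rule G.exc_line_subset[OF gammaI])
  have Vt: "Vt q t \<Theta> s \<subseteq> pts (blowup F0 GK)" for s
    unfolding Vt_def strict_transform_def by (rule zariski_closure_subset_pts)
  have exc: "bij_betw Phi (Fexc q t \<Theta> i s) (Eexc q t \<Theta> i' s')"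
    if "bm (centre_pt (gamma q t \<Theta> i s)) = centre_pt (beta q t \<Theta> i' s')" "i \<noteq> It" for i s i' s'
    by (rule bij_Phi_image[OF Fexc]) (use that root_gamma in
        \<open>simp add: Fexc_def Eexc_def Phi_exc_line[OF gammaI betaI]\<close>)
  have "\<forall>p\<in>phi_points q t \<Theta>. Phi p = phi q t \<Theta> p" using Phi_phi by simp
  moreover have "\<forall>i\<in>{I0, I1}. \<forall>s. bij_betw Phi (Fexc q t \<Theta> i s) (Eexc q t \<Theta> i s)"
    using exc bm_centre by blast
  moreover have "\<forall>s. bij_betw Phi (Fexc q t \<Theta> Iinf s) (Eexc q t \<Theta> Iinf (opp s))"
    using exc bm_centre by blast
  ultimately show ?thesis
    using birational_phi biregular_Phi biregular_qOka bij_Phi_image[OF Vt Phi_Vt]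
      bij_Phi_image[OF Fexc Phi_Fexc_It] bij_Phi_image[OF Jt_subset Phi_Jt]
    unfolding Psurf_def Psurf'_def by blast
qed

end
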